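(* Let $d$ be a positive integer, let $q\in\mathbb{C}\setminus\{0\}$, let $m\in\{1,\dots,d\}$ and set $E_m:=1/m$. Let $z$ be an indeterminate over $\mathbb{C}$. There exists a unique linear Markov trace $$\mathrm{tr}_{d,m}:\bigcup_{n\ge0}Y_{d,n}(q)^{(\mathrm{br})}\longrightarrow\mathbb{C}[z]$$ defined inductively on $Y_{d,n}(q)^{(\mathrm{br})}$, for all $n\ge0$, by the following rules, for all $a,b\in Y_{d,n}(q)^{(\mathrm{br})}$: (i) $\mathrm{tr}_{d,m}(ab)=\mathrm{tr}_{d,m}(ba)$; (ii) $\mathrm{tr}_{d,m}(1)=1$; (iii) $\mathrm{tr}_{d,m}(ag_n)=z\,\mathrm{tr}_{d,m}(a)$ (Markov property); (iv) $\mathrm{tr}_{d,m}(ae_n)=E_m\,\mathrm{tr}_{d,m}(a)$; (v) $\mathrm{tr}_{d,m}(ae_ng_n)=z\,\mathrm{tr}_{d,m}(a)$. Moreover, for all $a\in\bigcup_{n\ge0}Y_{d,n}(q)^{(\mathrm{br})}$ one has $\mathrm{tr}_{d,m}(a)=\mathrm{tr}_{d,D}(a)$, where $D$ is any subset of $\mathbb{Z}/d\mathbb{Z}$ with $|D|=m$; in this case $E_m=E_D$, where $E_D:=\mathrm{tr}_{d,D}(e_i)=1/|D|$.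
   Context: The Yokonuma--Hecke algebra $Y_{d,n}(q)$ is the $\mathbb{C}$-algebra generated by $g_1,\dots,g_{n-1},t_1,\dots,t_n$ with relations: $g_ig_jg_i=g_jg_ig_j$ for $|i-j|=1$; $g_ig_j=g_jg_i$ for $|i-j|>1$; $t_it_j=t_jt_i$; $t_jg_i=g_it_{s_i(j)}$ where $s_i=(i,i+1)$; $t_j^d=1$; and $g_i^2=1+(q-q^{-1})e_ig_i$, where $e_i=\frac1d\sum_{s=0}^{d-1}t_i^st_{i+1}^{d-s}$. Set $Y_{d,0}(q)=\mathbb{C}$; there are natural inclusions $Y_{d,n}(q)\subset Y_{d,n+1}(q)$. $Y_{d,n}(q)^{(\mathrm{br})}$ is the subalgebra of $Y_{d,n}(q)$ generated by $g_1,\dots,g_{n-1}$; it is the image of $\mathbb{C}B_n$ ($B_n$ the braid group) under $\sigma_i\mapsto g_i$. For a non-empty $D\subseteq\mathbb{Z}/d\mathbb{Z}$, let $X_D=(\mathrm{x}_1,\dots,\mathrm{x}_{d-1})$ be the solution of the E-system $\sum_{s=0}^{d-1}x_{k+s}x_{d-s}=x_k\sum_{s=0}^{d-1}x_sx_{d-s}$ ($1\le k\le d-1$, indices modulo $d$, $x_0=1$) parametrized by $D$, namely $\mathrm{x}_k=\frac{1}{|D|}\sum_{j\in D}\exp(2\pi\sqrt{-1}\,kj/d)$. The specialized trace $\mathrm{tr}_{d,D}:\bigcup_{n\ge0}Y_{d,n}(q)\to\mathbb{C}[z]$ is the unique linear map with, for all $n\ge0$ and all $a,b\in Y_{d,n}(q)$: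 $\mathrm{tr}_{d,D}(ab)=\mathrm{tr}_{d,D}(ba)$; $\mathrm{tr}_{d,D}(1)=1$; $\mathrm{tr}_{d,D}(ag_n)=z\,\mathrm{tr}_{d,D}(a)$; $\mathrm{tr}_{d,D}(at_{n+1}^k)=\mathrm{x}_k\,\mathrm{tr}_{d,D}(a)$ for $1\le k\le d-1$. (Its existence is known.)
   Formalization: For q = ±1 and d > 1 the element e_n does not lie in the subalgebra generated by the g_i, so rules (iv) and (v) are imposed only for those a for which ae_n, respectively ae_ng_n, lies in that subalgebra; for q² ≠ 1 this holds for every a. *)

theory Defs
  imports
    Complex_Main
    "HOL-Library.FuncSet"
    "HOL-Library.Poly_Mapping"
    "HOL-Computational_Algebra.Polynomial"
    "HOL-Combinatorics.Transposition"
    "HOL-Algebra.QuotRing"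
    "HOL-Algebra.Generated_Rings"
begin

section \<open>Free associative algebras\<close>

text \<open>The free monoid is a type of its own, written additively, because \<^typ>\<open>'a \<Rightarrow>\<^sub>0 'b\<close>
  carries the convolution product exactly when the keys form an instance of \<^class>\<open>monoid_add\<close>
  (not necessarily commutative).\<close>

datatype 'a fmon = FMon (letters: "'a list")

instantiation fmon :: (type) monoid_add
begin
definition zero_fmon_def: "0 = FMon []"
definition plus_fmon_def: "u + v = FMon (letters u @ letters v)"
instance
  by standard (simp_all add: zero_fmon_def plus_fmon_def)
end

type_synonym 'a falg = "'a fmon \<Rightarrow>\<^sub>0 complex"

definition free_var :: "'a \<Rightarrow> 'a falg" where
  "free_var x = Poly_Mapping.single (FMon [x]) 1"

definition free_const :: "complex \<Rightarrow> 'a falg" where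
  "free_const c = Poly_Mapping.single 0 c"

definition free_algebra :: "'a set \<Rightarrow> 'a falg ring" where
  "free_algebra A =
     \<lparr>carrier = {p. \<forall>w \<in> Poly_Mapping.keys p. set (letters w) \<subseteq> A},
      mult = (*), one = 1, zero = 0, add = (+)\<rparr>"


section \<open>The Yokonuma--Hecke algebra\<close>

datatype yh_gen = Gg nat | Gt nat

definition yh_gens :: "nat \<Rightarrow> yh_gen set" where
  "yh_gens n = Gg ` {i. 1 \<le> i \<and> i < n} \<union> Gt ` {1..n}"

abbreviation fg :: "nat \<Rightarrow> yh_gen falg" where "fg i \<equiv> free_var (Gg i)"
abbreviation ft :: "nat \<Rightarrow> yh_gen falg" where "ft j \<equiv> free_var (Gt j)"

definition fe :: "nat \<Rightarrow> nat \<Rightarrow> yh_gen falg" where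
  "fe d i = free_const (1 / of_nat d) * (\<Sum>s<d. ft i ^ s * ft (i + 1) ^ (d - s))"

text \<open>A defining relation \<open>l = r\<close> is represented by the element \<open>l - r\<close>.\<close>

definition yh_rels :: "nat \<Rightarrow> complex \<Rightarrow> nat \<Rightarrow> yh_gen falg set" where
  "yh_rels d q n =
     {fg i * fg j * fg i - fg j * fg i * fg j | i j.
        1 \<le> i \<and> i < n \<and> 1 \<le> j \<and> j < n \<and> \<bar>int i - int j\<bar> = 1} \<union>
     {fg i * fg j - fg j * fg i | i j.
        1 \<le> i \<and> i < n \<and> 1 \<le> j \<and> j < n \<and> \<bar>int i - int j\<bar> > 1} \<union>
     {ft i * ft j - ft j * ft i | i j. 1 \<le> i \<and> i \<le> n \<and> 1 \<le> j \<and> j \<le> n} \<union>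
     {ft j * fg i - fg i * ft (transpose i (i + 1) j) | i j.
        1 \<le> i \<and> i < n \<and> 1 \<le> j \<and> j \<le> n} \<union>
     {ft j ^ d - 1 | j. 1 \<le> j \<and> j \<le> n} \<union>
     {fg i ^ 2 - (1 + free_const (q - inverse q) * (fe d i * fg i)) | i. 1 \<le> i \<and> i < n}"

definition yh_ideal :: "nat \<Rightarrow> complex \<Rightarrow> nat \<Rightarrow> yh_gen falg set" where
  "yh_ideal d q n = Idl\<^bsub>free_algebra (yh_gens n)\<^esub> (yh_rels d q n)"

definition YH :: "nat \<Rightarrow> complex \<Rightarrow> nat \<Rightarrow> yh_gen falg set ring" where
  "YH d q n = free_algebra (yh_gens n) Quot yh_ideal d q n"

definition yh_class :: "nat \<Rightarrow> complex \<Rightarrow> nat \<Rightarrow> yh_gen falg \<Rightarrow> yh_gen falg set" where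
  "yh_class d q n p = yh_ideal d q n +>\<^bsub>free_algebra (yh_gens n)\<^esub> p"

definition yh_scalar :: "nat \<Rightarrow> complex \<Rightarrow> nat \<Rightarrow> complex \<Rightarrow> yh_gen falg set" where
  "yh_scalar d q n c = yh_class d q n (free_const c)"

definition yh_g :: "nat \<Rightarrow> complex \<Rightarrow> nat \<Rightarrow> nat \<Rightarrow> yh_gen falg set" where
  "yh_g d q n i = yh_class d q n (fg i)"

definition yh_t :: "nat \<Rightarrow> complex \<Rightarrow> nat \<Rightarrow> nat \<Rightarrow> yh_gen falg set" where
  "yh_t d q n j = yh_class d q n (ft j)"

definition yh_e :: "nat \<Rightarrow> complex \<Rightarrow> nat \<Rightarrow> nat \<Rightarrow> yh_gen falg set" where
  "yh_e d q n i = yh_class d q n (fe d i)"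

text \<open>The natural map from level \<open>n\<close> to level \<open>n + 1\<close>: a coset of the ideal of level \<open>n\<close> is sent
  to the coset of the ideal of level \<open>n + 1\<close> that contains it (see \<open>yh_incl_class\<close> below).\<close>

definition yh_incl :: "nat \<Rightarrow> complex \<Rightarrow> nat \<Rightarrow> yh_gen falg set \<Rightarrow> yh_gen falg set" where
  "yh_incl d q n X = yh_ideal d q (Suc n) <+>\<^bsub>free_algebra (yh_gens (Suc n))\<^esub> X"

text \<open>The subring generated by the scalars and a set of elements is the
  \<open>\<complex>\<close>-subalgebra generated by these elements.\<close>

definition YH_br :: "nat \<Rightarrow> complex \<Rightarrow> nat \<Rightarrow> yh_gen falg set set" where
  "YH_br d q n =
     generate_ring (YH d q n) (range (yh_scalar d q n) \<union> yh_g d q n ` {i. 1 \<le> i \<and> i < n})"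


section \<open>Markov traces\<close>

text \<open>A linear map on the union of an ascending chain of algebras with values in \<open>\<complex>[z]\<close> is a
  family of linear maps, one on every level, that is compatible with the inclusions. The
  components are \<^const>\<open>extensional\<close>, so that equality of families is equality of maps.\<close>

definition linear_on_union ::
  "nat \<Rightarrow> complex \<Rightarrow> (nat \<Rightarrow> yh_gen falg set set) \<Rightarrow>
     (nat \<Rightarrow> yh_gen falg set \<Rightarrow> complex poly) \<Rightarrow> bool" where
  "linear_on_union d q A \<tau> \<longleftrightarrow>
     (\<forall>n. \<tau> n \<in> extensional (A n)) \<and>
     (\<forall>n. \<forall>a\<in>A n. \<forall>b\<in>A n. \<tau> n (a \<oplus>\<^bsub>YH d q n\<^esub> b) = \<tau> n a + \<tau> n b) \<and>
     (\<forall>n c. \<forall>a\<in>A n. \<tau> n (yh_scalar d q n c \<otimes>\<^bsub>YH d q n\<^esub> a) = Polynomial.smult c (\<tau> n a)) \<and>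
     (\<forall>n. \<forall>a\<in>A n. \<tau> (Suc n) (yh_incl d q n a) = \<tau> n a)"

text \<open>The solution of the E-system given by \<open>D\<close>; a subset of \<open>\<int>/d\<int>\<close> is represented by a set of
  residues in \<open>{0, \<dots>, d - 1}\<close>.\<close>

definition E_solution :: "nat \<Rightarrow> nat set \<Rightarrow> nat \<Rightarrow> complex" where
  "E_solution d D k =
     1 / of_nat (card D) * (\<Sum>j\<in>D. exp (2 * of_real pi * \<i> * of_nat k * of_nat j / of_nat d))"

text \<open>The indeterminate \<open>z\<close> is \<open>[:0, 1:]\<close>. There is no \<open>g\<^sub>0\<close>, so rules involving
  \<open>g\<^sub>n\<close> or \<open>e\<^sub>n\<close> are stated for \<open>n \<ge> 1\<close>.\<close>

definition is_specialized_trace ::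
  "nat \<Rightarrow> complex \<Rightarrow> nat set \<Rightarrow> (nat \<Rightarrow> yh_gen falg set \<Rightarrow> complex poly) \<Rightarrow> bool" where
  "is_specialized_trace d q D \<tau> \<longleftrightarrow>
     linear_on_union d q (\<lambda>n. carrier (YH d q n)) \<tau> \<and>
     (\<forall>n. \<forall>a\<in>carrier (YH d q n). \<forall>b\<in>carrier (YH d q n).
        \<tau> n (a \<otimes>\<^bsub>YH d q n\<^esub> b) = \<tau> n (b \<otimes>\<^bsub>YH d q n\<^esub> a)) \<and>
     (\<forall>n. \<tau> n \<one>\<^bsub>YH d q n\<^esub> = 1) \<and>
     (\<forall>n\<ge>1. \<forall>a\<in>carrier (YH d q n).
        \<tau> (Suc n) (yh_incl d q n a \<otimes>\<^bsub>YH d q (Suc n)\<^esub> yh_g d q (Suc n) n) = [:0, 1:] * \<tau> n a) \<and>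
     (\<forall>n. \<forall>a\<in>carrier (YH d q n). \<forall>k. 1 \<le> k \<and> k \<le> d - 1 \<longrightarrow>
        \<tau> (Suc n) (yh_incl d q n a \<otimes>\<^bsub>YH d q (Suc n)\<^esub>
                     (yh_t d q (Suc n) (Suc n) [^]\<^bsub>YH d q (Suc n)\<^esub> k)) =
          Polynomial.smult (E_solution d D k) (\<tau> n a))"

definition specialized_trace ::
  "nat \<Rightarrow> complex \<Rightarrow> nat set \<Rightarrow> nat \<Rightarrow> yh_gen falg set \<Rightarrow> complex poly" where
  "specialized_trace d q D = (THE \<tau>. is_specialized_trace d q D \<tau>)"

text \<open>In the last two rules the element on the left must lie in the domain of the trace. This is
  automatic if \<open>q\<^sup>2 \<noteq> 1\<close> (see \<open>yh_e_in_YH_br\<close> and \<open>yh_incl_YH_br\<close> below). If \<open>q\<^sup>2 = 1\<close> and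
  \<open>d > 1\<close>, then \<open>e\<^sub>n\<close> is not in the subalgebra generated by the \<open>g\<^sub>i\<close>.\<close>

definition is_braid_trace ::
  "nat \<Rightarrow> complex \<Rightarrow> nat \<Rightarrow> (nat \<Rightarrow> yh_gen falg set \<Rightarrow> complex poly) \<Rightarrow> bool" where
  "is_braid_trace d q m \<tau> \<longleftrightarrow>
     linear_on_union d q (YH_br d q) \<tau> \<and>
     (\<forall>n. \<forall>a\<in>YH_br d q n. \<forall>b\<in>YH_br d q n.
        \<tau> n (a \<otimes>\<^bsub>YH d q n\<^esub> b) = \<tau> n (b \<otimes>\<^bsub>YH d q n\<^esub> a)) \<and>
     (\<forall>n. \<tau> n \<one>\<^bsub>YH d q n\<^esub> = 1) \<and>
     (\<forall>n\<ge>1. \<forall>a\<in>YH_br d q n.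
        \<tau> (Suc n) (yh_incl d q n a \<otimes>\<^bsub>YH d q (Suc n)\<^esub> yh_g d q (Suc n) n) = [:0, 1:] * \<tau> n a) \<and>
     (\<forall>n\<ge>1. \<forall>a\<in>YH_br d q n.
        let x = yh_incl d q n a \<otimes>\<^bsub>YH d q (Suc n)\<^esub> yh_e d q (Suc n) n in
        x \<in> YH_br d q (Suc n) \<longrightarrow> \<tau> (Suc n) x = Polynomial.smult (1 / of_nat m) (\<tau> n a)) \<and>
     (\<forall>n\<ge>1. \<forall>a\<in>YH_br d q n.
        let x = yh_incl d q n a \<otimes>\<^bsub>YH d q (Suc n)\<^esub> yh_e d q (Suc n) n
                  \<otimes>\<^bsub>YH d q (Suc n)\<^esub> yh_g d q (Suc n) n in
        x \<in> YH_br d q (Suc n) \<longrightarrow> \<tau> (Suc n) x = [:0, 1:] * \<tau> n a)"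


section \<open>Basic facts\<close>

lemma letters_simps [simp]: "letters 0 = []" "letters (u + v) = letters u @ letters v"
  by (simp_all add: zero_fmon_def plus_fmon_def)

lemma free_algebra_simps [simp]:
  "mult (free_algebra A) = (*)" "one (free_algebra A) = 1"
  "zero (free_algebra A) = 0" "add (free_algebra A) = (+)"
  by (simp_all add: free_algebra_def)

lemma mem_free_algebra:
  "p \<in> carrier (free_algebra A) \<longleftrightarrow> (\<forall>w \<in> Poly_Mapping.keys p. set (letters w) \<subseteq> A)"
  by (simp add: free_algebra_def)

lemma free_algebra_closed:
  assumes "p \<in> carrier (free_algebra A)" "r \<in> carrier (free_algebra A)"
  shows "p + r \<in> carrier (free_algebra A)" "p * r \<in> carrier (free_algebra A)"
    "- p \<in> carrier (free_algebra A)" "p - r \<in> carrier (free_algebra A)"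
proof -
  have m: "- x \<in> carrier (free_algebra A)" if "x \<in> carrier (free_algebra A)" for x
    using that by (auto simp: mem_free_algebra in_keys_iff)
  show "- p \<in> carrier (free_algebra A)" using m[OF assms(1)] .
  show "p + r \<in> carrier (free_algebra A)"
    using assms keys_add[of p r] unfolding mem_free_algebra by blast
  show "p * r \<in> carrier (free_algebra A)"
    using assms keys_mult[of p r] unfolding mem_free_algebra by fastforce
  have "p + - r \<in> carrier (free_algebra A)"
    using assms(1) m[OF assms(2)] keys_add[of p "- r"] unfolding mem_free_algebra by blast
  thus "p - r \<in> carrier (free_algebra A)" by simp
qed

lemma free_algebra_consts [simp]:
  "0 \<in> carrier (free_algebra A)" "1 \<in> carrier (free_algebra A)"
  "free_const c \<in> carrier (free_algebra A)"
  by (auto simp: mem_free_algebra free_const_def)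

lemma free_var_mem [simp]: "free_var x \<in> carrier (free_algebra A) \<longleftrightarrow> x \<in> A"
  by (auto simp: mem_free_algebra free_var_def)

lemma free_algebra_power:
  "p \<in> carrier (free_algebra A) \<Longrightarrow> p ^ k \<in> carrier (free_algebra A)"
  by (induction k) (auto intro: free_algebra_closed)

lemma free_algebra_sum:
  "(\<And>i. i \<in> I \<Longrightarrow> f i \<in> carrier (free_algebra A)) \<Longrightarrow> sum f I \<in> carrier (free_algebra A)"
  by (induction I rule: infinite_finite_induct) (auto intro: free_algebra_closed)

lemma ring_free_algebra: "ring (free_algebra A)"
proof (rule ringI)
  show "abelian_group (free_algebra A)"
  proof (rule abelian_groupI)
    fix x assume x: "x \<in> carrier (free_algebra A)"
    show "\<exists>y\<in>carrier (free_algebra A). y \<oplus>\<^bsub>free_algebra A\<^esub> x = \<zero>\<^bsub>free_algebra A\<^esub>"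
      using free_algebra_closed(3)[OF x x] by (intro bexI[of _ "- x"]) auto
  qed (auto intro: free_algebra_closed simp: algebra_simps)
  show "monoid (free_algebra A)"
    by (rule monoidI) (auto intro: free_algebra_closed simp: algebra_simps)
qed (auto simp: algebra_simps)

lemma fe_mem:
  assumes "1 \<le> i" "i < n"
  shows "fe d i \<in> carrier (free_algebra (yh_gens n))"
proof -
  have "Gt i \<in> yh_gens n" "Gt (i + 1) \<in> yh_gens n"
    using assms by (auto simp: yh_gens_def)
  thus ?thesis
    unfolding fe_def by (intro free_algebra_closed free_algebra_sum free_algebra_power) auto
qed

lemma Gg_mem: "1 \<le> i \<Longrightarrow> i < n \<Longrightarrow> Gg i \<in> yh_gens n"
  by (auto simp: yh_gens_def)

lemma Gt_mem: "1 \<le> i \<Longrightarrow> i \<le> n \<Longrightarrow> Gt i \<in> yh_gens n"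
  by (auto simp: yh_gens_def)

lemma yh_rels_subset: "yh_rels d q n \<subseteq> carrier (free_algebra (yh_gens n))"
proof -
  have "1 \<le> transpose i (i + 1) j \<and> transpose i (i + 1) j \<le> n"
    if "1 \<le> i" "i < n" "1 \<le> j" "j \<le> n" for i j :: nat
    using that by (auto simp: transpose_def)
  thus ?thesis
    unfolding yh_rels_def
    by (auto intro!: free_algebra_closed free_algebra_power fe_mem Gg_mem Gt_mem
             simp: power2_eq_square simp del: One_nat_def)
qed

lemma ideal_yh_ideal: "ideal (yh_ideal d q n) (free_algebra (yh_gens n))"
  unfolding yh_ideal_def by (intro ring.genideal_ideal ring_free_algebra yh_rels_subset)

lemma yh_ideal_closed:
  shows "0 \<in> yh_ideal d q n"
    and "x \<in> yh_ideal d q n \<Longrightarrow> y \<in> yh_ideal d q n \<Longrightarrow> x + y \<in> yh_ideal d q n"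
    and "x \<in> yh_ideal d q n \<Longrightarrow> - x \<in> yh_ideal d q n"
proof -
  interpret I: ideal "yh_ideal d q n" "free_algebra (yh_gens n)" by (rule ideal_yh_ideal)
  note add = ideal.axioms(1)[OF ideal_yh_ideal[of d q n]]
  show "0 \<in> yh_ideal d q n"
    using additive_subgroup.zero_closed[OF add] by simp
  show "x + y \<in> yh_ideal d q n" if "x \<in> yh_ideal d q n" "y \<in> yh_ideal d q n"
    using additive_subgroup.a_closed[OF add] that by simp
  show "- x \<in> yh_ideal d q n" if "x \<in> yh_ideal d q n"
    using I.I_l_closed[OF that free_algebra_closed(3)[OF free_algebra_consts(2) free_algebra_consts(2)]]
    by simp
qed

lemma ring_YH: "ring (YH d q n)"
  unfolding YH_def by (rule ideal.quotient_is_ring[OF ideal_yh_ideal])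

lemma yh_class_ring_hom: "yh_class d q n \<in> ring_hom (free_algebra (yh_gens n)) (YH d q n)"
proof -
  have "yh_class d q n = (+>\<^bsub>free_algebra (yh_gens n)\<^esub>) (yh_ideal d q n)"
    by (rule ext) (simp add: yh_class_def)
  thus ?thesis
    unfolding YH_def using ideal.rcos_ring_hom[OF ideal_yh_ideal] by simp
qed

lemma carrier_YH: "carrier (YH d q n) = yh_class d q n ` carrier (free_algebra (yh_gens n))"
  by (auto simp: YH_def FactRing_def A_RCOSETS_def' yh_class_def)

lemma yh_class_alt: "yh_class d q n p = (\<lambda>h. h + p) ` yh_ideal d q n"
  by (auto simp: yh_class_def a_r_coset_def')

lemma yh_class_eq_iff:
  assumes "p \<in> carrier (free_algebra (yh_gens n))" "r \<in> carrier (free_algebra (yh_gens n))"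
  shows "yh_class d q n p = yh_class d q n r \<longleftrightarrow> p - r \<in> yh_ideal d q n"
proof -
  note z = yh_ideal_closed(1)[of d q n] and a = yh_ideal_closed(2)[of _ d q n]
    and m = yh_ideal_closed(3)[of _ d q n]
  show ?thesis
  proof
    assume "yh_class d q n p = yh_class d q n r"
    hence "0 + p \<in> (\<lambda>h. h + r) ` yh_ideal d q n"
      using z unfolding yh_class_alt by blast
    thus "p - r \<in> yh_ideal d q n" by auto
  next
    assume pr: "p - r \<in> yh_ideal d q n"
    have "h + p \<in> (\<lambda>h. h + r) ` yh_ideal d q n" if "h \<in> yh_ideal d q n" for h
      using a[OF that pr] by (intro image_eqI[of _ _ "h + (p - r)"]) auto
    moreover have "h + r \<in> (\<lambda>h. h + p) ` yh_ideal d q n" if "h \<in> yh_ideal d q n" for h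
      using a[OF that m[OF pr]] by (intro image_eqI[of _ _ "h + - (p - r)"]) auto
    ultimately show "yh_class d q n p = yh_class d q n r" unfolding yh_class_alt by blast
  qed
qed

lemma yh_gens_mono: "carrier (free_algebra (yh_gens n)) \<subseteq> carrier (free_algebra (yh_gens (Suc n)))"
proof -
  have "yh_gens n \<subseteq> yh_gens (Suc n)"
    by (auto simp: yh_gens_def)
  thus ?thesis unfolding mem_free_algebra subset_iff by blast
qed

lemma yh_rels_mono: "yh_rels d q n \<subseteq> yh_rels d q (Suc n)"
  unfolding yh_rels_def by (intro Un_mono) (force intro: less_SucI le_SucI)+

lemma yh_ideal_mono: "yh_ideal d q n \<subseteq> yh_ideal d q (Suc n)"
proof -
  let ?F = "free_algebra (yh_gens n)" and ?F' = "free_algebra (yh_gens (Suc n))"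
  let ?J = "yh_ideal d q (Suc n) \<inter> carrier ?F"
  interpret I: ideal "yh_ideal d q (Suc n)" ?F' by (rule ideal_yh_ideal)
  have inv: "inv\<^bsub>add_monoid ?F\<^esub> x = - x" if "x \<in> carrier ?F" for x
  proof -
    interpret R: ring ?F by (rule ring_free_algebra)
    show ?thesis
      using R.minus_equality[of "- x" x] that free_algebra_closed(3)[OF that that]
      by (simp add: a_inv_def)
  qed
  have "ideal ?J ?F"
  proof (rule idealI)
    show "subgroup ?J (add_monoid ?F)"
    proof (rule subgroup.intro)
      show "?J \<subseteq> carrier (add_monoid ?F)" by auto
      show "x \<otimes>\<^bsub>add_monoid ?F\<^esub> y \<in> ?J" if "x \<in> ?J" "y \<in> ?J" for x y
        using that yh_ideal_closed(2) free_algebra_closed(1) by auto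
      show "\<one>\<^bsub>add_monoid ?F\<^esub> \<in> ?J" using yh_ideal_closed(1) by auto
      show "inv\<^bsub>add_monoid ?F\<^esub> x \<in> ?J" if "x \<in> ?J" for x
        using that yh_ideal_closed(3) inv free_algebra_closed(3) by auto
    qed
  next
    fix x y assume x: "x \<in> ?J" and y: "y \<in> carrier ?F"
    hence y': "y \<in> carrier ?F'" using yh_gens_mono by blast
    show "y \<otimes>\<^bsub>?F\<^esub> x \<in> ?J" "x \<otimes>\<^bsub>?F\<^esub> y \<in> ?J"
      using I.I_l_closed[OF IntD1[OF x] y'] I.I_r_closed[OF IntD1[OF x] y']
        free_algebra_closed(2)[OF IntD2[OF x] y] free_algebra_closed(2)[OF y IntD2[OF x]] by simp_all
  qed (rule ring_free_algebra)
  moreover have "yh_rels d q n \<subseteq> ?J"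
    using yh_rels_subset[of d q n] yh_rels_mono[of d q n]
      ring.genideal_self[OF ring_free_algebra yh_rels_subset[of d q "Suc n"]]
    unfolding yh_ideal_def by blast
  ultimately show ?thesis
    unfolding yh_ideal_def[of d q n] genideal_def by blast
qed

lemma yh_incl_class: "yh_incl d q n (yh_class d q n p) = yh_class d q (Suc n) p"
proof -
  have "h + (h' + p) \<in> (\<lambda>h. h + p) ` yh_ideal d q (Suc n)"
    if "h \<in> yh_ideal d q (Suc n)" "h' \<in> yh_ideal d q n" for h h'
    using that yh_ideal_closed(2)[of h d q "Suc n" h'] yh_ideal_mono[of d q n]
    by (intro image_eqI[of _ _ "h + h'"]) (auto simp: algebra_simps)
  moreover have "h + p = h + (0 + p)" "0 \<in> yh_ideal d q n" for h
    using yh_ideal_closed(1) by auto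
  ultimately show ?thesis
    unfolding yh_incl_def yh_class_alt set_add_def' free_algebra_simps by (safe; blast)
qed

lemma yh_incl_ring_hom: "yh_incl d q n \<in> ring_hom (YH d q n) (YH d q (Suc n))"
proof -
  note sub = subsetD[OF yh_gens_mono[of n]]
  show ?thesis
  proof (rule ring_hom_memI)
    fix x assume "x \<in> carrier (YH d q n)"
    thus "yh_incl d q n x \<in> carrier (YH d q (Suc n))"
      unfolding carrier_YH using sub by (auto simp: yh_incl_class)
  next
    fix x y assume xy: "x \<in> carrier (YH d q n)" "y \<in> carrier (YH d q n)"
    then obtain p r where p: "p \<in> carrier (free_algebra (yh_gens n))" "x = yh_class d q n p"
      and r: "r \<in> carrier (free_algebra (yh_gens n))" "y = yh_class d q n r"
      unfolding carrier_YH by blast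
    have "x \<otimes>\<^bsub>YH d q n\<^esub> y = yh_class d q n (p * r)"
      using ring_hom_mult[OF yh_class_ring_hom p(1) r(1)] p(2) r(2) by simp
    moreover have "yh_class d q (Suc n) (p * r) =
        yh_class d q (Suc n) p \<otimes>\<^bsub>YH d q (Suc n)\<^esub> yh_class d q (Suc n) r"
      using ring_hom_mult[OF yh_class_ring_hom sub[OF p(1)] sub[OF r(1)]] by simp
    ultimately show "yh_incl d q n (x \<otimes>\<^bsub>YH d q n\<^esub> y) =
        yh_incl d q n x \<otimes>\<^bsub>YH d q (Suc n)\<^esub> yh_incl d q n y"
      unfolding p(2) r(2) by (simp only: yh_incl_class)
    have "x \<oplus>\<^bsub>YH d q n\<^esub> y = yh_class d q n (p + r)"
      using ring_hom_add[OF yh_class_ring_hom p(1) r(1)] p(2) r(2) by simp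
    moreover have "yh_class d q (Suc n) (p + r) =
        yh_class d q (Suc n) p \<oplus>\<^bsub>YH d q (Suc n)\<^esub> yh_class d q (Suc n) r"
      using ring_hom_add[OF yh_class_ring_hom sub[OF p(1)] sub[OF r(1)]] by simp
    ultimately show "yh_incl d q n (x \<oplus>\<^bsub>YH d q n\<^esub> y) =
        yh_incl d q n x \<oplus>\<^bsub>YH d q (Suc n)\<^esub> yh_incl d q n y"
      unfolding p(2) r(2) by (simp only: yh_incl_class)
  next
    show "yh_incl d q n \<one>\<^bsub>YH d q n\<^esub> = \<one>\<^bsub>YH d q (Suc n)\<^esub>"
      using ring_hom_one[OF yh_class_ring_hom[of d q n]]
        ring_hom_one[OF yh_class_ring_hom[of d q "Suc n"]] yh_incl_class[of d q n 1] by simp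
  qed
qed

lemma yh_scalar_mem: "yh_scalar d q n c \<in> carrier (YH d q n)"
  unfolding yh_scalar_def carrier_YH by simp

lemma yh_g_mem: "1 \<le> i \<Longrightarrow> i < n \<Longrightarrow> yh_g d q n i \<in> carrier (YH d q n)"
  unfolding yh_g_def carrier_YH by (simp add: Gg_mem)

lemma subring_YH_br: "subring (YH_br d q n) (YH d q n)"
  unfolding YH_br_def
  by (rule ring.generate_ring_is_subring[OF ring_YH]) (auto simp: yh_scalar_mem yh_g_mem)

lemma yh_incl_YH_br:
  assumes "a \<in> YH_br d q n"
  shows "yh_incl d q n a \<in> YH_br d q (Suc n)"
proof -
  interpret H: ring_hom_ring "YH d q n" "YH d q (Suc n)" "yh_incl d q n"
    by (intro ring_hom_ringI2 ring_YH yh_incl_ring_hom)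
  note sub = subringE(1)[OF subring_YH_br[of d q n], unfolded YH_br_def]
  show ?thesis
    using assms unfolding YH_br_def
  proof (induction rule: generate_ring.induct)
    case (incl h)
    thus ?case
      by (intro generate_ring.incl)
         (auto simp: yh_scalar_def yh_g_def yh_incl_class intro!: imageI)
  qed (use sub in \<open>auto simp: subset_iff intro: generate_ring.intros\<close>)
qed

lemma free_const_simps:
  "free_const c * p = p * free_const c" "free_const a * free_const b = free_const (a * b)"
  "free_const 1 = 1" "of_nat k = free_const (of_nat k)"
proof -
  show "free_const a * free_const b = free_const (a * b)" for a b
    by (simp add: free_const_def mult_single)
  show "free_const 1 = 1" "of_nat k = free_const (of_nat k)"
    by (simp_all add: free_const_def)
  have comm: "free_const c * Poly_Mapping.single w x = Poly_Mapping.single w x * free_const c" for w x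
    by (simp add: free_const_def mult_single mult.commute)
  have "p = (\<Sum>k\<in>Poly_Mapping.keys p. Poly_Mapping.single k (Poly_Mapping.lookup p k))"
    by (rule poly_mapping_eqI) (simp add: lookup_sum lookup_single when_def in_keys_iff)
  thus "free_const c * p = p * free_const c"
    using comm by (metis (mono_tags, lifting) sum.cong sum_distrib_left sum_distrib_right)
qed

context
  fixes d n :: nat and q :: complex
begin

private definition eqv (infix \<open>\<approx>\<close> 50) where "p \<approx> r \<longleftrightarrow> p - r \<in> yh_ideal d q n"

private abbreviation "C \<equiv> carrier (free_algebra (yh_gens n))"

private lemma eqv_refl [simp]: "p \<approx> p"
  by (simp add: eqv_def yh_ideal_closed)

private lemma eqv_sym: "p \<approx> r \<Longrightarrow> r \<approx> p"
  using yh_ideal_closed(3)[of "p - r" d q n] by (simp add: eqv_def)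

private lemma eqv_trans [trans]: "p \<approx> r \<Longrightarrow> r \<approx> s \<Longrightarrow> p \<approx> s"
  using yh_ideal_closed(2)[of "p - r" d q n "r - s"] by (simp add: eqv_def)

private lemma eqv_eq [trans]: "p \<approx> r \<Longrightarrow> r = s \<Longrightarrow> p \<approx> s" "p = r \<Longrightarrow> r \<approx> s \<Longrightarrow> p \<approx> s"
  by simp_all

private lemma eqv_add: "p \<approx> r \<Longrightarrow> p' \<approx> r' \<Longrightarrow> p + p' \<approx> r + r'"
  using yh_ideal_closed(2)[of "p - r" d q n "p' - r'"] by (simp add: eqv_def algebra_simps)

private lemma eqv_sum: "(\<And>i. i \<in> I \<Longrightarrow> f i \<approx> h i) \<Longrightarrow> sum f I \<approx> sum h I"
  by (induction I rule: infinite_finite_induct) (auto intro: eqv_add)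

private lemma eqv_mult_left: "p \<approx> r \<Longrightarrow> x \<in> C \<Longrightarrow> x * p \<approx> x * r"
  using ideal.I_l_closed[OF ideal_yh_ideal, of "p - r" d q n x]
  by (simp add: eqv_def algebra_simps)

private lemma eqv_mult_right: "p \<approx> r \<Longrightarrow> x \<in> C \<Longrightarrow> p * x \<approx> r * x"
  using ideal.I_r_closed[OF ideal_yh_ideal, of "p - r" d q n x]
  by (simp add: eqv_def algebra_simps)

private lemma eqv_rel: "p - r \<in> yh_rels d q n \<Longrightarrow> p \<approx> r"
  using ring.genideal_self[OF ring_free_algebra yh_rels_subset[of d q n]]
  by (auto simp: eqv_def yh_ideal_def)

private lemma fe_idem:
  assumes i: "1 \<le> i" "i < n" and d: "d > 0"
  shows "fe d i * fe d i \<approx> fe d i"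
proof -
  define u v where "u = ft i" and "v = ft (i + 1)"
  define S where "S = (\<Sum>s<d. u ^ s * v ^ (d - s))"
  have C: "u \<in> C" "v \<in> C"
    using i by (simp_all add: u_def v_def Gt_mem)
  note cl = free_algebra_closed(2) free_algebra_power free_algebra_consts C
  have SC: "S \<in> C" unfolding S_def by (intro free_algebra_sum cl)
  have vu: "v * u \<approx> u * v"
  proof (rule eqv_rel)
    have "v * u - u * v \<in> {ft i * ft j - ft j * ft i | i j. 1 \<le> i \<and> i \<le> n \<and> 1 \<le> j \<and> j \<le> n}"
      unfolding u_def v_def using i by (intro CollectI exI[of _ "i + 1"] exI[of _ i]) simp
    thus "v * u - u * v \<in> yh_rels d q n" unfolding yh_rels_def by blast
  qed
  have "ft j ^ d \<approx> 1" if "1 \<le> j" "j \<le> n" for j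
    by (rule eqv_rel) (use that in \<open>unfold yh_rels_def, blast\<close>)
  hence ud: "u ^ d \<approx> 1" "v ^ d \<approx> 1"
    using i by (simp_all add: u_def v_def)
  have vus: "v * u ^ s \<approx> u ^ s * v" for s
  proof (induction s)
    case (Suc s)
    have "v * u ^ Suc s = v * u * u ^ s" by (simp add: mult.assoc)
    also have "\<dots> \<approx> u * v * u ^ s" by (intro eqv_mult_right vu cl)
    also have "\<dots> = u * (v * u ^ s)" by (simp add: mult.assoc)
    also have "\<dots> \<approx> u * (u ^ s * v)" by (intro eqv_mult_left Suc.IH cl)
    finally show ?case by (simp add: mult.assoc)
  qed simp
  have vkus: "v ^ k * u ^ s \<approx> u ^ s * v ^ k" for k s
  proof (induction k)
    case (Suc k)
    have "v ^ Suc k * u ^ s = v * (v ^ k * u ^ s)" by (simp add: mult.assoc)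
    also have "\<dots> \<approx> v * (u ^ s * v ^ k)" by (intro eqv_mult_left Suc.IH cl)
    also have "\<dots> = v * u ^ s * v ^ k" by (simp add: mult.assoc)
    also have "\<dots> \<approx> u ^ s * v * v ^ k" by (intro eqv_mult_right vus cl)
    finally show ?case by (simp add: mult.assoc)
  qed simp
  have "u * S \<approx> v * S"
  proof -
    define f where "f s = u ^ s * v ^ (Suc d - s)" for s
    have "v * S = (\<Sum>s<d. v * u ^ s * v ^ (d - s))"
      by (simp add: S_def sum_distrib_left mult.assoc)
    also have "\<dots> \<approx> (\<Sum>s<d. u ^ s * v * v ^ (d - s))"
      by (intro eqv_sum eqv_mult_right vus cl)
    also have "\<dots> = (\<Sum>s<d. f s)"
      by (intro sum.cong) (auto simp: f_def Suc_diff_le mult.assoc)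
    finally have 1: "v * S \<approx> (\<Sum>s<d. f s)" .
    have 2: "u * S = (\<Sum>s<d. f (Suc s))"
      by (simp add: S_def sum_distrib_left f_def mult.assoc)
    have "f d = u ^ d * v" by (simp add: f_def)
    also have "\<dots> \<approx> 1 * v" by (intro eqv_mult_right ud cl)
    also have "\<dots> = v * 1" by simp
    also have "\<dots> \<approx> v * v ^ d" by (intro eqv_mult_left eqv_sym[OF ud(2)] cl)
    also have "\<dots> = f 0" by (simp add: f_def)
    finally have "f d - f 0 \<in> yh_ideal d q n" by (simp add: eqv_def)
    hence "(\<Sum>s<d. f (Suc s)) \<approx> (\<Sum>s<d. f s)"
      by (simp add: eqv_def sum_lessThan_telescope flip: sum_subtractf)
    thus ?thesis using eqv_trans[OF _ eqv_sym[OF 1]] by (simp add: 2)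
  qed
  have uS: "u ^ s * S \<approx> v ^ s * S" for s
  proof (induction s)
    case (Suc s)
    have "u ^ Suc s * S = u ^ s * (u * S)" by (simp add: power_Suc2 mult.assoc del: power_Suc)
    also have "\<dots> \<approx> u ^ s * (v * S)" by (intro eqv_mult_left \<open>u * S \<approx> v * S\<close> cl)
    also have "\<dots> = u ^ s * v * S" by (simp add: mult.assoc)
    also have "\<dots> \<approx> v * u ^ s * S" by (intro eqv_mult_right eqv_sym[OF vus] cl SC)
    also have "\<dots> = v * (u ^ s * S)" by (simp add: mult.assoc)
    also have "\<dots> \<approx> v * (v ^ s * S)" by (intro eqv_mult_left Suc.IH cl)
    finally show ?case by (simp add: mult.assoc)
  qed simp
  have "u ^ s * v ^ (d - s) * S \<approx> S" if "s < d" for s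
  proof -
    have "u ^ s * v ^ (d - s) * S \<approx> v ^ (d - s) * u ^ s * S"
      by (intro eqv_mult_right eqv_sym[OF vkus] SC)
    also have "\<dots> = v ^ (d - s) * (u ^ s * S)" by (simp add: mult.assoc)
    also have "\<dots> \<approx> v ^ (d - s) * (v ^ s * S)" by (intro eqv_mult_left uS cl)
    also have "\<dots> = v ^ d * S" using that by (simp flip: mult.assoc power_add)
    also have "\<dots> \<approx> 1 * S" by (intro eqv_mult_right ud SC)
    finally show ?thesis by simp
  qed
  hence "(\<Sum>s<d. u ^ s * v ^ (d - s) * S) \<approx> (\<Sum>s<d. S)" by (intro eqv_sum) simp
  hence SS: "S * S \<approx> of_nat d * S" by (simp add: S_def sum_distrib_right)
  define c :: "yh_gen falg" where "c = free_const (1 / of_nat d)"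
  have e: "fe d i = c * S" by (simp add: fe_def c_def S_def u_def v_def)
  have "c * of_nat d = 1"
    using d by (simp only: c_def free_const_simps(2)
        free_const_simps(4)[of d]) (simp add: free_const_simps(3))
  have "c * S * (c * S) = c * c * (S * S)"
    using arg_cong[where f = "\<lambda>x. c * x * S", OF free_const_simps(1)[of "1 / of_nat d" S, folded c_def]]
    by (simp add: mult.assoc)
  also have "\<dots> \<approx> c * c * (of_nat d * S)" by (intro eqv_mult_left SS cl) (auto simp: c_def)
  also have "\<dots> = c * (c * of_nat d) * S" by (simp add: mult.assoc)
  also have "\<dots> = c * S" by (simp add: \<open>c * of_nat d = 1\<close>)
  finally show ?thesis by (simp add: e)
qed

lemma yh_e_in_YH_br:
  assumes d: "d > 0" and q: "q \<noteq> 0" "q ^ 2 \<noteq> 1" and i: "1 \<le> i" "i < n"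
  shows "yh_e d q n i \<in> YH_br d q n"
proof -
  define B where "B = {p \<in> C. yh_class d q n p \<in> YH_br d q n}"
  note br = subringE[OF subring_YH_br[of d q n]]
  note hom = yh_class_ring_hom[of d q n]
  have Bm: "p * r \<in> B" if "p \<in> B" "r \<in> B" for p r
    using that br(6) ring_hom_mult[OF hom, of p r] by (auto simp: B_def free_algebra_closed)
  have Ba: "p + r \<in> B" if "p \<in> B" "r \<in> B" for p r
    using that br(7) ring_hom_add[OF hom, of p r] by (auto simp: B_def free_algebra_closed)
  have Bc: "free_const c \<in> B" for c
    by (auto simp: B_def YH_br_def yh_scalar_def intro: generate_ring.incl)
  have "- 1 = (free_const (- 1) :: yh_gen falg)"
    by (simp add: free_const_def single_uminus)
  hence Bn: "- p \<in> B" if "p \<in> B" for p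
    using Bm[OF Bc[of "-1"] that] by (metis mult_minus1)
  have Bs: "p - r \<in> B" if "p \<in> B" "r \<in> B" for p r
    using Ba[OF that(1) Bn[OF that(2)]] by simp
  have Be: "r \<in> B" if "p \<in> B" "p \<approx> r" "r \<in> C" for p r
    using that yh_class_eq_iff[of p n r d q] by (auto simp: B_def eqv_def)
  define g e where "g = fg i" and "e = fe d i"
  have gC: "g \<in> C" and eC: "e \<in> C"
    using i by (simp_all add: g_def e_def Gg_mem fe_mem)
  have gB: "g \<in> B"
    using gC i by (auto simp: B_def YH_br_def g_def yh_g_def intro!: generate_ring.incl)
  define l where "l = q - inverse q"
  have l: "l \<noteq> 0" using q by (auto simp: l_def field_simps power2_eq_square)
  have rel: "g ^ 2 \<approx> 1 + free_const l * (e * g)"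
    unfolding g_def e_def l_def
    by (rule eqv_rel) (use i in \<open>unfold yh_rels_def, blast\<close>)
  have g2: "free_const (1 / l) * (g ^ 2 - 1) \<in> B"
    unfolding power2_eq_square using gB Bc[of 1] by (intro Bm Bs Bc) (auto simp: free_const_simps(3))
  have "g ^ 2 - 1 \<approx> free_const l * (e * g)"
    using rel by (simp add: eqv_def algebra_simps)
  hence "free_const (1 / l) * (g ^ 2 - 1) \<approx> free_const (1 / l) * (free_const l * (e * g))"
    by (intro eqv_mult_left) auto
  also have "\<dots> = e * g"
    using l by (simp add: free_const_simps(2,3) flip: mult.assoc)
  finally have egB: "e * g \<in> B"
    using Be[OF g2] gC eC by (simp add: free_algebra_closed)
  have "e * g * g = e * g ^ 2" by (simp add: power2_eq_square mult.assoc)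
  also have "\<dots> \<approx> e * (1 + free_const l * (e * g))" by (intro eqv_mult_left rel eC)
  also have "\<dots> = e + free_const l * (e * e * g)"
    using arg_cong[where f = "\<lambda>x. x * (e * g)", OF free_const_simps(1)[of l e]]
    by (simp add: distrib_left mult.assoc)
  also have "\<dots> \<approx> e + free_const l * (e * g)"
    unfolding e_def
    by (intro eqv_add eqv_refl eqv_mult_left eqv_mult_right fe_idem i d gC free_algebra_consts)
  finally have "e * g * g - free_const l * (e * g) \<approx> e"
    by (simp add: eqv_def algebra_simps)
  moreover have "e * g * g - free_const l * (e * g) \<in> B"
    by (intro Bs Bm egB gB Bc)
  ultimately have "e \<in> B"
    using Be eC by blast
  thus ?thesis by (simp add: B_def e_def yh_e_def)
qed

end

end

theory Submission
  imports Defs "HOL-Library.Function_Algebras"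
begin

text \<open>The spectral projections \<open>P j \<chi>\<close> of the \<open>t\<^sub>j\<close> turn the defining relations into permutation
  rules and \<open>e\<^sub>i\<close> into \<open>\<Sum>\<^sub>\<chi> P i \<chi> * P (i + 1) \<chi>\<close>. Every element of level \<open>n + 1\<close> is a sum of elements
  \<open>a * P (n + 1) \<chi>\<close> and \<open>a * g\<^sub>n * b\<close> with \<open>a\<close>, \<open>b\<close> of level \<open>n\<close>; this gives uniqueness of the specialized
  trace, and it also shows by induction that any linear functional obeying the Markov rules in the form
  \<open>\<tau> (a * P (n + 1) \<chi> * b) = Y \<chi> * \<tau> (a * b)\<close>, \<open>\<tau> (a * g\<^sub>n * b) = z * \<tau> (a * b)\<close> is a trace.
  Such a functional exists on the regular representation, which is constructed level by level from the basis
  \<open>P i \<chi> * g\<^sub>i * \<dots> * g\<^sub>n\<close> of level \<open>n + 1\<close> over level \<open>n\<close>. For \<open>Y = 1 / |D|\<close> on \<open>D\<close> and \<open>0\<close> elsewhere,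
  \<open>\<tau> (a * P n \<chi>)\<close> vanishes for \<open>\<chi>\<close> outside \<open>D\<close>, whence \<open>\<tau> (a * e\<^sub>n) = \<tau> a / |D|\<close>. On the braid
  subalgebra, the values of a trace are determined because level \<open>n + 1\<close> is spanned by \<open>a * w * b\<close>, where
  \<open>w\<close> is one of \<open>1\<close>, \<open>g\<^sub>n\<close>, \<open>(q - q\<inverse>) e\<^sub>n\<close>, \<open>(q - q\<inverse>) e\<^sub>n g\<^sub>n\<close>.\<close>


section \<open>Idempotent presentation\<close>

text \<open>The weights \<open>Y\<close> are the values of the trace on the projections, hence the
  inverse Fourier transform of the parameters x_k. Every choice of weights with sum 1 gives a trace,
  and the solution of the E-system attached to \<open>D\<close> is the uniform distribution on
  \<open>D\<close>. The main obstacle is the trace property: the functional is defined by recursion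
  on coordinates, which hides symmetry, and for \<open>g n * a * g n * b\<close> symmetry is
  obtained only by splitting both \<open>a\<close> and \<open>b\<close> one level further down. What
  has to be checked of the regular representation is that the relations hold in it; the functional
  is then pulled back along the evaluation of words, which sends the ideal to 0. On the braid part
  the obstacle is q^2 = 1, where e_n may leave the domain of the trace; the multiple (q - 1/q) e_n
  stays inside it and is 0 in that case. Scalars enter as a central homomorphism \<open>sc\<close>,
  so that one development serves both operators on a vector space and a product of the algebras
  \<open>YH d q n\<close>.\<close>

locale central_scalars =
  fixes sc :: "complex \<Rightarrow> 'a::{ring,monoid_mult}"
  assumes sc_add: "sc (a + b) = sc a + sc b"
    and sc_mult: "sc (a * b) = sc a * sc b"
    and sc_1: "sc 1 = 1"
    and sc_comm: "x * sc a = sc a * x"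
begin

lemma sc_0: "sc 0 = 0"
  using sc_add[of 0 0] by simp

lemma sc_minus: "sc (- a) = - sc a"
  using sc_add[of a "- a"] sc_0 by (simp add: eq_neg_iff_add_eq_0 add.commute)

lemma sc_sum: "sc (sum f I) = (\<Sum>i\<in>I. sc (f i))"
  by (induction I rule: infinite_finite_induct) (auto simp: sc_add sc_0)

lemma sc_left_comm: "x * (sc a * y) = sc a * (x * y)"
  by (metis sc_comm mult.assoc)

end

text \<open>Lets an equation between two products act inside a right-associated word, the normal
  form that \<open>mult.assoc\<close> produces.\<close>

lemma mult_ext: "(a::'a::semigroup_mult) * b = c * e \<Longrightarrow> a * (b * x) = c * (e * x)"
  by (metis mult.assoc)

lemma mult_ext1: "(a::'a::semigroup_mult) * b = c \<Longrightarrow> a * (b * x) = c * x"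
  by (metis mult.assoc)

text \<open>The idempotents \<open>P j \<chi>\<close> are the spectral projections of \<open>t\<^sub>j\<close>, that is,
  \<open>t\<^sub>j = (\<Sum>\<chi><d. \<zeta>\<^sup>\<chi> P j \<chi>)\<close>.\<close>

locale coloured_hecke = central_scalars sc
  for sc :: "complex \<Rightarrow> 'a::{ring,monoid_mult}" +
  fixes g :: "nat \<Rightarrow> 'a" and P :: "nat \<Rightarrow> nat \<Rightarrow> 'a" and N d :: nat and c :: complex
  assumes d_pos: "d \<ge> 1"
    and braid: "1 \<le> i \<Longrightarrow> i + 1 < N \<Longrightarrow> g i * g (i + 1) * g i = g (i + 1) * g i * g (i + 1)"
    and far: "1 \<le> i \<Longrightarrow> i + 1 < j \<Longrightarrow> j < N \<Longrightarrow> g i * g j = g j * g i"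
    and PP_comm: "1 \<le> i \<Longrightarrow> i \<le> N \<Longrightarrow> 1 \<le> j \<Longrightarrow> j \<le> N \<Longrightarrow> \<chi> < d \<Longrightarrow> \<psi> < d \<Longrightarrow>
       P i \<chi> * P j \<psi> = P j \<psi> * P i \<chi>"
    and PP_orth: "1 \<le> j \<Longrightarrow> j \<le> N \<Longrightarrow> \<chi> < d \<Longrightarrow> \<psi> < d \<Longrightarrow>
       P j \<chi> * P j \<psi> = (if \<chi> = \<psi> then P j \<chi> else 0)"
    and P_sum: "1 \<le> j \<Longrightarrow> j \<le> N \<Longrightarrow> (\<Sum>\<chi><d. P j \<chi>) = 1"
    and gP: "1 \<le> i \<Longrightarrow> i < N \<Longrightarrow> \<chi> < d \<Longrightarrow> g i * P i \<chi> = P (i + 1) \<chi> * g i"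
    and gP': "1 \<le> i \<Longrightarrow> i < N \<Longrightarrow> \<chi> < d \<Longrightarrow> g i * P (i + 1) \<chi> = P i \<chi> * g i"
    and gP_far: "1 \<le> i \<Longrightarrow> i < N \<Longrightarrow> 1 \<le> j \<Longrightarrow> j \<le> N \<Longrightarrow> j \<noteq> i \<Longrightarrow> j \<noteq> i + 1 \<Longrightarrow> \<chi> < d \<Longrightarrow>
       g i * P j \<chi> = P j \<chi> * g i"
    and quad: "1 \<le> i \<Longrightarrow> i < N \<Longrightarrow>
       g i * g i = 1 + sc c * ((\<Sum>\<chi><d. P i \<chi> * P (i + 1) \<chi>) * g i)"
begin

definition E :: "nat \<Rightarrow> nat \<Rightarrow> 'a" where
  "E i j = (\<Sum>\<chi><d. P i \<chi> * P j \<chi>)"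

inductive_set A :: "nat \<Rightarrow> 'a set" for n where
  A_sc: "sc a \<in> A n"
| A_g: "1 \<le> i \<Longrightarrow> i < n \<Longrightarrow> g i \<in> A n"
| A_P: "1 \<le> j \<Longrightarrow> j \<le> n \<Longrightarrow> \<chi> < d \<Longrightarrow> P j \<chi> \<in> A n"
| A_add: "x \<in> A n \<Longrightarrow> y \<in> A n \<Longrightarrow> x + y \<in> A n"
| A_mult: "x \<in> A n \<Longrightarrow> y \<in> A n \<Longrightarrow> x * y \<in> A n"

lemma A_1 [simp]: "1 \<in> A n" using A_sc[of 1 n] sc_1 by simp
lemma A_0 [simp]: "0 \<in> A n" using A_sc[of 0 n] sc_0 by simp

lemma A_sum: "(\<And>i. i \<in> I \<Longrightarrow> f i \<in> A n) \<Longrightarrow> sum f I \<in> A n"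
  by (induction I rule: infinite_finite_induct) (auto intro: A_add)

lemma A_mono: "x \<in> A n \<Longrightarrow> n \<le> m \<Longrightarrow> x \<in> A m"
  by (induction rule: A.induct) (auto intro: A.intros)

lemma A_comm_gen:
  assumes "x \<in> A n" "\<And>i. 1 \<le> i \<Longrightarrow> i < n \<Longrightarrow> g i * y = y * g i"
    "\<And>j \<chi>. 1 \<le> j \<Longrightarrow> j \<le> n \<Longrightarrow> \<chi> < d \<Longrightarrow> P j \<chi> * y = y * P j \<chi>"
  shows "x * y = y * x"
  using assms(1)
proof (induction rule: A.induct)
  case (A_mult a b)
  thus ?case by (metis mult.assoc)
qed (use assms(2,3) in \<open>auto simp: sc_comm algebra_simps\<close>)

lemma A_g_comm: "x \<in> A n \<Longrightarrow> n < k \<Longrightarrow> k < N \<Longrightarrow> x * g k = g k * x"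
  by (rule A_comm_gen) (auto intro!: far gP_far[symmetric])

lemma A_P_comm: "x \<in> A n \<Longrightarrow> n < k \<Longrightarrow> k \<le> N \<Longrightarrow> \<chi> < d \<Longrightarrow> x * P k \<chi> = P k \<chi> * x"
  by (rule A_comm_gen) (auto simp: PP_comm gP_far)

lemma g_A_left: "x \<in> A n \<Longrightarrow> n < k \<Longrightarrow> k < N \<Longrightarrow> g k * (x * y) = x * (g k * y)"
  using A_g_comm[of x n k] by (simp flip: mult.assoc)

lemma P_A_left:
  "x \<in> A n \<Longrightarrow> n < k \<Longrightarrow> k \<le> N \<Longrightarrow> \<chi> < d \<Longrightarrow> P k \<chi> * (x * y) = x * (P k \<chi> * y)"
  using A_P_comm[of x n k \<chi>] by (simp flip: mult.assoc)

lemma A0_central: "x \<in> A 0 \<Longrightarrow> x * y = y * x"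
  by (rule A_comm_gen) auto

text \<open>\<open>Sp n\<close> turns out to be \<open>A (n + 1)\<close>, see \<open>A_Sp\<close>.\<close>

inductive_set Sp :: "nat \<Rightarrow> 'a set" for n where
  Sp_P: "a \<in> A n \<Longrightarrow> \<chi> < d \<Longrightarrow> a * P (Suc n) \<chi> \<in> Sp n"
| Sp_g: "1 \<le> n \<Longrightarrow> a \<in> A n \<Longrightarrow> b \<in> A n \<Longrightarrow> a * g n * b \<in> Sp n"
| Sp_add: "x \<in> Sp n \<Longrightarrow> y \<in> Sp n \<Longrightarrow> x + y \<in> Sp n"

lemma Sp_0: "0 \<in> Sp n"
  using Sp_P[of 0 n 0] d_pos by simp

lemma Sp_sum: "(\<And>i. i \<in> I \<Longrightarrow> f i \<in> Sp n) \<Longrightarrow> sum f I \<in> Sp n"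
  by (induction I rule: infinite_finite_induct) (auto intro: Sp_add Sp_0)

lemma Sp_lmult: "x \<in> Sp n \<Longrightarrow> a \<in> A n \<Longrightarrow> a * x \<in> Sp n"
proof (induction rule: Sp.induct)
  case (Sp_P b \<chi>)
  thus ?case using Sp.Sp_P[of "a * b" n \<chi>] by (simp add: mult.assoc A_mult)
next
  case (Sp_g b b')
  thus ?case using Sp.Sp_g[of n "a * b" b'] by (simp add: mult.assoc A_mult)
qed (auto simp: distrib_left intro: Sp_add)

lemma A_in_Sp: assumes "n < N" "a \<in> A n" shows "a \<in> Sp n"
proof -
  have "a = (\<Sum>\<chi><d. a * P (Suc n) \<chi>)"
    using P_sum[of "Suc n"] assms(1) by (simp flip: sum_distrib_left)
  also have "\<dots> \<in> Sp n" by (intro Sp_sum Sp_P assms) auto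
  finally show ?thesis .
qed

lemma Sp_P': "n < N \<Longrightarrow> a \<in> A n \<Longrightarrow> b \<in> A n \<Longrightarrow> \<chi> < d \<Longrightarrow> a * P (Suc n) \<chi> * b \<in> Sp n"
  using Sp_P[of "a * b" n \<chi>] A_P_comm[of b n "Suc n" \<chi>] by (simp add: mult.assoc A_mult)

lemma Sp_rmult: "x \<in> Sp n \<Longrightarrow> n < N \<Longrightarrow> a \<in> A n \<Longrightarrow> x * a \<in> Sp n"
proof (induction rule: Sp.induct)
  case (Sp_P b \<chi>)
  thus ?case by (auto intro: Sp_P')
next
  case (Sp_g b b')
  thus ?case using Sp.Sp_g[of n "b" "b' * a"] by (simp add: mult.assoc A_mult)
qed (auto simp: distrib_right intro: Sp_add)

lemma E_comm: "1 \<le> i \<Longrightarrow> i \<le> N \<Longrightarrow> 1 \<le> j \<Longrightarrow> j \<le> N \<Longrightarrow> E i j = E j i"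
  unfolding E_def by (rule sum.cong) (auto simp: PP_comm)

lemma P_idem: "1 \<le> j \<Longrightarrow> j \<le> N \<Longrightarrow> \<chi> < d \<Longrightarrow> P j \<chi> * P j \<chi> = P j \<chi>"
  by (simp add: PP_orth)

lemma P_E:
  assumes "1 \<le> i" "i \<le> N" "1 \<le> j" "j \<le> N" "\<chi> < d"
  shows "P i \<chi> * E i j = P i \<chi> * P j \<chi>"
proof -
  have "P i \<chi> * E i j = (\<Sum>\<psi><d. (P i \<chi> * P i \<psi>) * P j \<psi>)"
    by (simp add: E_def sum_distrib_left mult.assoc)
  also have "\<dots> = (\<Sum>\<psi><d. if \<chi> = \<psi> then P i \<chi> * P j \<chi> else 0)"
    using assms by (intro sum.cong) (auto simp: PP_orth)
  finally show ?thesis using assms by (simp add: sum.delta')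
qed

lemma P_E_comm:
  assumes "1 \<le> i" "i \<le> N" "1 \<le> j" "j \<le> N" "1 \<le> k" "k \<le> N" "\<chi> < d"
  shows "P k \<chi> * E i j = E i j * P k \<chi>"
proof -
  have "P k \<chi> * (P i \<psi> * P j \<psi>) = P i \<psi> * P j \<psi> * P k \<chi>" if "\<psi> < d" for \<psi>
    using PP_comm[of k i \<chi> \<psi>] PP_comm[of k j \<chi> \<psi>] assms that by (metis mult.assoc)
  thus ?thesis by (simp add: E_def sum_distrib_left sum_distrib_right)
qed

lemma P_E':
  assumes "1 \<le> i" "i \<le> N" "1 \<le> j" "j \<le> N" "\<chi> < d"
  shows "E i j * P i \<chi> = P i \<chi> * P j \<chi>" "P j \<chi> * E i j = P i \<chi> * P j \<chi>"
    "E i j * P j \<chi> = P i \<chi> * P j \<chi>"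
  using P_E[of i j \<chi>] P_E[of j i \<chi>] P_E_comm[of i j i \<chi>] P_E_comm[of i j j \<chi>] E_comm[of i j]
    PP_comm[of i j \<chi> \<chi>] assms by simp_all

lemma gE:
  assumes "1 \<le> i" "i < N" "1 \<le> j" "j \<le> N" "j \<noteq> i" "j \<noteq> i + 1"
  shows "g i * E i j = E (i + 1) j * g i" "g i * E (i + 1) j = E i j * g i"
    "g i * E j i = E j (i + 1) * g i" "g i * E j (i + 1) = E j i * g i"
proof -
  have 1: "g i * (P i \<chi> * P j \<chi>) = P (i+1) \<chi> * P j \<chi> * g i" if "\<chi> < d" for \<chi>
    using gP[of i \<chi>] gP_far[of i j \<chi>] assms that by (metis mult.assoc)
  have 2: "g i * (P (i+1) \<chi> * P j \<chi>) = P i \<chi> * P j \<chi> * g i" if "\<chi> < d" for \<chi>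
    using gP'[of i \<chi>] gP_far[of i j \<chi>] assms that by (metis mult.assoc)
  show a: "g i * E i j = E (i + 1) j * g i" "g i * E (i + 1) j = E i j * g i"
    using 1 2 by (simp_all add: E_def sum_distrib_left sum_distrib_right)
  show "g i * E j i = E j (i + 1) * g i" "g i * E j (i + 1) = E j i * g i"
    using a E_comm[of i j] E_comm[of "i+1" j] assms by simp_all
qed

lemma gE_same: 
  assumes "1 \<le> i" "i < N"
  shows "g i * E i (i + 1) = E i (i + 1) * g i"
proof -
  have "g i * (P i \<chi> * P (i+1) \<chi>) = P i \<chi> * P (i+1) \<chi> * g i" if "\<chi> < d" for \<chi>
    using gP[of i \<chi>] gP'[of i \<chi>] PP_comm[of i "i+1" \<chi> \<chi>] assms that
    by (metis mult.assoc le_add2 trans_le_add1 less_imp_le_nat Suc_leI Suc_eq_plus1)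
  thus ?thesis by (simp add: E_def sum_distrib_left sum_distrib_right)
qed

lemma gg: "1 \<le> i \<Longrightarrow> i < N \<Longrightarrow> g i * g i = 1 + sc c * (E i (i + 1) * g i)"
  using quad by (simp add: E_def)

text \<open>A projection cuts \<open>E i (i+1) * g i\<close> down to one colour, and the remaining
  projections can be carried through \<open>g i\<close>. In the form
  \<open>P i \<chi> * g i * P i \<chi>\<close> both outer factors have level \<open>i\<close>, as
  \<open>Sp_g\<close> and the Markov rule require.\<close>

lemma ggP:
  assumes "1 \<le> i" "i < N" "\<chi> < d"
  shows "P i \<chi> * (E i (i+1) * g i) = P (i+1) \<chi> * g i * P (i+1) \<chi>"
    "P (i+1) \<chi> * (E i (i+1) * g i) = P i \<chi> * g i * P i \<chi>"
    "E i (i+1) * g i * P i \<chi> = P i \<chi> * g i * P i \<chi>"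
    "E i (i+1) * g i * P (i+1) \<chi> = P i \<chi> * g i * P i \<chi>"
proof -
  note r = gP[of i \<chi>] gP'[of i \<chi>] PP_comm[of i "i+1" \<chi> \<chi>]
  have a: "P i \<chi> * P (i+1) \<chi> * g i = P (i+1) \<chi> * g i * P (i+1) \<chi>"
    "P i \<chi> * P (i+1) \<chi> * g i = P i \<chi> * g i * P i \<chi>"
    using r assms by (simp_all add: mult.assoc mult_ext[of "P i \<chi>" "P (Suc i) \<chi>"])
  note e = P_E[of i "i+1" \<chi>] P_E'[of i "i+1" \<chi>]
  show "P i \<chi> * (E i (i+1) * g i) = P (i+1) \<chi> * g i * P (i+1) \<chi>"
    "P (i+1) \<chi> * (E i (i+1) * g i) = P i \<chi> * g i * P i \<chi>"
    using e a assms by (simp_all flip: mult.assoc)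
  have "E i (i+1) * g i * P i \<chi> = E i (i+1) * P (i+1) \<chi> * g i"
    "E i (i+1) * g i * P (i+1) \<chi> = E i (i+1) * P i \<chi> * g i"
    using r assms by (simp_all add: mult.assoc)
  thus "E i (i+1) * g i * P i \<chi> = P i \<chi> * g i * P i \<chi>"
    "E i (i+1) * g i * P (i+1) \<chi> = P i \<chi> * g i * P i \<chi>"
    using e a assms by simp_all
qed

lemma Sp_rmult_P:
  assumes "n < N" "x \<in> Sp n" "\<psi> < d"
  shows "x * P (Suc n) \<psi> \<in> Sp n"
  using assms(2)
proof (induction rule: Sp.induct)
  case (Sp_P a \<chi>)
  have "a * P (Suc n) \<chi> * P (Suc n) \<psi> = (if \<chi> = \<psi> then a * P (Suc n) \<chi> else 0)"
    using PP_orth[of "Suc n" \<chi> \<psi>] assms Sp_P by (auto simp: mult.assoc)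
  thus ?case using Sp_P Sp_0 by (auto intro: Sp.Sp_P)
next
  case (Sp_g a b)
  have "a * g n * b * P (Suc n) \<psi> = a * (g n * P (Suc n) \<psi>) * b"
    using A_P_comm[OF Sp_g(3), of "Suc n" \<psi>] assms by (simp add: mult.assoc)
  also have "\<dots> = a * P n \<psi> * g n * b"
    using gP'[of n \<psi>] assms Sp_g by (simp add: mult.assoc)
  also have "\<dots> \<in> Sp n"
    using Sp_g assms by (intro Sp.Sp_g A_mult A_P) auto
  finally show ?case .
qed (auto simp: distrib_right intro: Sp_add)

text \<open>\<open>Sp n\<close> contains 1 and is closed under right multiplication by every
  generator of level \<open>n + 1\<close>. Only \<open>g n * b * g n\<close> needs work: the
  induction hypothesis splits \<open>b\<close> over level \<open>n - 1\<close>, and then the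
  quadratic or the braid relation leaves at most one \<open>g n\<close> in each term.\<close>

lemma A_Sp: "n < N \<Longrightarrow> x \<in> A (Suc n) \<Longrightarrow> x \<in> Sp n"
proof (induction n arbitrary: x rule: less_induct)
  case (less n)
  note n = \<open>n < N\<close>
  have rg: "y * g n \<in> Sp n" if "y \<in> Sp n" "1 \<le> n" for y
    using that(1)
  proof (induction rule: Sp.induct)
    case (Sp_P a \<chi>)
    have "a * P (Suc n) \<chi> * g n = a * g n * P n \<chi>"
      using gP[of n \<chi>] n that Sp_P by (simp add: mult.assoc)
    also have "\<dots> \<in> Sp n" using that Sp_P n by (intro Sp_g A_P) auto
    finally show ?case .
  next
    case (Sp_g a b)
    obtain k where k: "n = Suc k" using Sp_g(1) by (cases n) auto
    have gbg: "g n * b * g n \<in> Sp n" if "b \<in> Sp k" for b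
      using that
    proof (induction rule: Sp.induct)
      case (Sp_P u \<chi>)
      have "g n * (u * P (Suc k) \<chi>) * g n = u * (g n * g n) * P (Suc n) \<chi>"
        using g_A_left[OF Sp_P(1), of n] gP'[of n \<chi>] n k Sp_P(2) by (simp add: mult.assoc)
      also have "\<dots> = u * P (Suc n) \<chi> + sc c * (u * (P n \<chi> * g n * P n \<chi>))"
        using ggP(4)[of n \<chi>] n k Sp_P(2)
        by (simp only: gg) (simp add: distrib_left distrib_right mult.assoc sc_left_comm[of u])
      also have "\<dots> = u * P (Suc n) \<chi> + (sc c * u * P n \<chi>) * g n * P n \<chi>"
        by (simp add: mult.assoc)
      also have "\<dots> \<in> Sp n"
        using n k Sp_P A_mono[OF Sp_P(1), of n]
        by (intro Sp_add Sp.Sp_P Sp.Sp_g A_mult A_sc A_P) auto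
      finally show ?case .
    next
      case (Sp_g u v)
      have u: "u \<in> A n" "v \<in> A n" using Sp_g k A_mono by auto
      have "g n * (u * g k * v) * g n = u * (g n * g k * g n) * v"
        using g_A_left[OF Sp_g(2), of n] A_g_comm[OF Sp_g(3), of n] n k by (simp add: mult.assoc)
      also have "g n * g k * g n = g k * g n * g k"
        using braid[of k] Sp_g k n by simp
      also have "u * (g k * g n * g k) * v = (u * g k) * g n * (g k * v)"
        by (simp add: mult.assoc)
      also have "\<dots> \<in> Sp n"
        using u k Sp_g by (intro Sp.Sp_g A_mult A_g) auto
      finally show ?case .
    next
      case (Sp_add x y)
      thus ?case by (simp add: distrib_left distrib_right Sp.Sp_add)
    qed
    have "b \<in> Sp k" using less.IH[of k b] k n Sp_g by auto
    hence "a * (g n * b * g n) \<in> Sp n" by (rule Sp_lmult[OF gbg Sp_g(2)])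
    thus ?case by (simp add: mult.assoc)
  next
    case (Sp_add x y)
    thus ?case by (simp add: distrib_right Sp.Sp_add)
  qed
  have rm: "y * x \<in> Sp n" if "y \<in> Sp n" for y
    using less.prems(2) that
  proof (induction arbitrary: y rule: A.induct)
    case (A_sc a)
    thus ?case by (intro Sp_rmult n A.A_sc)
  next
    case (A_g i)
    show ?case
    proof (cases "i = n")
      case True thus ?thesis using rg A_g by simp
    next
      case False thus ?thesis using A_g n by (intro Sp_rmult A.A_g) auto
    qed
  next
    case (A_P j \<chi>)
    show ?case
    proof (cases "j = Suc n")
      case True thus ?thesis using Sp_rmult_P[OF n] A_P by simp
    next
      case False thus ?thesis using A_P n by (intro Sp_rmult A.A_P) auto
    qed
  next
    case (A_mult a b)
    from A_mult.IH(2)[OF A_mult.IH(1)[OF A_mult.prems]] show ?case by (simp add: mult.assoc)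
  next
    case (A_add a b)
    thus ?case by (simp add: distrib_left Sp_add)
  qed
  show ?case using rm[OF A_in_Sp[OF n A_1]] by simp
qed

lemma E_A: "1 \<le> i \<Longrightarrow> i \<le> n \<Longrightarrow> 1 \<le> j \<Longrightarrow> j \<le> n \<Longrightarrow> E i j \<in> A n"
  unfolding E_def by (intro A_sum A_mult A_P) auto

lemma E_A_comm:
  assumes "x \<in> A n" "n < k" "n < j" "k \<le> N" "j \<le> N"
  shows "E k j * x = x * E k j"
proof -
  have "P k \<chi> * P j \<chi> * x = x * (P k \<chi> * P j \<chi>)" if "\<chi> < d" for \<chi>
    using A_P_comm[of x n k \<chi>] A_P_comm[of x n j \<chi>] assms that
    by (metis mult.assoc)
  thus ?thesis by (simp add: E_def sum_distrib_left sum_distrib_right)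
qed

end


section \<open>The trace property\<close>

text \<open>Symmetry of \<open>\<tau>\<close> is not assumed but derived in \<open>tr_cyc\<close>.
  Until then a right factor cannot be moved to the front, which is why both rules carry
  \<open>b\<close>. The special shape of the weights \<open>Y\<close> enters only with
  \<open>tr_E\<close>.\<close>

locale weak_trace = coloured_hecke sc g P N d c
  for sc :: "complex \<Rightarrow> 'a::{ring,monoid_mult}" and g :: "nat \<Rightarrow> 'a" and P N d c +
  fixes \<tau> :: "'a \<Rightarrow> complex poly" and z :: "complex poly" and Y :: "nat \<Rightarrow> complex"
  assumes tr_add: "\<tau> (x + y) = \<tau> x + \<tau> y"
    and tr_sc: "\<tau> (sc s * x) = Polynomial.smult s (\<tau> x)"
    and tr_P: "n < N \<Longrightarrow> a \<in> A n \<Longrightarrow> b \<in> A n \<Longrightarrow> \<chi> < d \<Longrightarrow>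
       \<tau> (a * P (Suc n) \<chi> * b) = Polynomial.smult (Y \<chi>) (\<tau> (a * b))"
    and tr_g: "1 \<le> n \<Longrightarrow> n < N \<Longrightarrow> a \<in> A n \<Longrightarrow> b \<in> A n \<Longrightarrow> \<tau> (a * g n * b) = z * \<tau> (a * b)"
begin

lemma tr_0: "\<tau> 0 = 0"
  using tr_add[of 0 0] by simp

lemma tr_sum: "\<tau> (sum f I) = (\<Sum>i\<in>I. \<tau> (f i))"
  by (induction I rule: infinite_finite_induct) (auto simp: tr_add tr_0)

text \<open>Passing through \<open>g n\<close> changes \<open>P n \<chi>\<close> into
  \<open>P (Suc n) \<chi>\<close>, so the two factors \<open>g n\<close> meet and the quadratic
  relation applies; its two terms fall under \<open>tr_P\<close> and \<open>tr_g\<close>. The outer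
  factors \<open>l\<close> and \<open>r\<close> let one formula serve both sides of
  \<open>tr_gag\<close>.\<close>

lemma tr_gPg:
  assumes n: "n = Suc k" "n < N" and u: "u \<in> A k" and l: "l \<in> A n" "r \<in> A n" and \<chi>: "\<chi> < d"
  shows "\<tau> (l * g n * (u * P n \<chi>) * g n * r) =
    Polynomial.smult (Y \<chi>) (\<tau> (l * u * r)) + Polynomial.smult c (z * \<tau> (l * u * P n \<chi> * r))"
proof -
  have uA: "u \<in> A n" using u n A_mono by auto
  have "g n * (u * P n \<chi>) * g n = u * (g n * g n) * P (Suc n) \<chi>"
    using g_A_left[OF u, of n] gP'[of n \<chi>] n \<chi> by (simp add: mult.assoc)
  also have "\<dots> = u * P (Suc n) \<chi> + sc c * (u * (P n \<chi> * g n * P n \<chi>))"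
    using ggP(4)[of n \<chi>] n \<chi>
    by (simp only: gg) (simp add: distrib_left distrib_right mult.assoc sc_left_comm[of u])
  finally have *: "l * g n * (u * P n \<chi>) * g n * r =
      (l * u) * P (Suc n) \<chi> * r + sc c * ((l * u * P n \<chi>) * g n * (P n \<chi> * r))"
    by (simp add: distrib_left distrib_right mult.assoc sc_left_comm[of l])
  have "\<tau> ((l * u) * P (Suc n) \<chi> * r) = Polynomial.smult (Y \<chi>) (\<tau> (l * u * r))"
    using assms uA by (intro tr_P A_mult) auto
  moreover have "\<tau> ((l * u * P n \<chi>) * g n * (P n \<chi> * r)) = z * \<tau> ((l * u * P n \<chi>) * (P n \<chi> * r))"
    using assms uA by (intro tr_g A_mult A_P) auto
  moreover have "(l * u * P n \<chi>) * (P n \<chi> * r) = l * u * P n \<chi> * r"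
    using mult_ext1[OF P_idem[of n \<chi>]] n \<chi> by (simp add: mult.assoc)
  ultimately show ?thesis by (simp add: * tr_add tr_sc)
qed

text \<open>The braid relation leaves a single \<open>g n\<close>. Once the Markov rule has removed
  it, the two copies of \<open>g k\<close> meet in a square, which the quadratic relation
  opens.\<close>

lemma tr_ggg:
  assumes n: "n = Suc k" "1 \<le> k" "n < N" and uv: "u \<in> A k" "v \<in> A k" and l: "l \<in> A n" "r \<in> A n"
  shows "\<tau> (l * g n * (u * g k * v) * g n * r) =
    z * \<tau> (l * u * v * r) + Polynomial.smult c (z * \<tau> (l * u * (E k n * g k) * v * r))"
proof -
  have uvA: "u \<in> A n" "v \<in> A n" using uv n A_mono by auto
  have "l * g n * (u * g k * v) * g n * r = l * u * (g n * g k * g n) * v * r"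
    using g_A_left[OF uv(1), of n] g_A_left[OF uv(2), of n] n by (simp add: mult.assoc)
  also have "g n * g k * g n = g k * g n * g k" using braid[of k] n by simp
  also have "l * u * (g k * g n * g k) * v * r = (l * u * g k) * g n * (g k * v * r)"
    by (simp add: mult.assoc)
  also have "\<tau> \<dots> = z * \<tau> (l * u * g k * (g k * v * r))"
    using assms uvA by (intro tr_g A_mult A_g) auto
  also have "l * u * g k * (g k * v * r) = l * u * (g k * g k) * v * r"
    by (simp add: mult.assoc)
  also have "\<dots> = l * u * v * r + sc c * (l * u * (E k n * g k) * v * r)"
    using n gg[of k] by (simp add: distrib_left distrib_right mult.assoc sc_left_comm[of u] sc_left_comm[of l])
  finally show ?thesis by (simp add: tr_add tr_sc distrib_left)
qed

text \<open>In \<open>tr_gag\<close>, if both factors contain \<open>g\<^sub>k\<close>, the two sides differ by these terms.\<close>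

lemma tr_EgwgE:
  assumes n: "n = Suc k" "1 \<le> k" "k < N" and w: "w \<in> A k" and l: "l \<in> A k" "r \<in> A k"
  shows "\<tau> (l * (E k n * g k) * w * g k * r) = \<tau> (l * g k * w * (E k n * g k) * r)"
proof -
  obtain m where m: "k = Suc m" using n by (cases k) auto
  have "w \<in> Sp m" using A_Sp[of m w] w m n by simp
  thus ?thesis
  proof (induction rule: Sp.induct)
    case (Sp_P p \<chi>)
    have "(E k n * g k) * (p * P (Suc m) \<chi>) * g k = p * ((E k n * g k) * P k \<chi> * g k)"
      using g_A_left[OF Sp_P(1), of k] mult_ext[OF E_A_comm[OF Sp_P(1), of k n]] n m by (simp add: mult.assoc)
    also have "(E k n * g k) * P k \<chi> * g k = g k * P k \<chi> * (E k n * g k)"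
      using gE_same[of k] mult_ext[OF P_E_comm[of k n k \<chi>]] mult_ext[OF gE_same[of k]] n Sp_P
      by (simp add: mult.assoc)
    also have "p * (g k * P k \<chi> * (E k n * g k)) = g k * (p * P (Suc m) \<chi>) * (E k n * g k)"
      using g_A_left[OF Sp_P(1), of k] n m by (simp add: mult.assoc)
    finally show ?case by (simp add: mult.assoc)
  next
    case (Sp_g p s)
    have pA: "p \<in> A k" "s \<in> A k" using Sp_g m A_mono by auto
    have n': "n = k + 1" "k = m + 1" using n m by simp_all
    note gl = A_g_comm[OF Sp_g(3), of k] g_A_left[OF Sp_g(2), of k] g_A_left[OF Sp_g(3), of k]
      mult_ext[OF E_A_comm[OF Sp_g(2), of k n]] mult_ext[OF E_A_comm[OF Sp_g(3), of k n]]
    have br: "g k * g m * g k = g m * g k * g m" using braid[of m] Sp_g m n by simp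
    \<comment> \<open>The idempotent \<open>E k n\<close> is carried along by \<open>g k\<close> and
      \<open>g m\<close> until it becomes \<open>E m k\<close>. The two products then differ only in
      \<open>E m k\<close> standing to the right or to the left of \<open>g k\<close>, and they
      agree under the trace once \<open>tr_g\<close> has removed \<open>g k\<close>.\<close>
    have "(E k n * g k) * (p * g m * s) * g k = p * E k n * (g k * g m * g k) * s"
      using gl n m by (simp add: mult.assoc)
    also have "\<dots> = p * (E k n * g m) * g k * g m * s"
      unfolding br by (simp add: mult.assoc)
    also have "E k n * g m = g m * E m n" using gE(1)[of m n] n m Sp_g by simp
    also have "p * (g m * E m n) * g k * g m * s = p * g m * (E m n * g k) * g m * s"
      by (simp add: mult.assoc)
    also have "E m n * g k = g k * E m k" using gE(3)[of k m] n m Sp_g by simp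
    finally have 1: "(E k n * g k) * (p * g m * s) * g k = p * g m * g k * (E m k * g m * s)"
      by (simp add: mult.assoc)
    have "g k * (p * g m * s) * (E k n * g k) = p * g k * g m * (s * E k n) * g k"
      using gl n m by (simp add: mult.assoc)
    also have "s * E k n = E k n * s" using E_A_comm[OF Sp_g(3), of k n] n m by simp
    also have "p * g k * g m * (E k n * s) * g k = p * g k * g m * E k n * g k * s"
      using gl n m by (simp add: mult.assoc)
    also have "\<dots> = p * (g k * g m * g k) * E k n * s"
      using mult_ext[OF gE_same[of k]] n by (simp add: mult.assoc)
    also have "\<dots> = p * g m * g k * (g m * E k n) * s"
      unfolding br by (simp add: mult.assoc)
    also have "g m * E k n = E m n * g m" using gE(2)[of m n] n m Sp_g by simp
    also have "p * g m * g k * (E m n * g m) * s = p * g m * (g k * E m n) * g m * s"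
      by (simp add: mult.assoc)
    also have "g k * E m n = E m k * g k" using gE(4)[of k m] n m Sp_g by simp
    finally have 2: "g k * (p * g m * s) * (E k n * g k) = p * g m * E m k * g k * (g m * s)"
      by (simp add: mult.assoc)
    have EA: "E m k \<in> A k" "g m \<in> A k" using Sp_g m by (auto intro: E_A A_g)
    have "\<tau> (l * (E k n * g k) * (p * g m * s) * g k * r) = \<tau> ((l * p * g m) * g k * (E m k * g m * s * r))"
      using arg_cong[OF 1, of "\<lambda>x. l * x * r"] by (simp add: mult.assoc)
    also have "\<dots> = z * \<tau> ((l * p * g m) * (E m k * g m * s * r))"
      using n l pA EA by (intro tr_g A_mult) auto
    also have "\<dots> = z * \<tau> ((l * p * g m * E m k) * (g m * s * r))"
      by (simp add: mult.assoc)
    also have "\<dots> = \<tau> ((l * p * g m * E m k) * g k * (g m * s * r))"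
      using n l pA EA by (intro tr_g[symmetric] A_mult) auto
    also have "\<dots> = \<tau> (l * g k * (p * g m * s) * (E k n * g k) * r)"
      using arg_cong[OF 2, of "\<lambda>x. l * x * r"] by (simp add: mult.assoc)
    finally show ?case .
  next
    case (Sp_add x y)
    thus ?case by (simp add: distrib_left distrib_right tr_add)
  qed
qed


lemma tr_P1: "n < N \<Longrightarrow> a \<in> A n \<Longrightarrow> \<chi> < d \<Longrightarrow> \<tau> (a * P (Suc n) \<chi>) = Polynomial.smult (Y \<chi>) (\<tau> a)"
  using tr_P[of n a 1 \<chi>] by simp

text \<open>The only case of symmetry that the Markov rules do not reach directly, since
  \<open>g n\<close> occurs twice on each side. Splitting \<open>a\<close> and \<open>b\<close> over
  level \<open>k\<close> gives four cases; in three of them the formulas \<open>tr_gPg\<close> and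
  \<open>tr_ggg\<close> already yield equal expressions, and the fourth needs
  \<open>tr_EgwgE\<close>.\<close>

lemma tr_gag:
  assumes n: "n = Suc k" "n < N" and a: "a \<in> A n" and b: "b \<in> A n"
  shows "\<tau> (g n * a * g n * b) = \<tau> (a * g n * b * g n)"
proof -
  have n': "1 \<le> n" "n \<le> N" "k < N" "k < n" using n by auto
  have up: "x \<in> A n" if "x \<in> A k" for x using that n' A_mono by auto
  have sp: "x \<in> Sp k" if "x \<in> A n" for x using A_Sp[of k x] n n' that by simp
  have L1: "\<tau> (g n * (u * P n \<chi>) * g n * r) = Polynomial.smult (Y \<chi>) (\<tau> (u * r)) + Polynomial.smult c (z * \<tau> (u * P n \<chi> * r))"
    and R1: "\<tau> (r * g n * (u * P n \<chi>) * g n) = Polynomial.smult (Y \<chi>) (\<tau> (r * u)) + Polynomial.smult c (z * \<tau> (r * u * P n \<chi>))"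
    if "u \<in> A k" "r \<in> A n" "\<chi> < d" for u r \<chi>
    using tr_gPg[of n k u 1 r \<chi>] tr_gPg[of n k u r 1 \<chi>] n that by auto
  have L2: "\<tau> (g n * (u * g k * v) * g n * r) = z * \<tau> (u * v * r) + Polynomial.smult c (z * \<tau> (u * (E k n * g k) * v * r))"
    and R2: "\<tau> (r * g n * (u * g k * v) * g n) = z * \<tau> (r * u * v) + Polynomial.smult c (z * \<tau> (r * u * (E k n * g k) * v))"
    if "1 \<le> k" "u \<in> A k" "v \<in> A k" "r \<in> A n" for u v r
    using tr_ggg[of n k u v 1 r] tr_ggg[of n k u v r 1] n that by auto
  have Pc: "P n \<chi> * (x * y) = x * (P n \<chi> * y)" "P n \<chi> * x = x * P n \<chi>" if "x \<in> A k" "\<chi> < d" for x y \<chi>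
    using P_A_left[OF that(1), of n \<chi> y] A_P_comm[OF that(1), of n \<chi>] n' that by auto
  have tg: "\<tau> (u * g k * v) = z * \<tau> (u * v)" if "1 \<le> k" "u \<in> A k" "v \<in> A k" for u v
    using tr_g[of k u v] n' that by simp
  have gPk: "g k * P n \<chi> = P k \<chi> * g k" "P n \<chi> * g k = g k * P k \<chi>" if "1 \<le> k" "\<chi> < d" for \<chi>
    using gP'[of k \<chi>] gP[of k \<chi>] n that by simp_all
  have PEg: "P n \<chi> * (E k n * g k) = P k \<chi> * g k * P k \<chi>" "E k n * g k * P n \<chi> = P k \<chi> * g k * P k \<chi>"
    if "1 \<le> k" "\<chi> < d" for \<chi>
    using ggP[of k \<chi>] n n' that by simp_all
  have Pkk: "P k \<chi> * (P k \<chi> * y) = P k \<chi> * y" if "1 \<le> k" "\<chi> < d" for \<chi> y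
    using mult_ext1[OF P_idem[of k \<chi>]] n' that by simp
  show ?thesis
    using sp[OF a] sp[OF b]
  proof (induction arbitrary: rule: Sp.induct)
    case aP: (Sp_P u \<chi>)
    note u = up[OF aP(1)]
    from aP(3) show ?case
    proof (induction rule: Sp.induct)
      case (Sp_P v \<psi>)
      note v = up[OF Sp_P(1)]
      have "\<tau> (u * (v * P n \<psi>)) = Polynomial.smult (Y \<psi>) (\<tau> (u * v))"
        using tr_P1[of k "u * v" \<psi>] Sp_P aP n n' by (simp add: A_mult mult.assoc)
      moreover have "\<tau> (u * P n \<chi> * v) = Polynomial.smult (Y \<chi>) (\<tau> (u * v))"
        using tr_P[of k u v \<chi>] Sp_P aP n n' by simp
      moreover have "\<tau> (g n * (u * P n \<chi>) * g n * (v * P n \<psi>)) =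
          Polynomial.smult (Y \<chi>) (\<tau> (u * (v * P n \<psi>))) + Polynomial.smult c (z * \<tau> (u * P n \<chi> * (v * P n \<psi>)))"
        using aP Sp_P v n' by (intro L1 A_mult A_P) auto
      moreover have "\<tau> (u * P n \<chi> * g n * (v * P n \<psi>) * g n) =
          Polynomial.smult (Y \<psi>) (\<tau> (u * P n \<chi> * v)) + Polynomial.smult c (z * \<tau> (u * P n \<chi> * v * P n \<psi>))"
        using aP Sp_P u n' by (intro R1 A_mult A_P) auto
      ultimately show ?case by (simp add: n(1)[symmetric] mult.assoc mult.commute[of "Y \<chi>"])
    next
      case (Sp_g v w)
      note vw = up[OF Sp_g(2)] up[OF Sp_g(3)]
      have "\<tau> (g n * (u * P n \<chi>) * g n * (v * g k * w)) =
          Polynomial.smult (Y \<chi>) (\<tau> (u * (v * g k * w))) + Polynomial.smult c (z * \<tau> (u * P n \<chi> * (v * g k * w)))"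
        using aP Sp_g vw n' n by (intro L1 A_mult A_g) auto
      also have "u * (v * g k * w) = (u * v) * g k * w" by (simp add: mult.assoc)
      also have "\<tau> \<dots> = z * \<tau> (u * v * w)" using aP Sp_g by (intro tg A_mult)
      also have "u * P n \<chi> * (v * g k * w) = (u * v) * g k * (P k \<chi> * w)"
        using gPk Pc aP Sp_g by (simp add: mult.assoc) (simp flip: mult.assoc)
      also have "\<tau> \<dots> = z * \<tau> (u * v * (P k \<chi> * w))" using aP Sp_g by (intro tg A_mult A_P) auto
      finally have l: "\<tau> (g n * (u * P n \<chi>) * g n * (v * g k * w)) =
         Polynomial.smult (Y \<chi>) (z * \<tau> (u * v * w)) + Polynomial.smult c (z * (z * \<tau> (u * v * P k \<chi> * w)))"
         by (simp add: mult.assoc)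
      have "\<tau> (u * P n \<chi> * g n * (v * g k * w) * g n) =
          z * \<tau> (u * P n \<chi> * v * w) + Polynomial.smult c (z * \<tau> (u * P n \<chi> * v * (E k n * g k) * w))"
        using aP Sp_g u n' by (intro R2 A_mult A_P) auto
      also have "u * P n \<chi> * v * w = u * P n \<chi> * (v * w)" by (simp add: mult.assoc)
      also have "\<tau> \<dots> = Polynomial.smult (Y \<chi>) (\<tau> (u * v * w))"
        using tr_P[of k u "v * w" \<chi>] Sp_g aP n n' by (simp add: A_mult mult.assoc)
      also have "u * P n \<chi> * v * (E k n * g k) * w = u * v * (P n \<chi> * (E k n * g k)) * w"
        using Pc aP Sp_g by (simp add: mult.assoc)
      also have "\<dots> = (u * v * P k \<chi>) * g k * (P k \<chi> * w)"
        using PEg aP Sp_g by (simp add: mult.assoc)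
      also have "\<tau> \<dots> = z * \<tau> ((u * v * P k \<chi>) * (P k \<chi> * w))"
        using aP Sp_g by (intro tg A_mult A_P) auto
      also have "(u * v * P k \<chi>) * (P k \<chi> * w) = u * v * P k \<chi> * w"
        using Pkk aP Sp_g by (simp add: mult.assoc)
      finally show ?case using l by (simp add: n(1)[symmetric])
    next
      case (Sp_add x y)
      thus ?case by (simp add: distrib_left distrib_right tr_add)
    qed
  next
    case ag: (Sp_g v w)
    note vw = up[OF ag(2)] up[OF ag(3)]
    from ag(4) show ?case
    proof (induction rule: Sp.induct)
      case (Sp_P u \<chi>)
      note u = up[OF Sp_P(1)]
      have "\<tau> (g n * (v * g k * w) * g n * (u * P n \<chi>)) =
          z * \<tau> (v * w * (u * P n \<chi>)) + Polynomial.smult c (z * \<tau> (v * (E k n * g k) * w * (u * P n \<chi>)))"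
        using ag Sp_P u n' by (intro L2 A_mult A_P) auto
      also have "v * w * (u * P n \<chi>) = (v * w * u) * P (Suc k) \<chi>" by (simp add: n mult.assoc)
      also have "\<tau> \<dots> = Polynomial.smult (Y \<chi>) (\<tau> (v * w * u))" using ag Sp_P n' by (intro tr_P1 A_mult) auto
      also have "v * (E k n * g k) * w * (u * P n \<chi>) = v * (E k n * g k * P n \<chi>) * w * u"
        using Pc ag Sp_P by (simp add: mult.assoc) 
      also have "\<dots> = (v * P k \<chi>) * g k * (P k \<chi> * w * u)"
        using PEg ag Sp_P by (simp add: mult.assoc)
      also have "\<tau> \<dots> = z * \<tau> ((v * P k \<chi>) * (P k \<chi> * w * u))"
        using ag Sp_P by (intro tg A_mult A_P) auto
      also have "(v * P k \<chi>) * (P k \<chi> * w * u) = v * P k \<chi> * w * u"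
        using Pkk ag Sp_P by (simp add: mult.assoc)
      finally have l: "\<tau> (g n * (v * g k * w) * g n * (u * P n \<chi>)) =
          z * Polynomial.smult (Y \<chi>) (\<tau> (v * w * u)) + Polynomial.smult c (z * (z * \<tau> (v * P k \<chi> * w * u)))" .
      have "\<tau> ((v * g k * w) * g n * (u * P n \<chi>) * g n) =
          Polynomial.smult (Y \<chi>) (\<tau> ((v * g k * w) * u)) + Polynomial.smult c (z * \<tau> ((v * g k * w) * u * P n \<chi>))"
        using ag Sp_P vw n n' by (intro R1 A_mult A_g) auto
      also have "(v * g k * w) * u = v * g k * (w * u)" by (simp add: mult.assoc)
      also have "\<tau> \<dots> = z * \<tau> (v * (w * u))" using ag Sp_P by (intro tg A_mult)
      also have "v * g k * (w * u) * P n \<chi> = v * (g k * P n \<chi>) * w * u"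
        using Pc ag Sp_P by (simp add: mult.assoc)
      also have "\<dots> = (v * P k \<chi>) * g k * (w * u)" using gPk ag Sp_P by (simp add: mult.assoc)
      also have "\<tau> \<dots> = z * \<tau> ((v * P k \<chi>) * (w * u))" using ag Sp_P by (intro tg A_mult A_P) auto
      finally show ?case using l by (simp add: n(1)[symmetric] mult.assoc)
    next
      case (Sp_g u s)
      note us = up[OF Sp_g(2)] up[OF Sp_g(3)]
      have EgA: "E k n \<in> A n" using ag n n' by (intro E_A) auto
      have gA: "g k \<in> A n" using ag n n' by (intro A_g) auto
      have t: "\<tau> (v * w * (u * g k * s)) = z * \<tau> (v * w * u * s)"
        using tg[of "v * w * u" s] ag Sp_g by (simp add: A_mult mult.assoc)
      have t': "\<tau> (v * g k * w * u * s) = z * \<tau> (v * w * u * s)"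
        using tg[of v "w * u * s"] ag Sp_g by (simp add: A_mult mult.assoc)
      have "\<tau> (v * (E k n * g k) * (w * u) * g k * s) = \<tau> (v * g k * (w * u) * (E k n * g k) * s)"
        using ag Sp_g n n' by (intro tr_EgwgE A_mult) auto
      moreover have "\<tau> (g n * (v * g k * w) * g n * (u * g k * s)) =
          z * \<tau> (v * w * (u * g k * s)) + Polynomial.smult c (z * \<tau> (v * (E k n * g k) * w * (u * g k * s)))"
        using ag Sp_g us gA by (intro L2 A_mult) auto
      moreover have "\<tau> ((v * g k * w) * g n * (u * g k * s) * g n) =
          z * \<tau> ((v * g k * w) * u * s) + Polynomial.smult c (z * \<tau> ((v * g k * w) * u * (E k n * g k) * s))"
        using ag Sp_g vw gA by (intro R2 A_mult) auto
      ultimately show ?case using t t' by (simp add: mult.assoc)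
    next
      case (Sp_add x y)
      thus ?case by (simp add: distrib_left distrib_right tr_add)
    qed
  next
    case (Sp_add x y)
    thus ?case by (simp add: distrib_left distrib_right tr_add)
  qed
qed

text \<open>The elements \<open>b\<close> that satisfy the equation for all \<open>a\<close> are
  closed under sums and products, so generators suffice. Those of level \<open>n\<close> reduce to
  the previous level by the Markov rules, \<open>g n\<close> is covered by \<open>tr_gag\<close>,
  and the projection on strand \<open>n + 1\<close> is carried through \<open>g n\<close> to strand
  \<open>n\<close>.\<close>

theorem tr_cyc: "n \<le> N \<Longrightarrow> a \<in> A n \<Longrightarrow> b \<in> A n \<Longrightarrow> \<tau> (a * b) = \<tau> (b * a)"
proof (induction n arbitrary: a b)
  case 0
  thus ?case using A0_central by simp
next
  case (Suc n)
  have n: "n < N" "n \<le> N" using Suc by auto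
  have small: "\<tau> (x * y) = \<tau> (y * x)" if "x \<in> Sp n" "y \<in> A n" for x y
    using that(1)
  proof (induction rule: Sp.induct)
    case (Sp_P a \<chi>)
    have "\<tau> (a * P (Suc n) \<chi> * y) = Polynomial.smult (Y \<chi>) (\<tau> (a * y))" "\<tau> (y * (a * P (Suc n) \<chi>)) = Polynomial.smult (Y \<chi>) (\<tau> (y * a))"
      using tr_P[of n a y \<chi>] tr_P1[of n "y * a" \<chi>] n that Sp_P by (simp_all add: A_mult mult.assoc)
    thus ?case using Suc.IH[OF n(2), of a y] Sp_P that by simp
  next
    case (Sp_g a b)
    have "\<tau> (a * g n * b * y) = z * \<tau> (a * (b * y))" "\<tau> (y * (a * g n * b)) = z * \<tau> (y * (a * b))"
      using tr_g[of n a "b * y"] tr_g[of n "y * a" b] n that Sp_g by (simp_all add: A_mult mult.assoc)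
    thus ?case using Suc.IH[OF n(2), of "a * b" y] Sp_g that by (simp add: A_mult mult.assoc)
  qed (auto simp: distrib_left distrib_right tr_add)
  have gcase: "\<tau> (x * g n) = \<tau> (g n * x)" if "x \<in> Sp n" "1 \<le> n" for x
    using that(1)
  proof (induction rule: Sp.induct)
    case (Sp_P a \<chi>)
    have PA: "P n \<chi> \<in> A n" using that Sp_P by (intro A_P) auto
    have "\<tau> (a * P (Suc n) \<chi> * g n) = \<tau> (a * g n * P n \<chi>)"
      using gP[of n \<chi>] n that Sp_P by (simp add: mult.assoc)
    also have "\<dots> = z * \<tau> (a * P n \<chi>)" using that n Sp_P PA by (intro tr_g) auto
    also have "\<dots> = z * \<tau> (P n \<chi> * a)" using Suc.IH[OF n(2), of a "P n \<chi>"] PA Sp_P by simp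
    also have "\<dots> = \<tau> (P n \<chi> * g n * a)" using that n Sp_P PA by (intro tr_g[symmetric]) auto
    also have "P n \<chi> * g n * a = g n * (a * P (Suc n) \<chi>)"
      using gP'[of n \<chi>] A_P_comm[OF Sp_P(1), of "Suc n" \<chi>] n that Sp_P by (simp flip: mult.assoc)
    finally show ?case .
  next
    case (Sp_g a b)
    then obtain k where k: "n = Suc k" by (cases n) auto
    show ?case using tr_gag[OF k n(1) Sp_g(2,3)] by (simp add: mult.assoc)
  qed (auto simp: distrib_left distrib_right tr_add)
  have Pcase: "\<tau> (x * P (Suc n) \<psi>) = \<tau> (P (Suc n) \<psi> * x)" if "x \<in> Sp n" "\<psi> < d" for x \<psi>
    using that(1)
  proof (induction rule: Sp.induct)
    case (Sp_P a \<chi>)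
    have "a * P (Suc n) \<chi> * P (Suc n) \<psi> = P (Suc n) \<psi> * (a * P (Suc n) \<chi>)"
      using P_A_left[OF Sp_P(1), of "Suc n" \<psi>] PP_comm[of "Suc n" "Suc n" \<chi> \<psi>] n that Sp_P by (simp add: mult.assoc)
    thus ?case by simp
  next
    case (Sp_g a b)
    have PA: "P n \<psi> \<in> A n" using that Sp_g by (intro A_P) auto
    have "a * g n * b * P (Suc n) \<psi> = a * (g n * P (Suc n) \<psi>) * b"
      using A_P_comm[OF Sp_g(3), of "Suc n" \<psi>] n that by (simp add: mult.assoc)
    also have "\<dots> = a * P n \<psi> * g n * b" using gP'[of n \<psi>] Sp_g that n by (simp add: mult.assoc)
    also have "\<tau> \<dots> = z * \<tau> (a * P n \<psi> * b)"
      using Sp_g PA n by (intro tr_g A_mult)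
    also have "\<dots> = z * \<tau> (a * (P n \<psi> * b))" by (simp add: mult.assoc)
    also have "\<dots> = \<tau> (a * g n * (P n \<psi> * b))"
      using Sp_g PA n by (intro tr_g[symmetric] A_mult)
    also have "a * g n * (P n \<psi> * b) = a * (P (Suc n) \<psi> * g n) * b"
      using mult_ext[OF gP[of n \<psi>]] Sp_g that n by (simp add: mult.assoc)
    also have "\<dots> = P (Suc n) \<psi> * (a * g n * b)"
      using P_A_left[OF Sp_g(2), of "Suc n" \<psi>] n that by (simp add: mult.assoc)
    finally show ?case .
  qed (auto simp: distrib_left distrib_right tr_add)
  have Sp: "x \<in> Sp n" if "x \<in> A (Suc n)" for x using A_Sp n that by auto
  show ?case
    using Suc.prems(3,2)
  proof (induction arbitrary: a rule: A.induct)
    case (A_sc s) thus ?case using small[OF Sp, of a "sc s"] A.A_sc by auto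
  next
    case (A_g i)
    show ?case
    proof (cases "i = n")
      case True thus ?thesis using gcase[OF Sp] A_g by simp
    next
      case False thus ?thesis using A_g small[OF Sp, of a "g i"] by (simp add: A.A_g)
    qed
  next
    case (A_P j \<chi>)
    show ?case
    proof (cases "j = Suc n")
      case True thus ?thesis using Pcase[OF Sp] A_P by simp
    next
      case False thus ?thesis using A_P small[OF Sp, of a "P j \<chi>"] by (simp add: A.A_P)
    qed
  next
    case (A_add x y)
    thus ?case by (simp add: distrib_left distrib_right tr_add)
  next
    case (A_mult x y)
    have "\<tau> (a * x * y) = \<tau> (y * (a * x))" using A_mult by (intro A_mult.IH(2) A.A_mult)
    also have "\<dots> = \<tau> ((y * a) * x)" by (simp add: mult.assoc)
    also have "\<dots> = \<tau> (x * (y * a))" using A_mult by (intro A_mult.IH(1) A.A_mult)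
    finally show ?case by (simp add: mult.assoc)
  qed
qed

text \<open>In \<open>a * g n * b * P (Suc n) \<chi>\<close> the projection passes to strand
  \<open>n\<close>; after the Markov rule has removed \<open>g n\<close>, symmetry brings it to the
  end again, one level lower. In \<open>a * P (Suc n) \<psi> * P (Suc n) \<chi>\<close> either
  orthogonality or the zero weight gives 0.\<close>

lemma tr_P_zero:
  assumes "Y \<chi> = 0" "\<chi> < d"
  shows "1 \<le> n \<Longrightarrow> n \<le> N \<Longrightarrow> a \<in> A n \<Longrightarrow> \<tau> (a * P n \<chi>) = 0"
proof (induction n arbitrary: a)
  case (Suc n)
  have n: "n < N" "n \<le> N" using Suc by auto
  have "a \<in> Sp n" using A_Sp Suc by auto
  thus ?case
  proof (induction rule: Sp.induct)
    case (Sp_P a \<psi>)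
    thus ?case using PP_orth[of "Suc n" \<psi> \<chi>] tr_P1[of n a \<chi>] n assms by (simp add: mult.assoc tr_0)
  next
    case (Sp_g a b)
    have PA: "P n \<chi> \<in> A n" using assms Sp_g by (intro A_P) auto
    have "a * g n * b * P (Suc n) \<chi> = a * (g n * P (Suc n) \<chi>) * b"
      using A_P_comm[OF Sp_g(3), of "Suc n" \<chi>] n assms by (simp add: mult.assoc)
    also have "\<dots> = (a * P n \<chi>) * g n * b" using gP'[of n \<chi>] Sp_g assms n by (simp add: mult.assoc)
    also have "\<tau> \<dots> = z * \<tau> (a * P n \<chi> * b)"
      using Sp_g PA n by (intro tr_g A_mult)
    also have "\<tau> (a * P n \<chi> * b) = \<tau> (b * (a * P n \<chi>))"
      using Sp_g PA n by (intro tr_cyc A_mult) auto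
    also have "\<dots> = \<tau> ((b * a) * P n \<chi>)" by (simp add: mult.assoc)
    also have "\<dots> = 0" using Sp_g n by (intro Suc.IH A_mult)
    finally show ?case by simp
  qed (auto simp: distrib_right tr_add)
qed simp

text \<open>Here the E-system enters, in the form that the weights have at most one nonzero value
  \<open>y\<close>: by \<open>tr_P_zero\<close> each weight may be replaced by \<open>y\<close>, and
  the projections then add up to 1.\<close>

lemma tr_E:
  assumes n: "1 \<le> n" "n < N" "a \<in> A n" and Y: "\<And>\<chi>. \<chi> < d \<Longrightarrow> Y \<chi> = 0 \<or> Y \<chi> = y"
  shows "\<tau> (a * E n (Suc n)) = Polynomial.smult y (\<tau> a)"
proof -
  have "\<tau> (a * E n (Suc n)) = (\<Sum>\<chi><d. \<tau> (a * P n \<chi> * P (Suc n) \<chi>))"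
    by (simp add: E_def sum_distrib_left tr_sum mult.assoc)
  also have "\<dots> = (\<Sum>\<chi><d. Polynomial.smult (Y \<chi>) (\<tau> (a * P n \<chi>)))"
    using n by (intro sum.cong refl tr_P1 A_mult A_P) auto
  also have "\<dots> = (\<Sum>\<chi><d. Polynomial.smult y (\<tau> (a * P n \<chi>)))"
    using Y tr_P_zero[of _ n a] n by (intro sum.cong refl) fastforce
  also have "\<dots> = Polynomial.smult y (\<tau> (\<Sum>\<chi><d. a * P n \<chi>))" by (simp add: sum_distrib_left flip: tr_sc tr_sum)
  also have "(\<Sum>\<chi><d. a * P n \<chi>) = a" using P_sum[of n] n by (simp flip: sum_distrib_left)
  finally show ?thesis .
qed

text \<open>For every colour \<open>P n \<chi> * P (Suc n) \<chi> * g n\<close> equals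
  \<open>P n \<chi> * g n * P n \<chi>\<close>, to which the Markov rule for \<open>g n\<close>
  applies; so the result does not depend on the weights.\<close>

lemma tr_Eg:
  assumes n: "1 \<le> n" "n < N" "a \<in> A n"
  shows "\<tau> (a * E n (Suc n) * g n) = z * \<tau> a"
proof -
  have "P n \<chi> * P (Suc n) \<chi> * g n = P n \<chi> * g n * P n \<chi>" if "\<chi> < d" for \<chi>
    using gP[of n \<chi>] n that by (simp add: mult.assoc)
  hence "a * E n (Suc n) * g n = (\<Sum>\<chi><d. (a * P n \<chi>) * g n * P n \<chi>)"
    unfolding E_def sum_distrib_left sum_distrib_right by (intro sum.cong refl) (simp add: mult.assoc)
  hence "\<tau> (a * E n (Suc n) * g n) = (\<Sum>\<chi><d. \<tau> ((a * P n \<chi>) * g n * P n \<chi>))"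
    by (simp add: tr_sum)
  also have "\<dots> = (\<Sum>\<chi><d. z * \<tau> (a * P n \<chi> * P n \<chi>))"
    using n by (intro sum.cong refl tr_g A_mult A_P) auto
  also have "\<dots> = (\<Sum>\<chi><d. z * \<tau> (a * P n \<chi>))"
    using P_idem[of n] n by (intro sum.cong refl) (simp add: mult.assoc)
  also have "\<dots> = z * \<tau> (\<Sum>\<chi><d. a * P n \<chi>)" by (simp add: tr_sum sum_distrib_left)
  also have "(\<Sum>\<chi><d. a * P n \<chi>) = a" using P_sum[of n] n by (simp flip: sum_distrib_left)
  finally show ?thesis .
qed

end


section \<open>The subalgebra generated by the braid generators\<close>

context coloured_hecke
begin

inductive_set Br :: "nat \<Rightarrow> 'a set" for n where
  Br_sc: "sc a \<in> Br n"
| Br_g: "1 \<le> i \<Longrightarrow> i < n \<Longrightarrow> g i \<in> Br n"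
| Br_add: "x \<in> Br n \<Longrightarrow> y \<in> Br n \<Longrightarrow> x + y \<in> Br n"
| Br_mult: "x \<in> Br n \<Longrightarrow> y \<in> Br n \<Longrightarrow> x * y \<in> Br n"

lemma Br_1 [simp]: "1 \<in> Br n" using Br_sc[of 1 n] sc_1 by simp
lemma Br_0 [simp]: "0 \<in> Br n" using Br_sc[of 0 n] sc_0 by simp

lemma Br_diff: "x \<in> Br n \<Longrightarrow> y \<in> Br n \<Longrightarrow> x - y \<in> Br n"
  using Br_add[OF _ Br_mult[OF Br_sc[of "-1"]], of x n y] by (simp add: sc_minus sc_1)

lemma Br_mono: "x \<in> Br n \<Longrightarrow> n \<le> m \<Longrightarrow> x \<in> Br m"
  by (induction rule: Br.induct) (auto intro: Br.intros)

lemma Br_A: "x \<in> Br n \<Longrightarrow> x \<in> A n"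
  by (induction rule: Br.induct) (auto intro: A.intros)

text \<open>Unlike \<open>E i (i + 1)\<close>, the element \<open>F i\<close> always lies in the subalgebra generated by the \<open>g\<^sub>j\<close>;
  it vanishes if \<open>c = 0\<close>, and the uniqueness proof needs no case distinction.\<close>

definition F :: "nat \<Rightarrow> 'a" where
  "F i = sc c * E i (Suc i)"

lemma EE_comm:
  assumes "1 \<le> i" "i \<le> N" "1 \<le> j" "j \<le> N" "1 \<le> k" "k \<le> N" "1 \<le> l" "l \<le> N"
  shows "E i j * E k l = E k l * E i j"
proof -
  have "P k \<chi> * P l \<chi> * E i j = E i j * (P k \<chi> * P l \<chi>)" if "\<chi> < d" for \<chi>
    using P_E_comm[of i j k \<chi>] P_E_comm[of i j l \<chi>] assms that by (metis mult.assoc)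
  thus ?thesis by (simp add: E_def[of k l] sum_distrib_left sum_distrib_right)
qed

lemma E_mult:
  assumes "1 \<le> i" "i \<le> N" "1 \<le> j" "j \<le> N" "1 \<le> k" "k \<le> N"
  shows "E i j * E j k = (\<Sum>\<chi><d. P i \<chi> * (P j \<chi> * P k \<chi>))"
    "E i k * E j k = (\<Sum>\<chi><d. P i \<chi> * (P j \<chi> * P k \<chi>))"
  unfolding E_def[of i] sum_distrib_right mult.assoc
  using assms by (auto intro!: sum.cong simp: P_E P_E')

lemma E_idem: "1 \<le> i \<Longrightarrow> i \<le> N \<Longrightarrow> 1 \<le> j \<Longrightarrow> j \<le> N \<Longrightarrow> E i j * E i j = E i j"
  using E_mult(2)[of i i j] mult_ext1[OF P_idem[of i]] by (simp add: E_def)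

lemma gg_F: "1 \<le> i \<Longrightarrow> i < N \<Longrightarrow> g i * g i = 1 + F i * g i"
  using gg[of i] by (simp add: F_def mult.assoc)

lemma g_F: "1 \<le> i \<Longrightarrow> i < N \<Longrightarrow> g i * F i = F i * g i"
  using gE_same[of i] by (simp add: F_def mult.assoc sc_left_comm[of "g i"])

lemma FF: "1 \<le> i \<Longrightarrow> i < N \<Longrightarrow> F i * F i = sc c * F i"
  using E_idem[of i "Suc i"] by (simp add: F_def mult.assoc sc_left_comm[of "E i (Suc i)"])

lemma FF': "1 \<le> i \<Longrightarrow> i < N \<Longrightarrow> F i * (F i * x) = sc c * (F i * x)"
  using FF[of i] by (simp flip: mult.assoc)

text \<open>Since \<open>F i * F i = sc c * F i\<close>, the product
  \<open>(g i * g i - 1) * (g i - sc c)\<close> collapses to \<open>F i\<close>. No division by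
  \<open>c\<close> occurs, so the case \<open>c = 0\<close> is included.\<close>

lemma F_Br:
  assumes "1 \<le> i" "i < n" "n \<le> N"
  shows "F i \<in> Br n"
proof -
  have i: "i < N" using assms by simp
  have "(g i * g i - 1) * (g i - sc c) = F i * (g i * g i) - F i * g i * sc c"
    using gg_F[OF assms(1) i] by (simp add: algebra_simps)
  also have "\<dots> = F i + (F i * F i) * g i - sc c * (F i * g i)"
    using gg_F[OF assms(1) i] by (simp add: distrib_left mult.assoc sc_comm[of "F i * g i"] sc_comm[of "g i"] sc_left_comm[of "F i"])
  also have "\<dots> = F i" using FF[OF assms(1) i] by (simp add: mult.assoc)
  finally have "F i = (g i * g i - 1) * (g i - sc c)" ..
  also have "\<dots> \<in> Br n" using assms by (intro Br_mult Br_diff Br_g Br_sc Br_1) auto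
  finally show ?thesis .
qed

lemma g_inv: "1 \<le> i \<Longrightarrow> i < N \<Longrightarrow> g i * (g i - F i) = 1"
  using gg_F[of i] g_F[of i] by (simp add: right_diff_distrib)

text \<open>The four words are the normal forms of the polynomials in \<open>g n\<close>: by
  \<open>gg_F\<close> and \<open>FF\<close> every power of \<open>g n\<close> is a combination of
  them.\<close>

inductive_set BS :: "nat \<Rightarrow> 'a set" for n where
  BS_w: "w \<in> {1, F n, g n, F n * g n} \<Longrightarrow> a \<in> Br n \<Longrightarrow> b \<in> Br n \<Longrightarrow> a * w * b \<in> BS n"
| BS_add: "x \<in> BS n \<Longrightarrow> y \<in> BS n \<Longrightarrow> x + y \<in> BS n"

lemma BS_lmult: "x \<in> BS n \<Longrightarrow> a \<in> Br n \<Longrightarrow> a * x \<in> BS n"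
proof (induction rule: BS.induct)
  case (BS_w w u v)
  thus ?case using BS.BS_w[of w n "a * u" v] by (simp add: mult.assoc Br_mult)
qed (auto simp: distrib_left intro: BS_add)

lemma BS_rmult: "x \<in> BS n \<Longrightarrow> a \<in> Br n \<Longrightarrow> x * a \<in> BS n"
proof (induction rule: BS.induct)
  case (BS_w w u v)
  thus ?case using BS.BS_w[of w n u "v * a"] by (simp add: mult.assoc Br_mult)
qed (auto simp: distrib_right intro: BS_add)

lemma Br_BS: "a \<in> Br n \<Longrightarrow> a \<in> BS n"
  using BS_w[of 1 n a 1] by simp

lemma BS_wg:
  assumes "w \<in> {1, F n, g n, F n * g n}" "1 \<le> n" "n < N"
  shows "w * g n \<in> BS n"
proof -
  have 1: "g n * g n = 1 + F n * g n" using gg_F assms by simp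
  have 2: "F n * g n * g n = F n + sc c * (F n * g n)"
    using 1 FF'[of n] assms by (simp add: mult.assoc distrib_left)
  have "1 * g n * 1 \<in> BS n" "1 * 1 * 1 + 1 * (F n * g n) * 1 \<in> BS n" "1 * (F n * g n) * 1 \<in> BS n"
    "1 * F n * 1 + sc c * (F n * g n) * 1 \<in> BS n"
    by (intro BS_add BS_w Br_1 Br_sc; simp)+
  thus ?thesis using assms(1) by (elim insertE emptyE) (simp_all add: 1 2)
qed

text \<open>The idempotents \<open>e\<close>, \<open>en\<close> and \<open>X\<close> tie the strands
  k, n = k + 1 and m = n + 1 pairwise. Conjugation by \<open>h\<close> or \<open>G\<close> permutes
  them, and any two of them have the same product; this reduces all sixteen words. An idempotent
  always keeps a factor \<open>cc\<close>, because it is the scaled one that lies in the braid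
  subalgebra.\<close>

lemma BS_wwg:
  assumes "w \<in> {1, F n, g n, F n * g n}" "w' \<in> {1, F k, g k, F k * g k}" "1 \<le> k" "n = Suc k" "n < N"
  shows "w * w' * g n \<in> BS n"
proof -
  define m where "m = Suc n"
  define e en X where "e = E k n" and "en = E n m" and "X = E k m"
  define cc where "cc = sc c"
  define G h hi where "G = g n" and "h = g k" and "hi = h - F k"
  have n: "k < N" "1 \<le> n" "n \<le> N" "m \<le> N" using assms by (auto simp: m_def)
  have Fd: "F n = cc * en" "F k = cc * e" by (simp_all add: F_def cc_def e_def en_def m_def assms)
  note cl = sc_left_comm[of G c, folded cc_def] sc_left_comm[of h c, folded cc_def]
    sc_left_comm[of e c, folded cc_def] sc_left_comm[of en c, folded cc_def] 
    sc_left_comm[of X c, folded cc_def]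
  have GG: "G * G = 1 + cc * (en * G)" using gg_F[of n] n assms(5) by (simp add: G_def Fd mult.assoc)
  have Ge: "e * G = G * X" "X * G = G * e"
    using gE(4)[of n k] gE(3)[of n k] n assms by (simp_all add: G_def e_def X_def m_def)
  have Gen: "en * G = G * en" using gE_same[of n] n assms by (simp add: G_def en_def m_def)
  have hX: "h * X = en * h" "h * en = X * h"
    using gE(1)[of k m] gE(2)[of k m] n assms by (simp_all add: h_def en_def X_def m_def)
  have he: "h * e = e * h" using gE_same[of k] n assms by (simp add: h_def e_def)
  have comm: "en * e = e * en" "X * en = e * en" "en * X = e * en" "e * X = e * en" "X * e = e * en" "e * e = e" "en * en = en" "X * X = X"
    unfolding e_def en_def X_def
    using EE_comm[of k n n m] E_mult[of k n m] EE_comm[of k m n m] EE_comm[of k n k m]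
      E_mult[of m n k] E_mult(2)[of n k m] E_mult[of n k m] E_comm[of k n] E_comm[of k m] E_comm[of n m] E_idem n assms by (auto simp: m_def)
  have hhi: "h * hi = 1" using g_inv[of k] n assms by (simp add: h_def hi_def)
  have hB: "h \<in> Br n" "cc * e \<in> Br n" "hi \<in> Br n"
    using assms n F_Br[of k n] by (auto simp: h_def hi_def Fd[symmetric] intro!: Br_diff Br_g)
  have in_BS: "a * w * b \<in> BS n" if "w \<in> {1, cc * en, G, cc * en * G}" "a \<in> Br n" "b \<in> Br n" for a b w
    using BS_w[of w n a b] that by (simp add: Fd G_def)
  note hX' = hX(1)[symmetric] hX(2)[symmetric] he[symmetric]
  note rel = GG Ge Gen hX' comm
  note ext = mult_ext1[OF GG] mult_ext[OF Ge(1)] mult_ext[OF Ge(2)] mult_ext[OF Gen]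
    mult_ext[OF hX'(1)] mult_ext[OF hX'(2)] mult_ext[OF hX'(3)] mult_ext[OF comm(1)] mult_ext[OF comm(2)] mult_ext[OF comm(3)] mult_ext[OF comm(4)] mult_ext[OF comm(5)]
    mult_ext1[OF comm(6)] mult_ext1[OF comm(7)] mult_ext1[OF comm(8)]
  note S = mult.assoc cl distrib_left distrib_right
  have br: "G * (h * G) = h * (G * h)" 
    using braid[of k] n assms by (simp add: G_def h_def mult.assoc)
  have br': "G * (h * (G * x)) = h * (G * (h * x))" for x
    using br by (metis mult.assoc)
  \<comment> \<open>\<open>X\<close> ties the outer strands k and m, so \<open>cc * X\<close> is
    neither of level \<open>n\<close> nor one of the four words. Conjugating by \<open>h\<close>,
    whose inverse is \<open>hi\<close>, turns it into the admissible \<open>cc * en\<close>.\<close>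
  have X: "cc * X = h * (cc * en) * hi"
  proof -
    have "h * (cc * en) * hi = cc * (X * (h * hi))" by (simp add: S hX mult_ext[OF hX(2)])
    thus ?thesis by (simp add: hhi)
  qed
  consider "w' = 1" | "w' = cc * e" | "w' = h" | "w' = cc * e * h"
    using assms(2) by (auto simp: Fd h_def)
  moreover have W: "w \<in> {1, cc * en, G, cc * en * G}"
    using assms(1) by (simp add: Fd G_def)
  ultimately show ?thesis
  proof cases
    case 1
    thus ?thesis using BS_wg[of w n] assms n by simp
  next
    case 2
    have a: "1 * w' * G = w' * G * 1" by simp
    have b: "(cc * en) * w' * G = 1 * (cc * en * G) * w'"
      unfolding 2 by (simp add: S rel(2-) ext(2-))
    have c: "G * w' * G = h * (cc * en) * hi + w' * (cc * en * G) * 1"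
      unfolding 2 X[symmetric] by (simp add: S rel ext)
    have d: "(cc * en * G) * w' * G = w' * (cc * en) * 1 + (cc * w') * (cc * en * G) * 1"
      unfolding 2 by (simp add: S rel ext)
    have w': "w' \<in> Br n" "cc * w' \<in> Br n" using hB Br_sc[of c n] 2 by (auto simp: cc_def intro: Br_mult)
    have "1 * w' * G \<in> BS n" "(cc * en) * w' * G \<in> BS n" "G * w' * G \<in> BS n" "(cc * en * G) * w' * G \<in> BS n"
      unfolding a b c d using hB w'
      by (auto intro!: BS_add in_BS intro: Br_mult simp del: mult_1 mult_1_right)
    thus ?thesis using W unfolding G_def[symmetric] by (elim insertE emptyE) (simp_all only:)
  next
    case 3
    have a: "1 * w' * G = h * G * 1" by (simp add: 3)
    have b: "(cc * en) * w' * G = h * G * (cc * e)"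
      unfolding 3 by (simp add: S rel(2-) ext(2-))
    have c: "G * w' * G = h * G * h"
      unfolding 3 by (simp add: S br)
    have d: "(cc * en * G) * w' * G = h * G * (cc * e * h)"
      unfolding 3 by (simp add: S br br' rel(2-) ext(2-))
    have "1 * w' * G \<in> BS n" "(cc * en) * w' * G \<in> BS n" "G * w' * G \<in> BS n" "(cc * en * G) * w' * G \<in> BS n"
      unfolding a b c d using hB
      by (auto intro!: BS_add in_BS intro: Br_mult simp del: mult_1 mult_1_right)
    thus ?thesis using W unfolding G_def[symmetric] by (elim insertE emptyE) (simp_all only:)
  next
    case 4
    have a: "1 * w' * G = (cc * e * h) * G * 1" by (simp add: 4)
    have b: "(cc * en) * w' * G = (h * (cc * e)) * (cc * en * G) * 1"
      unfolding 4 by (simp add: S rel(2-) ext(2-))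
    have c: "G * w' * G = h * (cc * en * G) * h"
      unfolding 4 by (simp add: S br br' rel(2-) ext(2-))
    have d: "(cc * en * G) * w' * G = (h * (cc * e)) * (cc * en * G) * h"
      unfolding 4 by (simp add: S br br' rel(2-) ext(2-))
    have "1 * w' * G \<in> BS n" "(cc * en) * w' * G \<in> BS n" "G * w' * G \<in> BS n" "(cc * en * G) * w' * G \<in> BS n"
      unfolding a b c d using hB
      by (auto intro!: BS_add in_BS intro: Br_mult simp del: mult_1 mult_1_right)
    thus ?thesis using W unfolding G_def[symmetric] by (elim insertE emptyE) (simp_all only:)
  qed
qed

text \<open>The scheme of \<open>A_Sp\<close>: the essential point is right multiplication by
  \<open>g n\<close>. The induction hypothesis splits the right factor \<open>b\<close> into words
  of level \<open>n - 1\<close>; their outer factors commute with \<open>w\<close> and with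
  \<open>g n\<close>, and \<open>BS_wwg\<close> treats what remains.\<close>

theorem Br_Suc_BS:
  assumes "n < N" "1 \<le> n"
  shows "x \<in> Br (Suc n) \<Longrightarrow> x \<in> BS n"
  using assms
proof (induction n arbitrary: x rule: less_induct)
  case (less n)
  have comm: "u * w = w * u" if "u \<in> A k" "k < n" "w \<in> {1, F n, g n, F n * g n}" for u k w
  proof -
    have "u * F n = F n * u" using E_A_comm[OF that(1), of n "Suc n"] less.prems that
      by (simp add: F_def mult.assoc sc_left_comm[of u])
    moreover have "u * g n = g n * u" using A_g_comm[OF that(1)] less.prems that by simp
    ultimately show ?thesis using that(3) by (auto simp: mult.assoc) (metis mult.assoc)
  qed
  have rg: "y * g n \<in> BS n" if "y \<in> BS n" for y
    using that
  proof (induction rule: BS.induct)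
    case (BS_w w a b)
    note w = BS_w(1)
    show ?case
    proof (cases "n = 1")
      case True
      \<comment> \<open>For \<open>n = 1\<close> there is no lower word to split off; level 1
        contains no braid generator, so \<open>b\<close> is central.\<close>
      have "x \<in> A 0" if "x \<in> Br 1" for x
        using that by (induction rule: Br.induct) (auto intro: A.intros)
      hence "b * g n = g n * b" using A0_central BS_w True by auto
      hence "a * w * b * g n = a * (w * g n) * b" by (simp add: mult.assoc)
      also have "\<dots> \<in> BS n" using BS_w less.prems by (intro BS_lmult BS_rmult BS_wg) auto
      finally show ?thesis .
    next
      case False
      then obtain k where k: "n = Suc k" "1 \<le> k" using less.prems by (cases n) auto
      have "b \<in> BS k" using less.IH[of k b] BS_w k less.prems by auto
      hence "w * b * g n \<in> BS n"
      proof (induction rule: BS.induct)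
        case (BS_w w' u v)
        have uv: "u \<in> Br n" "v \<in> Br n" using BS_w k Br_mono by auto
        have "w * u = u * w" "v * g n = g n * v"
          using comm[of u k w] comm[of v k "g n"] BS_w Br_A k w by auto
        hence "w * (u * w' * v) * g n = u * (w * w' * g n) * v"
          by (metis mult.assoc)
        also have "\<dots> \<in> BS n" using BS_w less.prems k uv w by (intro BS_lmult BS_rmult BS_wwg[of w n w' k]) auto
        finally show ?case .
      qed (auto simp: distrib_left distrib_right intro: BS_add)
      from BS_lmult[OF this BS_w(2)] show ?thesis by (simp add: mult.assoc)
    qed
  qed (auto simp: distrib_right intro: BS_add)
  have rm: "y * x \<in> BS n" if "y \<in> BS n" for y
    using less.prems(1) that
  proof (induction arbitrary: y rule: Br.induct)
    case (Br_sc a)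
    thus ?case by (intro BS_rmult Br.Br_sc)
  next
    case (Br_g i)
    show ?case
    proof (cases "i = n")
      case True thus ?thesis using rg Br_g by simp
    next
      case False thus ?thesis using Br_g by (intro BS_rmult Br.Br_g) auto
    qed
  next
    case (Br_add a b)
    thus ?case by (simp add: distrib_left BS_add)
  next
    case (Br_mult a b)
    from Br_mult.IH(2)[OF Br_mult.IH(1)[OF Br_mult.prems]] show ?case by (simp add: mult.assoc)
  qed
  show ?case using rm[OF Br_BS[OF Br_1]] by simp
qed

end


section \<open>The regular representation\<close>

declare plus_fun_apply [simp del] zero_fun_apply [simp del]

lemmas pw = plus_fun_apply zero_fun_apply

type_synonym vec = "(nat \<times> nat) list \<Rightarrow> complex"

definition scal :: "complex \<Rightarrow> vec \<Rightarrow> vec" where "scal a v = (\<lambda>l. a * v l)"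

lemma scal_apply: "scal a v l = a * v l"
  by (simp add: scal_def)

text \<open>One space \<open>vec\<close> serves all levels, so that the operators of every level
  live in a single ring type and can be compared across levels.\<close>

typedef endo = "{f :: vec \<Rightarrow> vec. (\<forall>u v. f (u + v) = f u + f v) \<and> (\<forall>a u. f (scal a u) = scal a (f u))}"
  morphisms app Abs_endo
  by (rule exI[of _ "\<lambda>v. v"]) auto

lemma app_add: "app f (u + v) = app f u + app f v" and app_scal: "app f (scal a u) = scal a (app f u)"
  using app[of f] by auto

lemma scal_simps: "scal a (u + v) = scal a u + scal a v" "scal (a + b) u = scal a u + scal b u"
  "scal a (scal b u) = scal (a * b) u" "scal 1 u = u" "scal a 0 = 0" "scal 0 u = 0" "scal a (- u) = - scal a u"
  by (auto simp: scal_def fun_eq_iff algebra_simps pw)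

lemma app_0: "app f 0 = 0"
  using app_add[of f 0 0] by simp

lemma app_sum: "app f (sum h I) = (\<Sum>i\<in>I. app f (h i))"
  by (induction I rule: infinite_finite_induct) (auto simp: app_0 app_add)

setup_lifting type_definition_endo

instantiation endo :: "{ring, monoid_mult}"
begin
lift_definition zero_endo :: endo is "\<lambda>v. 0" by (auto simp: scal_simps)
lift_definition one_endo :: endo is "\<lambda>v. v" by auto
lift_definition plus_endo :: "endo \<Rightarrow> endo \<Rightarrow> endo" is "\<lambda>f h v. f v + h v"
  by (auto simp: scal_simps algebra_simps)
lift_definition uminus_endo :: "endo \<Rightarrow> endo" is "\<lambda>f v. - f v"
  by (auto simp: scal_simps algebra_simps)
lift_definition minus_endo :: "endo \<Rightarrow> endo \<Rightarrow> endo" is "\<lambda>f h v. f v + - h v"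
  by (auto simp: scal_simps algebra_simps simp del: add_uminus_conv_diff)
lift_definition times_endo :: "endo \<Rightarrow> endo \<Rightarrow> endo" is "\<lambda>f h v. f (h v)"
  by auto
instance
  by standard (transfer; simp add: fun_eq_iff algebra_simps)+
end

lift_definition endo_sc :: "complex \<Rightarrow> endo" is "\<lambda>a v. scal a v"
  by (auto simp: scal_simps) (simp add: mult.commute)

lemma app_simps: "app (x + y) v = app x v + app y v" "app (x * y) v = app x (app y v)" "app 1 v = v"
  "app 0 v = 0" "app (endo_sc a) v = scal a v"
  by (transfer; simp)+

lemma app_sum_left: "app (sum f I) v = (\<Sum>i\<in>I. app (f i) v)"
  by (induction I rule: infinite_finite_induct) (auto simp: app_simps)

lemma endo_eqI: "(\<And>v. app x v = app y v) \<Longrightarrow> x = y"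
  by (metis app_inject ext)

lemma app_cong: "x = y \<Longrightarrow> app x v = app y v" by simp

lemma central_endo_sc: "central_scalars endo_sc"
  by standard (auto intro!: endo_eqI simp: app_simps scal_simps app_scal mult.commute)

text \<open>Elements of level \<open>n + 1\<close> are sums of basis elements times elements of
  level \<open>n\<close> on the right. This is the right coordinate at the basis element with index
  \<open>(i, \<chi>)\<close>, again a vector, one level lower.\<close>

definition cmp :: "nat \<Rightarrow> nat \<Rightarrow> vec \<Rightarrow> vec" where "cmp i \<chi> v = (\<lambda>l. v ((i, \<chi>) # l))"

lemma cmp_simps: "cmp i \<chi> (u + v) = cmp i \<chi> u + cmp i \<chi> v" "cmp i \<chi> (scal a u) = scal a (cmp i \<chi> u)"
  "cmp i \<chi> 0 = 0"
  by (auto simp: cmp_def scal_def fun_eq_iff pw)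

lemma cmp_sum: "cmp i \<chi> (sum f I) = (\<Sum>x\<in>I. cmp i \<chi> (f x))"
  by (induction I rule: infinite_finite_induct) (auto simp: cmp_simps)

text \<open>Level \<open>n\<close> is a copy of the regular representation: lists \<open>[(i\<^sub>n, \<chi>\<^sub>n), \<dots>, (i\<^sub>1, \<chi>\<^sub>1)]\<close> with
  \<open>1 \<le> i\<^sub>k \<le> k\<close> and \<open>\<chi>\<^sub>k < d\<close> stand for the basis elements \<open>b\<^sub>n \<cdots> b\<^sub>1\<close>, where
  \<open>b\<^sub>k = P i\<^sub>k \<chi>\<^sub>k * g i\<^sub>k * \<dots> * g (k - 1)\<close>. On all other lists the algebra acts by the
  one-dimensional representation \<open>g\<^sub>i = q\<close>, \<open>t\<^sub>i = 1\<close>.\<close>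

definition junk :: "nat \<Rightarrow> nat \<Rightarrow> (nat \<times> nat) list \<Rightarrow> bool" where
  "junk d n l \<longleftrightarrow> (case l of [] \<Rightarrow> True | x # _ \<Rightarrow> \<not> (1 \<le> fst x \<and> fst x \<le> n \<and> snd x < d))"

lemma vec_eqI:
  assumes "\<And>l. junk d n l \<Longrightarrow> u l = v l"
    and "\<And>i \<chi>. 1 \<le> i \<Longrightarrow> i \<le> n \<Longrightarrow> \<chi> < d \<Longrightarrow> cmp i \<chi> u = cmp i \<chi> v"
  shows "u = v"
proof
  fix l
  show "u l = v l"
  proof (cases "junk d n l")
    case False
    then obtain i \<chi> l' where "l = (i, \<chi>) # l'" "1 \<le> i" "i \<le> n" "\<chi> < d"
      by (cases l) (auto simp: junk_def)
    thus ?thesis using assms(2)[of i \<chi>] by (simp add: cmp_def fun_eq_iff)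
  qed (rule assms)
qed

text \<open>The recursions of \<open>opP\<close> and \<open>opG\<close> are the rules
  \<open>P_B\<close> and \<open>g_B\<close> for moving a generator through the leading basis
  element, turned into definitions; the index drops from \<open>j\<close> to \<open>j - 1\<close> if
  the strand \<open>i\<close> of the basis element lies below \<open>j\<close>. For
  \<open>opG\<close> the rules appear transposed, because they compute coordinates: the new one at
  \<open>Suc j\<close> is the old one at \<open>j\<close>.\<close>

primrec opP :: "nat \<Rightarrow> nat \<Rightarrow> nat \<Rightarrow> nat \<Rightarrow> endo" where
  "opP d 0 j \<psi> = (if \<psi> = 0 then 1 else 0)"
| "opP d (Suc n) j \<psi> = Abs_endo (\<lambda>v l. if junk d (Suc n) l then (if \<psi> = 0 then v l else 0) else
     (let i = fst (hd l); \<chi> = snd (hd l) in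
       if i = j then (if \<chi> = \<psi> then v l else 0)
       else app (opP d n (if i < j then j - 1 else j) \<psi>) (cmp i \<chi> v) (tl l)))"

primrec opG :: "nat \<Rightarrow> complex \<Rightarrow> nat \<Rightarrow> nat \<Rightarrow> endo" where
  "opG d q 0 j = 1"
| "opG d q (Suc n) j = Abs_endo (\<lambda>v l. if junk d (Suc n) l then q * v l else
     (let i = fst (hd l); \<chi> = snd (hd l) in
       if i > Suc j then app (opG d q n j) (cmp i \<chi> v) (tl l)
       else if i = Suc j then cmp j \<chi> v (tl l)
       else if i = j then (cmp (Suc j) \<chi> v + scal (q - inverse q) (app (opP d n j \<chi>) (cmp j \<chi> v))) (tl l)
       else app (opG d q n (j - 1)) (cmp i \<chi> v) (tl l)))"

lemma app_opP:
  "app (opP d (Suc n) j \<psi>) = (\<lambda>v l. if junk d (Suc n) l then (if \<psi> = 0 then v l else 0) else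
     (let i = fst (hd l); \<chi> = snd (hd l) in
       if i = j then (if \<chi> = \<psi> then v l else 0)
       else app (opP d n (if i < j then j - 1 else j) \<psi>) (cmp i \<chi> v) (tl l)))"
  unfolding opP.simps
  by (rule Abs_endo_inverse) (auto simp: fun_eq_iff Let_def cmp_simps app_add app_scal scal_apply pw)

lemma app_opG:
  "app (opG d q (Suc n) j) = (\<lambda>v l. if junk d (Suc n) l then q * v l else
     (let i = fst (hd l); \<chi> = snd (hd l) in
       if i > Suc j then app (opG d q n j) (cmp i \<chi> v) (tl l)
       else if i = Suc j then cmp j \<chi> v (tl l)
       else if i = j then (cmp (Suc j) \<chi> v + scal (q - inverse q) (app (opP d n j \<chi>) (cmp j \<chi> v))) (tl l)
       else app (opG d q n (j - 1)) (cmp i \<chi> v) (tl l)))"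
  unfolding opG.simps
  by (rule Abs_endo_inverse)
    (auto simp: fun_eq_iff Let_def cmp_simps app_add app_scal scal_apply pw distrib_left mult.left_commute)

declare opP.simps [simp del] opG.simps [simp del]

lemma opP_junk: "junk d (Suc n) l \<Longrightarrow> app (opP d (Suc n) j \<psi>) v l = (if \<psi> = 0 then v l else 0)"
  unfolding app_opP by simp

lemma opG_junk: "junk d (Suc n) l \<Longrightarrow> app (opG d q (Suc n) j) v l = q * v l"
  unfolding app_opG by simp

lemma cmp_opP:
  assumes "\<chi> < d"
  shows "1 \<le> i \<Longrightarrow> i \<le> Suc n \<Longrightarrow> cmp i \<chi> (app (opP d (Suc n) i \<psi>) v) = (if \<chi> = \<psi> then cmp i \<chi> v else 0)"
    "1 \<le> i \<Longrightarrow> i < j \<Longrightarrow> i \<le> Suc n \<Longrightarrow> cmp i \<chi> (app (opP d (Suc n) j \<psi>) v) = app (opP d n (j - 1) \<psi>) (cmp i \<chi> v)"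
    "j < i \<Longrightarrow> i \<le> Suc n \<Longrightarrow> cmp i \<chi> (app (opP d (Suc n) j \<psi>) v) = app (opP d n j \<psi>) (cmp i \<chi> v)"
  using assms by (auto simp: app_opP cmp_def junk_def fun_eq_iff pw)

lemma cmp_opG:
  assumes "\<chi> < d"
  shows "Suc j < i \<Longrightarrow> i \<le> Suc n \<Longrightarrow> cmp i \<chi> (app (opG d q (Suc n) j) v) = app (opG d q n j) (cmp i \<chi> v)"
    "j \<le> n \<Longrightarrow> cmp (Suc j) \<chi> (app (opG d q (Suc n) j) v) = cmp j \<chi> v"
    "1 \<le> i \<Longrightarrow> i \<le> n \<Longrightarrow> cmp i \<chi> (app (opG d q (Suc n) i) v) =
       cmp (Suc i) \<chi> v + scal (q - inverse q) (app (opP d n i \<chi>) (cmp i \<chi> v))"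
    "1 \<le> i \<Longrightarrow> i < j \<Longrightarrow> i \<le> Suc n \<Longrightarrow> cmp i \<chi> (app (opG d q (Suc n) j) v) = app (opG d q n (j - 1)) (cmp i \<chi> v)"
  using assms by (auto simp: app_opG cmp_def junk_def fun_eq_iff pw)

abbreviation regular_rep :: "nat \<Rightarrow> complex \<Rightarrow> nat \<Rightarrow> bool" where
  "regular_rep d q n \<equiv> coloured_hecke endo_sc (opG d q n) (opP d n) n d (q - inverse q)"

lemma app_eqD: "x * y = z * w \<Longrightarrow> app x (app y v) = app z (app w v)"
  by (simp flip: app_simps(2))

lemma app_eqD1: "x * y = z \<Longrightarrow> app x (app y v) = app z v"
  by (simp flip: app_simps(2))

lemma scal_sum: "(\<Sum>i\<in>I. scal a (f i)) = scal a (sum f I)"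
  by (induction I rule: infinite_finite_induct) (auto simp: scal_simps)

lemmas lin = app_simps app_add app_scal app_0 scal_simps cmp_simps app_sum app_sum_left cmp_sum

lemma level_eqI:
  assumes "\<And>v l. junk d (Suc n) l \<Longrightarrow> app x v l = app y v l"
    and "\<And>v i \<chi>. 1 \<le> i \<Longrightarrow> i \<le> Suc n \<Longrightarrow> \<chi> < d \<Longrightarrow> cmp i \<chi> (app x v) = cmp i \<chi> (app y v)"
  shows "x = y"
  by (rule endo_eqI, rule vec_eqI[of d "Suc n"]) (use assms in auto)

lemma sum_apply: "(sum f I) l = (\<Sum>i\<in>I. f i l)"
  by (induction I rule: infinite_finite_induct) (auto simp: pw)

section \<open>The relations at level \<open>n + 1\<close>, deduced from those at level
  \<open>n\<close>\<close>

context
  fixes d n :: nat and q :: complex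
  assumes d: "d \<ge> 1" and q: "q \<noteq> 0" and IH: "regular_rep d q n"
begin

interpretation L: coloured_hecke endo_sc "opG d q n" "opP d n" n d "q - inverse q"
  by (rule IH)

private abbreviation "G \<equiv> opG d q (Suc n)"
private abbreviation "p \<equiv> opP d (Suc n)"

lemma step_P_comm:
  assumes "1 \<le> i" "i \<le> Suc n" "1 \<le> j" "j \<le> Suc n" "\<chi> < d" "\<psi> < d"
  shows "p i \<chi> * p j \<psi> = p j \<psi> * p i \<chi>"
proof (rule level_eqI[of d n])
  fix v k \<phi> assume k: "1 \<le> k" "k \<le> Suc n" "\<phi> < d"
  note c = cmp_opP
  have "app (opP d n i' \<chi>) (app (opP d n j' \<psi>) w) = app (opP d n j' \<psi>) (app (opP d n i' \<chi>) w)"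
    if "1 \<le> i'" "i' \<le> n" "1 \<le> j'" "j' \<le> n" for i' j' w
    using that assms by (intro app_eqD L.PP_comm)
  thus "cmp k \<phi> (app (p i \<chi> * p j \<psi>) v) = cmp k \<phi> (app (p j \<psi> * p i \<chi>) v)"
    using assms k by (cases k i rule: linorder_cases; cases k j rule: linorder_cases) (simp_all add: lin c)
qed (simp add: lin opP_junk)

lemma step_P_orth:
  assumes "1 \<le> j" "j \<le> Suc n" "\<chi> < d" "\<psi> < d"
  shows "p j \<chi> * p j \<psi> = (if \<chi> = \<psi> then p j \<chi> else 0)"
proof (rule level_eqI[of d n])
  fix v k \<phi> assume k: "1 \<le> k" "k \<le> Suc n" "\<phi> < d"
  note c = cmp_opP
  have "app (opP d n j' \<chi>) (app (opP d n j' \<psi>) w) = app (if \<chi> = \<psi> then opP d n j' \<chi> else 0) w"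
    if "1 \<le> j'" "j' \<le> n" for j' w
    using that assms by (intro app_eqD1 L.PP_orth)
  thus "cmp k \<phi> (app (p j \<chi> * p j \<psi>) v) = cmp k \<phi> (app (if \<chi> = \<psi> then p j \<chi> else 0) v)"
    using assms k by (cases k j rule: linorder_cases) (simp_all add: lin c)
qed (simp add: lin opP_junk pw)

lemma step_P_sum:
  assumes "1 \<le> j" "j \<le> Suc n"
  shows "(\<Sum>\<chi><d. p j \<chi>) = 1"
proof (rule level_eqI[of d n])
  fix v k \<phi> assume k: "1 \<le> k" "k \<le> Suc n" "\<phi> < d"
  note c = cmp_opP
  have "(\<Sum>\<chi><d. app (opP d n j' \<chi>) w) = w" if "1 \<le> j'" "j' \<le> n" for j' w
    using app_cong[OF L.P_sum[of j'], of w] that by (simp add: lin)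
  thus "cmp k \<phi> (app (\<Sum>\<chi><d. p j \<chi>) v) = cmp k \<phi> (app 1 v)"
    using assms k by (cases k j rule: linorder_cases) (simp_all add: lin c)
qed (use d in \<open>simp add: lin opP_junk sum_apply\<close>)

lemma step_gP:
  assumes "1 \<le> i" "i < Suc n" "\<chi> < d"
  shows "G i * p i \<chi> = p (i + 1) \<chi> * G i"
proof (rule level_eqI[of d n])
  fix v k \<phi> assume k: "1 \<le> k" "k \<le> Suc n" "\<phi> < d"
  note c = cmp_opP cmp_opG
  have r: "app (opG d q n i) (app (opP d n i \<chi>) w) = app (opP d n (Suc i) \<chi>) (app (opG d q n i) w)" if "i < n" for w
    using that assms by (auto intro!: app_eqD L.gP[simplified] L.gP'[simplified])
  have r1: "app (opG d q n (i - Suc 0)) (app (opP d n (i - Suc 0) \<chi>) w) = app (opP d n i \<chi>) (app (opG d q n (i - Suc 0)) w)" if "1 < i" for w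
    using that assms L.gP[of "i - Suc 0" \<chi>] L.gP'[of "i - Suc 0" \<chi>] by (auto intro!: app_eqD)
  have r': "app (opP d n i \<chi>) (app (opP d n i \<phi>) w) = app (if \<chi> = \<phi> then opP d n i \<chi> else 0) w"
    "app (opP d n i \<phi>) (app (opP d n i \<chi>) w) = app (if \<chi> = \<phi> then opP d n i \<chi> else 0) w"
    if "i \<le> n" for w
    using that assms k app_eqD1[OF L.PP_orth[of i \<chi> \<phi>]] app_eqD1[OF L.PP_orth[of i \<phi> \<chi>]] by auto
  consider "k < i" | "k = i" | "k = Suc i" | "Suc i < k" by linarith
  thus "cmp k \<phi> (app (G i * p i \<chi>) v) = cmp k \<phi> (app (p (i + 1) \<chi> * G i) v)"
    using assms k by cases (auto simp add: lin c r r1 r')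
qed (simp_all add: lin opP_junk opG_junk)

lemma step_gP':
  assumes "1 \<le> i" "i < Suc n" "\<chi> < d"
  shows "G i * p (i + 1) \<chi> = p i \<chi> * G i"
proof (rule level_eqI[of d n])
  fix v k \<phi> assume k: "1 \<le> k" "k \<le> Suc n" "\<phi> < d"
  note c = cmp_opP cmp_opG
  have r: "app (opG d q n i) (app (opP d n (Suc i) \<chi>) w) = app (opP d n i \<chi>) (app (opG d q n i) w)" if "i < n" for w
    using that assms by (auto intro!: app_eqD L.gP[simplified] L.gP'[simplified])
  have r1: "app (opG d q n (i - Suc 0)) (app (opP d n i \<chi>) w) = app (opP d n (i - Suc 0) \<chi>) (app (opG d q n (i - Suc 0)) w)" if "1 < i" for w
    using that assms L.gP[of "i - Suc 0" \<chi>] L.gP'[of "i - Suc 0" \<chi>] by (auto intro!: app_eqD)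
  have r': "app (opP d n i \<chi>) (app (opP d n i \<phi>) w) = app (if \<chi> = \<phi> then opP d n i \<chi> else 0) w"
    "app (opP d n i \<phi>) (app (opP d n i \<chi>) w) = app (if \<chi> = \<phi> then opP d n i \<chi> else 0) w"
    if "i \<le> n" for w
    using that assms k app_eqD1[OF L.PP_orth[of i \<chi> \<phi>]] app_eqD1[OF L.PP_orth[of i \<phi> \<chi>]] by auto
  consider "k < i" | "k = i" | "k = Suc i" | "Suc i < k" by linarith
  thus "cmp k \<phi> (app (G i * p (i + 1) \<chi>) v) = cmp k \<phi> (app (p i \<chi> * G i) v)"
    using assms k by cases (auto simp add: lin c r r1 r')
qed (simp_all add: lin opP_junk opG_junk)

lemma step_gP_far:
  assumes "1 \<le> i" "i < Suc n" "1 \<le> j" "j \<le> Suc n" "j \<noteq> i" "j \<noteq> i + 1" "\<chi> < d"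
  shows "G i * p j \<chi> = p j \<chi> * G i"
proof (rule level_eqI[of d n])
  fix v k \<phi> assume k: "1 \<le> k" "k \<le> Suc n" "\<phi> < d"
  note c = cmp_opP cmp_opG
  have r: "app (opG d q n i') (app (opP d n j' \<chi>) w) = app (opP d n j' \<chi>) (app (opG d q n i') w)"
    if "1 \<le> i'" "i' < n" "1 \<le> j'" "j' \<le> n" "j' < i' \<or> i' + 1 < j'" for i' j' w
    using that assms by (intro app_eqD L.gP_far) auto
  have r': "app (opP d n i \<phi>) (app (opP d n j' \<chi>) w) = app (opP d n j' \<chi>) (app (opP d n i \<phi>) w)"
    if "1 \<le> j'" "j' \<le> n" for j' w
    using that assms k by (intro app_eqD L.PP_comm) auto
  have ij: "j < i \<or> i + 1 < j" using assms by linarith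
  have a: "0 < i" "i \<le> n" "0 < j" "j \<le> Suc n" "0 < k" "k \<le> Suc n" using assms k by auto
  consider "k < i" | "k = i" | "k = Suc i" | "Suc i < k" by linarith
  thus "cmp k \<phi> (app (G i * p j \<chi>) v) = cmp k \<phi> (app (p j \<chi> * G i) v)"
  proof cases
    case 1 thus ?thesis using ij k a by (cases k j rule: linorder_cases) (auto simp add: lin c r intro!: r)
  next
    case 2 thus ?thesis using ij k a by (cases k j rule: linorder_cases) (simp_all add: lin c r')
  next
    case 3 thus ?thesis using ij k a by (cases k j rule: linorder_cases) (auto simp add: lin c r intro!: r)
  next
    case 4 thus ?thesis using ij k a by (cases k j rule: linorder_cases) (auto simp add: lin c r intro!: r)
  qed
qed (simp_all add: lin opP_junk opG_junk)

lemma step_far: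
  assumes "1 \<le> i" "i + 1 < j" "j < Suc n"
  shows "G i * G j = G j * G i"
proof (rule level_eqI[of d n])
  fix v k \<phi> assume k: "1 \<le> k" "k \<le> Suc n" "\<phi> < d"
  note c = cmp_opG
  have r: "app (opG d q n i') (app (opG d q n j') w) = app (opG d q n j') (app (opG d q n i') w)"
    if "1 \<le> i'" "i' + 1 < j'" "j' < n" for i' j' w
    using that assms by (intro app_eqD L.far)
  have r': "app (opP d n i \<phi>) (app (opG d q n (j - 1)) w) = app (opG d q n (j - 1)) (app (opP d n i \<phi>) w)" for w
    using assms k by (intro app_eqD L.gP_far[symmetric]) auto
  have r'': "app (opP d n j \<phi>) (app (opG d q n i) w) = app (opG d q n i) (app (opP d n j \<phi>) w)" for w
    using assms k by (intro app_eqD L.gP_far[symmetric]) auto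
  have a: "0 < i" "i \<le> n" "0 < j" "j \<le> n" using assms by auto
  consider "k < i" | "k = i" | "k = Suc i" | "Suc i < k" "k < j" | "k = j" | "k = Suc j" | "Suc j < k" by linarith
  thus "cmp k \<phi> (app (G i * G j) v) = cmp k \<phi> (app (G j * G i) v)"
  proof cases
    case 1 thus ?thesis using assms(2) k a r[of "i-1" "j-1"] by (simp add: lin c)
  next
    case 2 thus ?thesis using assms(2) k a r' by (simp add: lin c)
  next
    case 3 thus ?thesis using assms(2) k a by (simp add: lin c)
  next
    case 4 thus ?thesis using assms(2) k a r[of i "j-1"] by (simp add: lin c)
  next
    case 5 thus ?thesis using assms(2) k a r'' by (simp add: lin c)
  next
    case 6 thus ?thesis using assms(2) k a by (simp add: lin c)
  next
    case 7 thus ?thesis using assms(2) k a r[of i j] by (simp add: lin c)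
  qed
qed (simp_all add: lin opG_junk)

lemma step_quad:
  assumes "1 \<le> i" "i < Suc n"
  shows "G i * G i = 1 + endo_sc (q - inverse q) * ((\<Sum>\<chi><d. p i \<chi> * p (i + 1) \<chi>) * G i)"
proof (rule level_eqI[of d n])
  fix v l assume "junk d (Suc n) l"
  \<comment> \<open>On junk lists \<open>g i\<close> acts as \<open>q\<close>, and only
    \<open>\<chi> = 0\<close> contributes to the sum of projections, which therefore acts as 1; the
    relation becomes this identity for the number \<open>q\<close>.\<close>
  moreover have "q * (q * x) = x + (q - inverse q) * (q * x)" for x
    using q by (simp add: field_simps)
  ultimately show "app (G i * G i) v l = app (1 + endo_sc (q - inverse q) * ((\<Sum>\<chi><d. p i \<chi> * p (i + 1) \<chi>) * G i)) v l"
    using d by (simp add: lin opG_junk opP_junk pw scal_apply sum_apply scal_sum if_distrib cong: if_cong)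
next
  fix v k \<phi> assume k: "1 \<le> k" "k \<le> Suc n" "\<phi> < d"
  note c = cmp_opP cmp_opG
  have r: "app (opG d q n j) (app (opG d q n j) w) = w + scal (q - inverse q)
      (\<Sum>\<chi><d. app (opP d n j \<chi>) (app (opP d n (Suc j) \<chi>) (app (opG d q n j) w)))"
    if "1 \<le> j" "j < n" for j w
    using app_cong[OF L.quad[of j], of w] that by (simp add: lin scal_sum)
  have s: "(\<Sum>\<chi><d. if \<phi> = \<chi> then f \<chi> else 0) = f \<phi>" for f :: "nat \<Rightarrow> vec"
    using k by (simp add: sum.delta')
  have s': "(\<Sum>\<chi><d. app (opP d n i \<chi>) (if \<phi> = \<chi> then f \<chi> else 0)) = app (opP d n i \<phi>) (f \<phi>)" for f :: "nat \<Rightarrow> vec"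
  proof -
    have "(\<Sum>\<chi><d. app (opP d n i \<chi>) (if \<phi> = \<chi> then f \<chi> else 0)) =
        (\<Sum>\<chi><d. if \<phi> = \<chi> then app (opP d n i \<chi>) (f \<chi>) else 0)"
      by (intro sum.cong) (auto simp: app_0)
    thus ?thesis by (simp add: s)
  qed
  have a: "0 < i" "i \<le> n" "0 < k" "k \<le> Suc n" using assms k by auto
  consider "k < i" | "k = i" | "k = Suc i" | "Suc i < k" by linarith
  thus "cmp k \<phi> (app (G i * G i) v) =
      cmp k \<phi> (app (1 + endo_sc (q - inverse q) * ((\<Sum>\<chi><d. p i \<chi> * p (i + 1) \<chi>) * G i)) v)"
  proof cases
    case 1 thus ?thesis using r[of "i - 1"] k a by (simp add: lin c scal_sum)
  next
    case 2 thus ?thesis using k a by (simp add: lin c scal_sum s)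
  next
    case 3 thus ?thesis using k a by (simp add: lin c scal_sum s')
  next
    case 4 thus ?thesis using r[of i] k a by (simp add: lin c scal_sum)
  qed
qed

lemma step_braid:
  assumes "1 \<le> i" "i + 1 < Suc n"
  shows "G i * G (i + 1) * G i = G (i + 1) * G i * G (i + 1)"
proof (rule level_eqI[of d n])
  fix v k \<phi> assume k: "1 \<le> k" "k \<le> Suc n" "\<phi> < d"
  note c = cmp_opG
  define cc where "cc = q - inverse q"
  have r: "app (opG d q n j) (app (opG d q n (Suc j)) (app (opG d q n j) w)) =
      app (opG d q n (Suc j)) (app (opG d q n j) (app (opG d q n (Suc j)) w))"
    if "1 \<le> j" "Suc j < n" for j w
    using app_cong[OF L.braid[of j], of w] that by (simp add: lin)
  have i: "1 \<le> i" "i < n" using assms by auto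
  \<comment> \<open>Used in the coordinate \<open>k = i\<close>, where the correction terms of the
    action meet: one side of the braid relation contains g_i P_i g_i, the other its expansion by the
    quadratic relation.\<close>
  have gPg: "app (opG d q n i) (app (opP d n i \<phi>) (app (opG d q n i) w)) =
      app (opP d n (Suc i) \<phi>) w + scal cc (app (opP d n i \<phi>) (app (opG d q n i) (app (opP d n i \<phi>) w)))" for w
  proof -
    have "opG d q n i * opP d n i \<phi> * opG d q n i = opP d n (i + 1) \<phi> * (opG d q n i * opG d q n i)"
      using L.gP[of i \<phi>] i k by (simp add: mult.assoc)
    also have "\<dots> = opP d n (i + 1) \<phi> + endo_sc cc * (opP d n i \<phi> * opG d q n i * opP d n i \<phi>)"
      using L.ggP(2)[of i \<phi>] i k L.gg[of i] by (simp add: distrib_left L.sc_left_comm[of "opP d n (Suc i) \<phi>"] cc_def)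
    finally have e: "opG d q n i * opP d n i \<phi> * opG d q n i =
        opP d n (i + 1) \<phi> + endo_sc cc * (opP d n i \<phi> * opG d q n i * opP d n i \<phi>)" .
    show ?thesis using app_cong[OF e, of w] by (simp add: lin)
  qed
  have gP: "app (opP d n (Suc i) \<phi>) (app (opG d q n i) w) = app (opG d q n i) (app (opP d n i \<phi>) w)"
    "app (opG d q n i) (app (opP d n (Suc i) \<phi>) w) = app (opP d n i \<phi>) (app (opG d q n i) w)" for w
    using app_eqD[OF L.gP[of i \<phi>]] app_eqD[OF L.gP'[of i \<phi>]] i k by auto
  have a: "0 < i" "i \<le> n" "0 < k" "k \<le> Suc n" "Suc i \<le> n" using assms k by auto
  consider "k < i" | "k = i" | "k = Suc i" | "k = Suc (Suc i)" | "Suc (Suc i) < k" by linarith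
  thus "cmp k \<phi> (app (G i * G (i + 1) * G i) v) = cmp k \<phi> (app (G (i + 1) * G i * G (i + 1)) v)"
  proof cases
    case 1 thus ?thesis using r[of "i - 1"] k a by (simp add: lin c)
  next
    case 2 thus ?thesis using k a gPg gP by (simp add: lin c cc_def[symmetric] add_ac)
  next
    case 3 thus ?thesis using k a gP by (simp add: lin c)
  next
    case 4 thus ?thesis using k a by (simp add: lin c)
  next
    case 5 thus ?thesis using r[of i] k a by (simp add: lin c)
  qed
qed (simp_all add: lin opG_junk)

lemma regular_rep_step: "regular_rep d q (Suc n)"
proof -
  interpret central_scalars endo_sc by (rule central_endo_sc)
  show ?thesis
    by unfold_locales (use d step_braid step_far step_P_comm step_P_orth step_P_sum step_gP step_gP' step_gP_far step_quad in auto)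
qed

end

lemma regular_rep: "d \<ge> 1 \<Longrightarrow> q \<noteq> 0 \<Longrightarrow> regular_rep d q n"
proof (induction n)
  case 0
  interpret central_scalars endo_sc by (rule central_endo_sc)
  show ?case by unfold_locales (use 0 in auto)
qed (rule regular_rep_step)

section \<open>Left multiplication on the elements
  \<open>P i \<chi> * g i * \<dots> * g (N - 1)\<close>\<close>

context coloured_hecke
begin

definition Q :: "nat \<Rightarrow> 'a" where "Q i = prod_list (map g [i..<N])"

lemma Q_N: "Q N = 1" by (simp add: Q_def)

lemma Q_rec: "i < N \<Longrightarrow> Q i = g i * Q (Suc i)"
  by (simp add: Q_def upt_conv_Cons)

lemma Q_comm:
  assumes "i \<le> N" "\<And>k. i \<le> k \<Longrightarrow> k < N \<Longrightarrow> x * g k = g k * x"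
  shows "x * Q i = Q i * x"
  using assms
proof (induction rule: inc_induct)
  case base thus ?case by (simp add: Q_N)
next
  case (step k)
  have xk: "x * g k = g k * x" using step by auto
  have "x * Q k = g k * (x * Q (Suc k))"
    using step mult_ext[OF xk] by (simp add: Q_rec)
  thus ?case using step by (simp add: Q_rec mult.assoc)
qed

lemma g_Q_far: "1 \<le> j \<Longrightarrow> j + 1 < i \<Longrightarrow> i \<le> N \<Longrightarrow> g j * Q i = Q i * g j"
  by (rule Q_comm) (auto intro: far)

lemma P_Q_far: "1 \<le> j \<Longrightarrow> j < i \<Longrightarrow> i \<le> N \<Longrightarrow> \<chi> < d \<Longrightarrow> P j \<chi> * Q i = Q i * P j \<chi>"
  by (rule Q_comm) (auto intro: gP_far[symmetric])

text \<open>\<open>g j\<close> commutes with the factors of \<open>Q i\<close> until it meets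
  \<open>g (j - 1) * g j\<close>; there the braid relation lets it reappear on the right as
  \<open>g (j - 1)\<close>, which commutes with the rest.\<close>

lemma g_Q:
  assumes "1 \<le> i" "i < j" "j < N"
  shows "g j * Q i = Q i * g (j - 1)"
proof -
  obtain m where m: "j = Suc m" using assms by (cases j) auto
  have "i \<le> m" using assms m by simp
  thus ?thesis using assms(1)
  proof (induction rule: inc_induct)
    case base
    have br: "g m * (g j * g m) = g j * (g m * g j)" using braid[of m] assms m by (simp add: mult.assoc)
    have "g j * Q m = (g m * (g j * g m)) * Q (Suc j)"
      unfolding br using assms m by (simp add: Q_rec mult.assoc)
    also have "\<dots> = g m * (g j * Q (Suc j)) * g m"
      using g_Q_far[of m "Suc j"] assms m by (simp add: mult.assoc)
    also have "\<dots> = Q m * g m" using assms m by (simp add: Q_rec mult.assoc)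
    finally show ?case using m by simp
  next
    case (step k)
    have "g j * Q k = g k * (g j * Q (Suc k))"
      using mult_ext[OF far[of k j, symmetric]] step assms m by (simp add: Q_rec[of k])
    thus ?case using step assms m by (simp add: Q_rec[of k] mult.assoc)
  qed
qed

lemma P_Q:
  assumes "1 \<le> i" "i < j" "j \<le> N" "\<chi> < d"
  shows "P j \<chi> * Q i = Q i * P (j - 1) \<chi>"
proof -
  obtain m where m: "j = Suc m" using assms by (cases j) auto
  have "i \<le> m" using assms m by simp
  thus ?thesis using assms(1)
  proof (induction rule: inc_induct)
    case base
    have "P j \<chi> * Q m = g m * (P m \<chi> * Q j)"
      using mult_ext[OF gP[of m \<chi>, symmetric]] assms m base by (simp add: Q_rec[of m])
    thus ?case using P_Q_far[of m j \<chi>] assms m base by (simp add: Q_rec[of m] mult.assoc)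
  next
    case (step k)
    have "P j \<chi> * Q k = g k * (P j \<chi> * Q (Suc k))"
      using mult_ext[OF gP_far[of k j \<chi>, symmetric]] step assms m by (simp add: Q_rec[of k])
    thus ?case using step assms m by (simp add: Q_rec[of k] mult.assoc)
  qed
qed

definition B :: "nat \<Rightarrow> nat \<Rightarrow> 'a" where "B i \<chi> = P i \<chi> * Q i"

lemma P_B:
  assumes "1 \<le> i" "i \<le> N" "1 \<le> j" "j \<le> N" "\<chi> < d" "\<psi> < d"
  shows "i = j \<Longrightarrow> P j \<psi> * B i \<chi> = (if \<chi> = \<psi> then B i \<chi> else 0)"
    "i < j \<Longrightarrow> P j \<psi> * B i \<chi> = B i \<chi> * P (j - 1) \<psi>"
    "j < i \<Longrightarrow> P j \<psi> * B i \<chi> = B i \<chi> * P j \<psi>"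
proof -
  note c = mult_ext[OF PP_comm[of j i \<psi> \<chi>]]
  show "i = j \<Longrightarrow> P j \<psi> * B i \<chi> = (if \<chi> = \<psi> then B i \<chi> else 0)"
    using PP_orth[of j \<psi> \<chi>] assms by (auto simp: B_def simp flip: mult.assoc)
  show "i < j \<Longrightarrow> P j \<psi> * B i \<chi> = B i \<chi> * P (j - 1) \<psi>"
    using c P_Q[of i j \<psi>] assms by (simp add: B_def mult.assoc)
  show "j < i \<Longrightarrow> P j \<psi> * B i \<chi> = B i \<chi> * P j \<psi>"
    using c P_Q_far[of j i \<psi>] assms by (simp add: B_def mult.assoc)
qed

text \<open>Only \<open>i = j\<close> creates a square \<open>g j * g j\<close>, and the quadratic
  relation then yields the correction term. These rules are what makes \<open>Phi\<close> commute
  with the action of level \<open>n\<close>, see \<open>Cor_G\<close>.\<close>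

lemma g_B:
  assumes "1 \<le> i" "i \<le> N" "1 \<le> j" "j < N" "\<chi> < d"
  shows "Suc j < i \<Longrightarrow> g j * B i \<chi> = B i \<chi> * g j"
    "i = Suc j \<Longrightarrow> g j * B i \<chi> = B j \<chi>"
    "i = j \<Longrightarrow> g j * B i \<chi> = B (Suc j) \<chi> + sc c * (B j \<chi> * P j \<chi>)"
    "i < j \<Longrightarrow> g j * B i \<chi> = B i \<chi> * g (j - 1)"
proof -
  show "Suc j < i \<Longrightarrow> g j * B i \<chi> = B i \<chi> * g j"
    using mult_ext[OF gP_far[of j i \<chi>]] g_Q_far[of j i] assms by (simp add: B_def mult.assoc)
  show "i = Suc j \<Longrightarrow> g j * B i \<chi> = B j \<chi>"
    using mult_ext[OF gP'[of j \<chi>]] assms by (simp add: B_def Q_rec[of j])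
  show "i < j \<Longrightarrow> g j * B i \<chi> = B i \<chi> * g (j - 1)"
    using mult_ext[OF gP_far[of j i \<chi>]] g_Q[of i j] assms by (simp add: B_def mult.assoc)
  have "g j * (P j \<chi> * g j) = P (Suc j) \<chi> * (g j * g j)"
    using mult_ext[OF gP[of j \<chi>]] assms by simp
  also have "\<dots> = P (Suc j) \<chi> + sc c * (P j \<chi> * g j * P j \<chi>)"
    using ggP(2)[of j \<chi>] assms gg[of j] by (simp add: distrib_left sc_left_comm[of "P (Suc j) \<chi>"])
  finally have e: "g j * (P j \<chi> * g j) = P (Suc j) \<chi> + sc c * (P j \<chi> * g j * P j \<chi>)" .
  have "g j * B j \<chi> = (g j * (P j \<chi> * g j)) * Q (Suc j)"
    using assms by (simp add: B_def Q_rec[of j] mult.assoc)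
  also have "\<dots> = B (Suc j) \<chi> + sc c * (B j \<chi> * P j \<chi>)"
    unfolding e using P_Q_far[of j "Suc j" \<chi>] assms by (simp add: B_def Q_rec[of j] distrib_right mult.assoc)
  finally show "i = j \<Longrightarrow> g j * B i \<chi> = B (Suc j) \<chi> + sc c * (B j \<chi> * P j \<chi>)" by simp
qed

end


section \<open>The Markov functional on the regular representation\<close>

definition opB :: "nat \<Rightarrow> complex \<Rightarrow> nat \<Rightarrow> nat \<Rightarrow> nat \<Rightarrow> endo" where
  "opB d q n i \<chi> = opP d n i \<chi> * prod_list (map (opG d q n) [i..<n])"

text \<open>\<open>Phi\<close> deletes the generator \<open>g\<^sub>n\<close> from the basis elements \<open>P i \<chi> * g i * \<dots> * g n\<close>
  of level \<open>n + 1\<close>, as in the Markov rule.\<close>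

definition Phi :: "nat \<Rightarrow> complex \<Rightarrow> nat \<Rightarrow> vec \<Rightarrow> vec" where
  "Phi d q n v = (\<Sum>\<chi><d. \<Sum>i\<in>{1..n}. app (opB d q n i \<chi>) (cmp i \<chi> v))"

text \<open>The Markov rules on coordinates: the basis element at \<open>i = Suc n\<close> is
  \<open>P (Suc n) \<chi>\<close> alone and receives the weight \<open>Y \<chi>\<close>; every other
  one ends in \<open>g n\<close>, which \<open>Phi\<close> deletes at the price of a factor
  \<open>z\<close>.\<close>

primrec ell :: "nat \<Rightarrow> complex \<Rightarrow> (nat \<Rightarrow> complex) \<Rightarrow> complex poly \<Rightarrow> nat \<Rightarrow> vec \<Rightarrow> complex poly" where
  "ell d q Y z 0 v = [:v []:]"
| "ell d q Y z (Suc n) v =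
     (\<Sum>\<chi><d. Polynomial.smult (Y \<chi>) (ell d q Y z n (cmp (Suc n) \<chi> v))) + z * ell d q Y z n (Phi d q n v)"

text \<open>The vector that represents \<open>1\<close>.\<close>

primrec vac :: "nat \<Rightarrow> nat \<Rightarrow> vec" where
  "vac d 0 = (\<lambda>l. if l = [] then 1 else 0)"
| "vac d (Suc n) = (\<lambda>l. case l of [] \<Rightarrow> 0 | x # l' \<Rightarrow> if fst x = Suc n \<and> snd x < d then vac d n l' else 0)"

declare vac.simps [simp del]

text \<open>Vectors in which \<open>g n\<close> does not occur; the vector of 1 is of this kind, and
  level \<open>n\<close> preserves the condition.\<close>

definition low :: "nat \<Rightarrow> nat \<Rightarrow> vec \<Rightarrow> bool" where
  "low d n v \<longleftrightarrow> (\<forall>i \<chi>. 1 \<le> i \<and> i \<le> n \<and> \<chi> < d \<longrightarrow> cmp i \<chi> v = 0)"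

lemma Phi_add: "Phi d q n (u + v) = Phi d q n u + Phi d q n v"
  by (simp add: Phi_def lin sum.distrib)

lemma Phi_scal: "Phi d q n (scal a v) = scal a (Phi d q n v)"
  by (simp add: Phi_def lin scal_sum)

lemma ell_add: "ell d q Y z n (u + v) = ell d q Y z n u + ell d q Y z n v"
  by (induction n arbitrary: u v) (simp_all add: pw cmp_simps Phi_add smult_add_right sum.distrib algebra_simps)

lemma ell_scal: "ell d q Y z n (scal a v) = Polynomial.smult a (ell d q Y z n v)"
proof (induction n arbitrary: v)
  case (Suc n)
  have "(\<Sum>\<chi><d. Polynomial.smult a (f \<chi>)) = Polynomial.smult a (\<Sum>\<chi><d. f \<chi>)" for f :: "nat \<Rightarrow> complex poly"
    by (induction d) (auto simp: smult_add_right)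
  from this[symmetric] show ?case
    by (simp add: Suc cmp_simps Phi_scal smult_add_right mult.commute[of a])
qed (simp add: scal_apply)

lemma ell_0: "ell d q Y z n 0 = 0"
  using ell_add[of d q Y z n 0 0] by simp

lemma cmp_vac: "\<chi> < d \<Longrightarrow> cmp (Suc n) \<chi> (vac d (Suc n)) = vac d n"
  by (auto simp: cmp_def fun_eq_iff vac.simps)

lemma low_vac: "low d n (vac d (Suc n))"
  by (auto simp: low_def cmp_def fun_eq_iff pw vac.simps)

lemma Phi_low: "low d n v \<Longrightarrow> Phi d q n v = 0"
  by (auto simp: low_def Phi_def app_0 intro!: sum.neutral)

text \<open>\<open>a\<close> and \<open>a'\<close> are to be the actions of one element of level
  \<open>n\<close> on the spaces of levels \<open>n + 1\<close> and \<open>n\<close>. The relation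
  records what the recursion of \<open>ell\<close> can see of this: the top coordinates and
  \<open>Phi\<close>.\<close>

definition Cor :: "nat \<Rightarrow> complex \<Rightarrow> nat \<Rightarrow> endo \<Rightarrow> endo \<Rightarrow> bool" where
  "Cor d q n a a' \<longleftrightarrow> (\<forall>v \<chi>. \<chi> < d \<longrightarrow> cmp (Suc n) \<chi> (app a v) = app a' (cmp (Suc n) \<chi> v)) \<and>
     (\<forall>v. Phi d q n (app a v) = app a' (Phi d q n v)) \<and> (\<forall>v. low d n v \<longrightarrow> low d n (app a v))"

lemma Cor_add: "Cor d q n a a' \<Longrightarrow> Cor d q n b b' \<Longrightarrow> Cor d q n (a + b) (a' + b')"
  by (simp add: Cor_def lin Phi_add low_def)

lemma Cor_mult: "Cor d q n a a' \<Longrightarrow> Cor d q n b b' \<Longrightarrow> Cor d q n (a * b) (a' * b')"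
  by (simp add: Cor_def lin)

lemma Cor_sc: "Cor d q n (endo_sc s) (endo_sc s)"
  by (simp add: Cor_def lin Phi_scal low_def)

text \<open>For \<open>Phi\<close>, the index shifts in the action at level \<open>n + 1\<close> are
  exactly those of \<open>P_B\<close> at level \<open>n\<close>: deleting the last factor
  \<open>g n\<close> of a basis element does not affect how a projection on a strand
  \<open>j \<le> n\<close> passes through it.\<close>

lemma Cor_P:
  assumes d: "d \<ge> 1" "q \<noteq> 0" and j: "1 \<le> j" "j \<le> n" "\<psi> < d"
  shows "Cor d q n (opP d (Suc n) j \<psi>) (opP d n j \<psi>)"
proof -
  interpret L: coloured_hecke endo_sc "opG d q n" "opP d n" n d "q - inverse q"
    by (rule regular_rep[OF d])
  have B: "opB d q n i \<chi> = L.B i \<chi>" for i \<chi> by (simp add: opB_def L.B_def L.Q_def)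
  have "app (opB d q n i \<chi>) (cmp i \<chi> (app (opP d (Suc n) j \<psi>) v)) =
      app (opP d n j \<psi>) (app (opB d q n i \<chi>) (cmp i \<chi> v))" if "1 \<le> i" "i \<le> n" "\<chi> < d" for i \<chi> v
  proof (cases i j rule: linorder_cases)
    case less
    thus ?thesis using that j app_eqD[OF L.P_B(2)[of i j \<chi> \<psi>]] unfolding B by (simp add: cmp_opP)
  next
    case equal
    thus ?thesis using that j app_eqD1[OF L.P_B(1)[of j j \<chi> \<psi>]] unfolding B by (simp add: cmp_opP app_simps app_0)
  next
    case greater
    thus ?thesis using that j app_eqD[OF L.P_B(3)[of i j \<chi> \<psi>]] unfolding B by (simp add: cmp_opP)
  qed
  hence "Phi d q n (app (opP d (Suc n) j \<psi>) v) = app (opP d n j \<psi>) (Phi d q n v)" for v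
    unfolding Phi_def app_sum by (intro sum.cong) auto
  moreover have "low d n (app (opP d (Suc n) j \<psi>) v)" if "low d n v" for v
    unfolding low_def
  proof (intro allI impI)
    fix i \<chi> assume i: "1 \<le> i \<and> i \<le> n \<and> \<chi> < d"
    show "cmp i \<chi> (app (opP d (Suc n) j \<psi>) v) = 0"
      using that i by (cases i j rule: linorder_cases) (auto simp: cmp_opP lin low_def)
  qed
  ultimately show ?thesis using j by (simp add: Cor_def cmp_opP)
qed

text \<open>Made for the action of \<open>g j\<close>, which mixes the coordinates \<open>j\<close>
  and \<open>Suc j\<close> and treats all others separately.\<close>

lemma sum_two:
  assumes "finite I" "i \<in> I" "j \<in> I" "i \<noteq> j" "\<And>k. k \<in> I \<Longrightarrow> k \<noteq> i \<Longrightarrow> k \<noteq> j \<Longrightarrow> f k = h k" "f i + f j = h i + h j"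
  shows "sum f I = (sum h I :: 'b :: ab_group_add)"
proof -
  have "sum f I = (f i + f j) + sum f (I - {i} - {j})" for f :: "_ \<Rightarrow> 'b"
    using assms(1-4) by (simp add: sum.remove[of I i] sum.remove[of "I - {i}" j] add.assoc)
  moreover have "sum f (I - {i} - {j}) = sum h (I - {i} - {j})"
    using assms(5) by (intro sum.cong) auto
  ultimately show ?thesis using assms(6) by metis
qed

lemma Cor_G:
  assumes d: "d \<ge> 1" "q \<noteq> 0" and j: "1 \<le> j" "j < n"
  shows "Cor d q n (opG d q (Suc n) j) (opG d q n j)"
proof -
  interpret L: coloured_hecke endo_sc "opG d q n" "opP d n" n d "q - inverse q"
    by (rule regular_rep[OF d])
  have B: "opB d q n i \<chi> = L.B i \<chi>" for i \<chi> by (simp add: opB_def L.B_def L.Q_def)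
  have "Phi d q n (app (opG d q (Suc n) j) v) = app (opG d q n j) (Phi d q n v)" for v
    unfolding Phi_def app_sum
  proof (rule sum.cong[OF refl], rule sum_two[where i = j and j = "Suc j"])
    fix \<chi> assume "\<chi> \<in> {..<d}" hence \<chi>: "\<chi> < d" by simp
    note g = app_eqD1[OF L.g_B(2)[of "Suc j" j \<chi>]] app_eqD1[OF L.g_B(3)[of j j \<chi>]]
    show "app (opB d q n j \<chi>) (cmp j \<chi> (app (opG d q (Suc n) j) v)) +
         app (opB d q n (Suc j) \<chi>) (cmp (Suc j) \<chi> (app (opG d q (Suc n) j) v)) =
         app (opG d q n j) (app (opB d q n j \<chi>) (cmp j \<chi> v)) +
         app (opG d q n j) (app (opB d q n (Suc j) \<chi>) (cmp (Suc j) \<chi> v))"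
      using j \<chi> g unfolding B by (simp add: cmp_opG lin add_ac)
    fix k assume k: "k \<in> {1..n}" "k \<noteq> j" "k \<noteq> Suc j"
    note g = app_eqD[OF L.g_B(1)[of k j \<chi>]] app_eqD[OF L.g_B(4)[of k j \<chi>]]
    show "app (opB d q n k \<chi>) (cmp k \<chi> (app (opG d q (Suc n) j) v)) =
        app (opG d q n j) (app (opB d q n k \<chi>) (cmp k \<chi> v))"
    proof (cases k j rule: linorder_cases)
      case less
      thus ?thesis using j \<chi> g(2) k unfolding B by (simp add: cmp_opG)
    next
      case greater
      hence "Suc j < k" using k by simp
      thus ?thesis using j \<chi> g(1) k unfolding B by (simp add: cmp_opG)
    qed (use k in simp)
  qed (use j in auto)
  moreover have "low d n (app (opG d q (Suc n) j) v)" if "low d n v" for v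
    unfolding low_def
  proof (intro allI impI)
    fix i \<chi> assume i: "1 \<le> i \<and> i \<le> n \<and> \<chi> < d"
    consider "i < j" | "i = j" | "i = Suc j" | "Suc j < i" by linarith
    thus "cmp i \<chi> (app (opG d q (Suc n) j) v) = 0"
      using that i j by cases (auto simp: cmp_opG lin low_def)
  qed
  ultimately show ?thesis using j by (simp add: Cor_def cmp_opG)
qed

abbreviation "regular_A d q n \<equiv> coloured_hecke.A endo_sc (opG d q n) (opP d n) d"

lemma Cor_A:
  assumes d: "d \<ge> 1" "q \<noteq> 0" and k: "k \<le> n" and a: "a \<in> regular_A d q (Suc n) k"
  shows "\<exists>a'\<in>regular_A d q n k. Cor d q n a a'"
proof -
  interpret L: coloured_hecke endo_sc "opG d q n" "opP d n" n d "q - inverse q"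
    by (rule regular_rep[OF d])
  interpret L': coloured_hecke endo_sc "opG d q (Suc n)" "opP d (Suc n)" "Suc n" d "q - inverse q"
    by (rule regular_rep[OF d])
  from a show ?thesis
  proof (induction rule: L'.A.induct)
    case (A_sc s) thus ?case using L.A_sc Cor_sc by blast
  next
    case (A_g i) thus ?case using L.A_g[of i k] Cor_G[OF d, of i n] k by auto
  next
    case (A_P j \<chi>) thus ?case using L.A_P[of j k \<chi>] Cor_P[OF d, of j n \<chi>] k by auto
  next
    case (A_add x y) thus ?case using L.A_add Cor_add by blast
  next
    case (A_mult x y) thus ?case using L.A_mult Cor_mult by blast
  qed
qed

definition regular_tr :: "nat \<Rightarrow> complex \<Rightarrow> (nat \<Rightarrow> complex) \<Rightarrow> complex poly \<Rightarrow> nat \<Rightarrow> endo \<Rightarrow> complex poly" where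
  "regular_tr d q Y z n a = ell d q Y z n (app a (vac d n))"

lemma ell_Cor_low:
  assumes "Cor d q n a a'" "low d n v"
  shows "ell d q Y z (Suc n) (app a v) = (\<Sum>\<chi><d. Polynomial.smult (Y \<chi>) (ell d q Y z n (app a' (cmp (Suc n) \<chi> v))))"
  using assms Phi_low by (auto simp: Cor_def ell_0 app_0)

text \<open>The unit of level \<open>n + 1\<close> has the unit of level \<open>n\<close> as its top
  coordinate in every colour, so that weights of sum 1 make the functional compatible with the
  inclusions.\<close>

lemma regular_tr_Cor:
  assumes "Cor d q n a a'" "(\<Sum>\<chi><d. Y \<chi>) = 1"
  shows "regular_tr d q Y z (Suc n) a = regular_tr d q Y z n a'"
  unfolding regular_tr_def ell_Cor_low[OF assms(1) low_vac]
  using assms(2) by (simp add: cmp_vac flip: smult_sum)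

lemma regular_tr_top:
  assumes d: "d \<ge> 1" "q \<noteq> 0" and Y: "(\<Sum>\<chi><d. Y \<chi>) = 1" and ab: "Cor d q n a a'" "Cor d q n b b'" 
  shows "\<chi> < d \<Longrightarrow> regular_tr d q Y z (Suc n) (a * opP d (Suc n) (Suc n) \<chi> * b) =
      Polynomial.smult (Y \<chi>) (regular_tr d q Y z (Suc n) (a * b))"
    "1 \<le> n \<Longrightarrow> regular_tr d q Y z (Suc n) (a * opG d q (Suc n) n * b) = z * regular_tr d q Y z (Suc n) (a * b)"
proof -
  interpret L: coloured_hecke endo_sc "opG d q n" "opP d n" n d "q - inverse q"
    by (rule regular_rep[OF d])
  define w where "w = app b (vac d (Suc n))"
  have w: "low d n w" "\<And>\<chi>. \<chi> < d \<Longrightarrow> cmp (Suc n) \<chi> w = app b' (vac d n)"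
    using ab(2) low_vac by (auto simp: Cor_def w_def cmp_vac)
  have ab': "regular_tr d q Y z (Suc n) (a * b) = ell d q Y z n (app a' (app b' (vac d n)))"
    using regular_tr_Cor[OF Cor_mult[OF ab] Y] by (simp add: regular_tr_def lin)
  show "regular_tr d q Y z (Suc n) (a * opP d (Suc n) (Suc n) \<chi> * b) =
      Polynomial.smult (Y \<chi>) (regular_tr d q Y z (Suc n) (a * b))" if \<chi>: "\<chi> < d"
  proof -
    have "low d n (app (opP d (Suc n) (Suc n) \<chi>) w)"
      using w(1) by (auto simp: low_def cmp_opP lin)
    hence "regular_tr d q Y z (Suc n) (a * opP d (Suc n) (Suc n) \<chi> * b) =
       (\<Sum>\<psi><d. Polynomial.smult (Y \<psi>) (ell d q Y z n (app a' (cmp (Suc n) \<psi> (app (opP d (Suc n) (Suc n) \<chi>) w)))))"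
      using ell_Cor_low[OF ab(1)] by (simp add: regular_tr_def app_simps w_def)
    also have "\<dots> = (\<Sum>\<psi><d. if \<psi> = \<chi> then Polynomial.smult (Y \<chi>) (ell d q Y z n (app a' (app b' (vac d n)))) else 0)"
      using w(2) by (intro sum.cong) (auto simp: cmp_opP app_0 ell_0)
    finally show ?thesis using \<chi> by (simp add: ab')
  qed
  show "regular_tr d q Y z (Suc n) (a * opG d q (Suc n) n * b) = z * regular_tr d q Y z (Suc n) (a * b)" if n: "1 \<le> n"
  proof -
    define v where "v = app (opG d q (Suc n) n) w"
    \<comment> \<open>Since \<open>w\<close> is low, \<open>g n\<close> moves its top coordinates to
      the index \<open>n\<close> and leaves nothing elsewhere; no correction term arises.\<close>
    have 1: "cmp (Suc n) \<psi> v = 0" if "\<psi> < d" for \<psi>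
      using w(1) n that by (simp add: v_def cmp_opG low_def)
    have 2: "cmp i \<psi> v = (if i = n then app b' (vac d n) else 0)" if "\<psi> < d" "1 \<le> i" "i \<le> n" for i \<psi>
      using w n that by (cases "i = n") (auto simp add: v_def cmp_opG low_def lin)
    have "Phi d q n v = (\<Sum>\<psi><d. app (opB d q n n \<psi>) (app b' (vac d n)))"
      unfolding Phi_def
    proof (intro sum.cong refl)
      fix \<psi> assume "\<psi> \<in> {..<d}"
      hence "(\<Sum>i = 1..n. app (opB d q n i \<psi>) (cmp i \<psi> v)) =
          (\<Sum>i = 1..n. if i = n then app (opB d q n n \<psi>) (app b' (vac d n)) else 0)"
        using 2 by (intro sum.cong) (auto simp: app_0)
      thus "(\<Sum>i = 1..n. app (opB d q n i \<psi>) (cmp i \<psi> v)) = app (opB d q n n \<psi>) (app b' (vac d n))"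
        using n by simp
    qed
    \<comment> \<open>At \<open>i = n\<close> the product of generators in \<open>opB\<close> is
      empty, so that the sum over the colours is that of the projections
      \<open>opP d n n \<psi>\<close>, which is 1.\<close>
    also have "\<dots> = app b' (vac d n)"
      using L.P_sum[of n] n by (simp add: opB_def flip: app_sum_left) (simp add: app_simps)
    finally have "Phi d q n (app a v) = app a' (app b' (vac d n))"
      using ab(1) by (simp add: Cor_def)
    moreover have "cmp (Suc n) \<psi> (app a v) = 0" if "\<psi> < d" for \<psi>
      using ab(1) 1 that by (simp add: Cor_def app_0)
    ultimately have "ell d q Y z (Suc n) (app a v) = z * ell d q Y z n (app a' (app b' (vac d n)))"
      by (simp add: ell_0)
    thus ?thesis
      unfolding ab' by (simp add: regular_tr_def app_simps v_def w_def del: ell.simps)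
  qed
qed

text \<open>For \<open>k < n\<close> the rules at level \<open>n + 1\<close> are those of level
  \<open>n\<close>, transported by \<open>Cor\<close>; the new case \<open>k = n\<close> is
  \<open>regular_tr_top\<close>. At level 0 the rules are vacuous.\<close>

theorem weak_trace_regular_tr:
  assumes d: "d \<ge> 1" "q \<noteq> 0" and Y: "(\<Sum>\<chi><d. Y \<chi>) = 1"
  shows "weak_trace endo_sc (opG d q n) (opP d n) n d (q - inverse q) (regular_tr d q Y z n) z Y"
proof (induction n)
  case 0
  interpret L: coloured_hecke endo_sc "opG d q 0" "opP d 0" 0 d "q - inverse q"
    by (rule regular_rep[OF d])
  show ?case by unfold_locales (auto simp: regular_tr_def lin ell_add ell_scal pw scal_apply)
next
  case (Suc n)
  interpret L: coloured_hecke endo_sc "opG d q n" "opP d n" n d "q - inverse q"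
    by (rule regular_rep[OF d])
  interpret L': coloured_hecke endo_sc "opG d q (Suc n)" "opP d (Suc n)" "Suc n" d "q - inverse q"
    by (rule regular_rep[OF d])
  interpret W: weak_trace endo_sc "opG d q n" "opP d n" n d "q - inverse q" "regular_tr d q Y z n" z Y
    by (rule Suc.IH)
  show ?case
  proof unfold_locales
    show "regular_tr d q Y z (Suc n) (x + y) = regular_tr d q Y z (Suc n) x + regular_tr d q Y z (Suc n) y" for x y
      by (simp add: regular_tr_def app_simps ell_add del: ell.simps)
    show "regular_tr d q Y z (Suc n) (endo_sc s * x) = Polynomial.smult s (regular_tr d q Y z (Suc n) x)" for s x
      by (simp add: regular_tr_def app_simps ell_scal del: ell.simps)
  next
    fix k a b \<chi> assume k: "k < Suc n" "a \<in> L'.A k" "b \<in> L'.A k" and \<chi>: "\<chi> < d"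
    obtain a' b' where c: "a' \<in> L.A k" "b' \<in> L.A k" "Cor d q n a a'" "Cor d q n b b'"
      using Cor_A[OF d, of k n a] Cor_A[OF d, of k n b] k by auto
    show "regular_tr d q Y z (Suc n) (a * opP d (Suc n) (Suc k) \<chi> * b) = Polynomial.smult (Y \<chi>) (regular_tr d q Y z (Suc n) (a * b))"
    proof (cases "k = n")
      case True thus ?thesis using regular_tr_top(1)[OF d Y c(3,4) \<chi>] by simp
    next
      case False
      hence "Cor d q n (opP d (Suc n) (Suc k) \<chi>) (opP d n (Suc k) \<chi>)" using k \<chi> d by (intro Cor_P) auto
      thus ?thesis
        using regular_tr_Cor[OF Cor_mult[OF Cor_mult[OF c(3)] c(4)] Y]
          regular_tr_Cor[OF Cor_mult[OF c(3,4)] Y] W.tr_P[of k a' b' \<chi>] False k c \<chi> by simp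
    qed
  next
    fix k a b assume k: "1 \<le> k" "k < Suc n" "a \<in> L'.A k" "b \<in> L'.A k"
    obtain a' b' where c: "a' \<in> L.A k" "b' \<in> L.A k" "Cor d q n a a'" "Cor d q n b b'"
      using Cor_A[OF d, of k n a] Cor_A[OF d, of k n b] k by auto
    show "regular_tr d q Y z (Suc n) (a * opG d q (Suc n) k * b) = z * regular_tr d q Y z (Suc n) (a * b)"
    proof (cases "k = n")
      case True thus ?thesis using regular_tr_top(2)[OF d Y c(3,4)] k by simp
    next
      case False
      hence "Cor d q n (opG d q (Suc n) k) (opG d q n k)" using k d by (intro Cor_G) auto
      thus ?thesis
        using regular_tr_Cor[OF Cor_mult[OF Cor_mult[OF c(3)] c(4)] Y]
          regular_tr_Cor[OF Cor_mult[OF c(3,4)] Y] W.tr_g[of k a' b'] False k c by simp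
    qed
  qed
qed


section \<open>Fourier transform on cyclic groups\<close>

definition zeta :: "nat \<Rightarrow> complex" where "zeta d = cis (2 * pi / real d)"

lemma zeta_pow: "zeta d ^ k = cis (2 * pi * real k / real d)"
  by (simp add: zeta_def DeMoivre mult.commute)

lemma zeta_d: "d \<ge> 1 \<Longrightarrow> zeta d ^ d = 1"
  by (simp add: zeta_pow)

lemma zeta_d_mult: "d \<ge> 1 \<Longrightarrow> zeta d ^ (d * k) = 1"
  by (simp add: power_mult zeta_d)

lemma zeta_eq_iff: "\<chi> < d \<Longrightarrow> \<psi> < d \<Longrightarrow> zeta d ^ \<chi> = zeta d ^ \<psi> \<longleftrightarrow> \<chi> = \<psi>"
  using bij_betw_roots_unity[of d] by (auto simp: zeta_pow bij_betw_def inj_on_def)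

lemma zeta_nz: "zeta d \<noteq> 0"
  by (simp add: zeta_def)

lemma root_unity_sum:
  fixes w :: complex
  assumes "w ^ d = 1" "w \<noteq> 1"
  shows "(\<Sum>s<d. w ^ s) = 0"
  using geometric_sum[of w d] assms by simp

text \<open>Orthogonality of characters. The exponent \<open>d - s\<close> stands for
  \<open>- s\<close>, as in the definition of \<open>fe\<close>, so that all exponents are natural
  numbers.\<close>

lemma zeta_orth:
  assumes "\<chi> < d" "\<psi> < d"
  shows "(\<Sum>s<d. zeta d ^ (\<chi> * (d - s)) * zeta d ^ (\<psi> * s)) = (if \<chi> = \<psi> then of_nat d else 0)"
proof -
  have d: "d \<ge> 1" using assms by simp
  define w where "w = zeta d ^ \<psi> / zeta d ^ \<chi>"
  have "zeta d ^ (\<chi> * (d - s)) * zeta d ^ (\<psi> * s) = w ^ s" if "s < d" for s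
  proof -
    have "zeta d ^ (\<chi> * (d - s)) * zeta d ^ (\<chi> * s) = (zeta d ^ d) ^ \<chi>"
      using that by (simp add: mult.commute[of d] algebra_simps flip: power_add power_mult)
    hence "zeta d ^ (\<chi> * (d - s)) * zeta d ^ (\<chi> * s) = 1" using zeta_d[OF d] by simp
    thus ?thesis by (simp add: w_def power_divide field_simps zeta_nz power_mult)
  qed
  hence "(\<Sum>s<d. zeta d ^ (\<chi> * (d - s)) * zeta d ^ (\<psi> * s)) = (\<Sum>s<d. w ^ s)" by simp
  moreover have "w ^ d = 1"
    using zeta_d_mult[OF d] zeta_nz by (simp add: w_def power_divide mult.commute[of _ d] flip: power_mult)
  moreover have "w = 1 \<longleftrightarrow> \<chi> = \<psi>"
    using zeta_eq_iff[OF assms] zeta_nz by (auto simp: w_def)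
  ultimately show ?thesis using root_unity_sum by auto
qed

lemma zeta_sum: "s < d \<Longrightarrow> (\<Sum>\<chi><d. zeta d ^ (\<chi> * (d - s))) = (if s = 0 then of_nat d else 0)"
proof -
  assume s: "s < d"
  have "(\<Sum>\<chi><d. zeta d ^ (\<chi> * (d - s))) = (\<Sum>\<chi><d. (zeta d ^ (d - s)) ^ \<chi>)"
    by (simp add: mult.commute flip: power_mult)
  moreover have "(zeta d ^ (d - s)) ^ d = 1"
    using zeta_d_mult[of d] s by (simp add: mult.commute[of _ d] flip: power_mult)
  moreover have "zeta d ^ (d - s) = 1 \<longleftrightarrow> s = 0"
    using zeta_eq_iff[of "d - s" d 0] zeta_d[of d] s by (cases "s = 0") auto
  ultimately show ?thesis using root_unity_sum by auto
qed

context central_scalars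
begin

definition spectral :: "nat \<Rightarrow> 'a \<Rightarrow> (nat \<Rightarrow> 'a) \<Rightarrow> bool" where
  "spectral d u p \<longleftrightarrow> (\<forall>\<chi><d. \<forall>\<psi><d. p \<chi> * p \<psi> = (if \<chi> = \<psi> then p \<chi> else 0)) \<and>
     (\<Sum>\<chi><d. p \<chi>) = 1 \<and> u = (\<Sum>\<chi><d. sc (zeta d ^ \<chi>) * p \<chi>)"

lemma sc_mult_left: "sc a * (sc b * x) = sc (a * b) * x"
  by (simp add: sc_mult mult.assoc)

lemma spectral_eigen:
  assumes "spectral d u p" "\<chi> < d"
  shows "u * p \<chi> = sc (zeta d ^ \<chi>) * p \<chi>"
proof -
  have "u * p \<chi> = (\<Sum>\<psi><d. if \<psi> = \<chi> then sc (zeta d ^ \<chi>) * p \<chi> else 0)"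
  proof -
    have "u * p \<chi> = (\<Sum>\<psi><d. sc (zeta d ^ \<psi>) * (p \<psi> * p \<chi>))"
      using assms by (simp add: spectral_def sum_distrib_right mult.assoc)
    also have "\<dots> = (\<Sum>\<psi><d. if \<psi> = \<chi> then sc (zeta d ^ \<chi>) * p \<chi> else 0)"
      using assms by (intro sum.cong) (auto simp: spectral_def)
    finally show ?thesis .
  qed
  thus ?thesis using assms(2) by simp
qed

lemma spectral_power:
  assumes "spectral d u p"
  shows "u ^ k = (\<Sum>\<chi><d. sc (zeta d ^ (\<chi> * k)) * p \<chi>)"
proof (induction k)
  case 0 thus ?case using assms by (simp add: spectral_def sc_1)
next
  case (Suc k)
  have "u ^ Suc k = (\<Sum>\<chi><d. sc (zeta d ^ (\<chi> * k)) * (u * p \<chi>))"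
    by (simp add: Suc sum_distrib_left sc_left_comm[of u])
  also have "\<dots> = (\<Sum>\<chi><d. sc (zeta d ^ (\<chi> * Suc k)) * p \<chi>)"
    using spectral_eigen[OF assms] by (intro sum.cong) (auto simp: sc_mult_left power_add mult.commute)
  finally show ?case .
qed

text \<open>Expanding both powers spectrally gives a character sum for every pair of colours, and
  orthogonality leaves the diagonal pairs.\<close>

lemma spectral_e:
  assumes u: "spectral d u p" and v: "spectral d v r" and d: "d \<ge> 1"
  shows "sc (1 / of_nat d) * (\<Sum>s<d. u ^ s * v ^ (d - s)) = (\<Sum>\<chi><d. p \<chi> * r \<chi>)"
proof -
  have "(\<Sum>s<d. u ^ s * v ^ (d - s)) =
      (\<Sum>s<d. \<Sum>\<chi><d. \<Sum>\<psi><d. sc (zeta d ^ (\<psi> * (d - s)) * zeta d ^ (\<chi> * s)) * (p \<chi> * r \<psi>))"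
    unfolding spectral_power[OF u] spectral_power[OF v] sum_product
    by (intro sum.cong refl) (simp add: sc_mult mult.assoc sc_left_comm[of "p _"] sc_left_comm[of "sc _"])
  also have "\<dots> = (\<Sum>\<chi><d. \<Sum>s<d. \<Sum>\<psi><d. sc (zeta d ^ (\<psi> * (d - s)) * zeta d ^ (\<chi> * s)) * (p \<chi> * r \<psi>))"
    by (rule sum.swap)
  also have "\<dots> = (\<Sum>\<chi><d. \<Sum>\<psi><d. \<Sum>s<d. sc (zeta d ^ (\<psi> * (d - s)) * zeta d ^ (\<chi> * s)) * (p \<chi> * r \<psi>))"
    by (intro sum.cong refl sum.swap)
  also have "\<dots> = (\<Sum>\<chi><d. \<Sum>\<psi><d. sc (if \<psi> = \<chi> then of_nat d else 0) * (p \<chi> * r \<psi>))"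
    by (intro sum.cong refl) (simp flip: sum_distrib_right sc_sum add: zeta_orth)
  also have "\<dots> = (\<Sum>\<chi><d. \<Sum>\<psi><d. if \<psi> = \<chi> then sc (of_nat d) * (p \<chi> * r \<chi>) else 0)"
    by (intro sum.cong refl) (auto simp: sc_0)
  also have "\<dots> = sc (of_nat d) * (\<Sum>\<chi><d. p \<chi> * r \<chi>)"
    by (simp add: sum_distrib_left)
  finally show ?thesis using d by (simp add: sc_mult_left sc_1)
qed

text \<open>The inverse discrete Fourier transform of the powers of \<open>u\<close>; if
  \<open>u ^ d = 1\<close>, it is the projection onto the eigenspace of
  \<open>zeta d ^ \<chi>\<close>.\<close>

definition proj :: "nat \<Rightarrow> 'a \<Rightarrow> nat \<Rightarrow> 'a" where
  "proj d u \<chi> = sc (1 / of_nat d) * (\<Sum>s<d. sc (zeta d ^ (\<chi> * (d - s))) * u ^ s)"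

lemma proj_eigen:
  assumes u: "u ^ d = 1" and d: "d \<ge> 1"
  shows "u * proj d u \<chi> = sc (zeta d ^ \<chi>) * proj d u \<chi>"
proof -
  define f where "f s = sc (zeta d ^ (\<chi> * (d - s))) * u ^ s" for s
  have "f d = f 0"
    using u zeta_d[OF d] by (simp add: f_def sc_1 mult.commute[of _ d] power_mult)
  hence "(\<Sum>s<d. f (Suc s)) = (\<Sum>s<d. f s)"
    using sum_lessThan_telescope[of f d] by (simp add: sum_subtractf)
  moreover have "u * f s = sc (zeta d ^ \<chi>) * f (Suc s)" if "s < d" for s
  proof -
    have "d - s = Suc (d - Suc s)" using that by simp
    hence "\<chi> * (d - s) = \<chi> + \<chi> * (d - Suc s)" by simp
    thus ?thesis by (simp add: f_def sc_left_comm[of u] sc_mult_left power_add)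
  qed
  moreover have "u * (\<Sum>s<d. f s) = (\<Sum>s<d. u * f s)" "sc (zeta d ^ \<chi>) * (\<Sum>s<d. f (Suc s)) = (\<Sum>s<d. sc (zeta d ^ \<chi>) * f (Suc s))"
    by (simp_all only: sum_distrib_left)
  ultimately have "u * (\<Sum>s<d. f s) = sc (zeta d ^ \<chi>) * (\<Sum>s<d. f s)" by simp
  thus ?thesis unfolding proj_def f_def[symmetric]
    by (simp add: sc_left_comm[of u] sc_left_comm[of "sc (zeta d ^ \<chi>)" "1 / of_nat d"])
qed

lemma proj_eigen_power:
  assumes u: "u ^ d = 1" and d: "d \<ge> 1"
  shows "u ^ s * proj d u \<chi> = sc (zeta d ^ (\<chi> * s)) * proj d u \<chi>"
proof (induction s)
  case (Suc s)
  have "u ^ Suc s * proj d u \<chi> = u * (u ^ s * proj d u \<chi>)" by (simp add: mult.assoc)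
  also have "\<dots> = sc (zeta d ^ (\<chi> * s)) * (u * proj d u \<chi>)" unfolding Suc by (rule sc_left_comm)
  also have "\<dots> = sc (zeta d ^ (\<chi> * Suc s)) * proj d u \<chi>"
    unfolding proj_eigen[OF u d] by (simp add: sc_mult_left power_add mult.commute)
  finally show ?case .
qed (simp add: sc_1)

lemma spectral_proj:
  assumes u: "u ^ d = 1" and d: "d \<ge> 1"
  shows "spectral d u (proj d u)"
proof -
  have orth: "proj d u \<chi> * proj d u \<psi> = (if \<chi> = \<psi> then proj d u \<chi> else 0)" if "\<chi> < d" "\<psi> < d" for \<chi> \<psi>
  proof -
    have "proj d u \<chi> * proj d u \<psi> =
        sc (1 / of_nat d) * (\<Sum>s<d. sc (zeta d ^ (\<chi> * (d - s)) * zeta d ^ (\<psi> * s)) * proj d u \<psi>)"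
      unfolding proj_def[of d u \<chi>] mult.assoc sum_distrib_right proj_eigen_power[OF u d] sc_mult_left ..
    also have "\<dots> = sc (1 / of_nat d) * (sc (if \<chi> = \<psi> then of_nat d else 0) * proj d u \<psi>)"
      using zeta_orth[OF that] by (simp flip: sum_distrib_right sc_sum)
    finally show ?thesis using d by (auto simp: sc_mult_left sc_1 sc_0)
  qed
  have "(\<Sum>\<chi><d. proj d u \<chi>) = sc (1 / of_nat d) * (\<Sum>\<chi><d. \<Sum>s<d. sc (zeta d ^ (\<chi> * (d - s))) * u ^ s)"
    by (simp add: proj_def sum_distrib_left)
  also have "(\<Sum>\<chi><d. \<Sum>s<d. sc (zeta d ^ (\<chi> * (d - s))) * u ^ s) = (\<Sum>s<d. sc (\<Sum>\<chi><d. zeta d ^ (\<chi> * (d - s))) * u ^ s)"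
    by (subst sum.swap) (simp add: sc_sum sum_distrib_right)
  also have "\<dots> = (\<Sum>s<d. if s = 0 then sc (of_nat d) else 0)"
    by (intro sum.cong) (auto simp: zeta_sum sc_0)
  also have "\<dots> = sc (of_nat d)" using d by simp
  finally have sum: "(\<Sum>\<chi><d. proj d u \<chi>) = 1" using d sc_mult[of "1 / of_nat d" "of_nat d"] by (simp add: sc_1)
  have "u = u * (\<Sum>\<chi><d. proj d u \<chi>)" by (simp add: sum)
  also have "\<dots> = (\<Sum>\<chi><d. sc (zeta d ^ \<chi>) * proj d u \<chi>)"
    by (simp add: sum_distrib_left proj_eigen[OF u d])
  finally show ?thesis using orth sum by (simp add: spectral_def)
qed

lemma proj_comm:
  assumes "x * u = v * x"
  shows "x * proj d u \<chi> = proj d v \<chi> * x"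
proof -
  have p: "x * u ^ s = v ^ s * x" for s
  proof (induction s)
    case (Suc s)
    have "x * u ^ Suc s = v * (x * u ^ s)" by (simp add: mult_ext[OF assms])
    thus ?case by (simp add: Suc mult.assoc)
  qed simp
  show ?thesis
    by (simp add: proj_def sum_distrib_left sum_distrib_right sc_left_comm[of x] p mult.assoc)
qed

section \<open>The universal property of the free algebra\<close>

definition ev :: "('x \<Rightarrow> 'a) \<Rightarrow> 'x falg \<Rightarrow> 'a" where
  "ev h p = (\<Sum>w\<in>Poly_Mapping.keys p. sc (Poly_Mapping.lookup p w) * prod_list (map h (letters w)))"

lemma ev_superset:
  assumes "finite S" "Poly_Mapping.keys p \<subseteq> S"
  shows "ev h p = (\<Sum>w\<in>S. sc (Poly_Mapping.lookup p w) * prod_list (map h (letters w)))"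
  unfolding ev_def using assms by (intro sum.mono_neutral_left) (auto simp: in_keys_iff sc_0)

lemma ev_add: "ev h (p + r) = ev h p + ev h r"
proof -
  let ?S = "Poly_Mapping.keys p \<union> Poly_Mapping.keys r"
  have "Poly_Mapping.keys (p + r) \<subseteq> ?S" by (rule keys_add)
  thus ?thesis
    using ev_superset[of ?S "p + r" h] ev_superset[of ?S p h] ev_superset[of ?S r h]
    by (simp add: lookup_add sc_add distrib_right sum.distrib)
qed

lemma ev_single: "ev h (Poly_Mapping.single w a) = sc a * prod_list (map h (letters w))"
  using ev_superset[of "{w}" "Poly_Mapping.single w a" h] by simp

lemma ev_0: "ev h 0 = 0" by (simp add: ev_def)

lemma ev_sum: "ev h (sum f I) = (\<Sum>i\<in>I. ev h (f i))"
  by (induction I rule: infinite_finite_induct) (auto simp: ev_add ev_0)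

lemma poly_mapping_decomp: "p = (\<Sum>k\<in>Poly_Mapping.keys p. Poly_Mapping.single k (Poly_Mapping.lookup p k))"
  by (rule poly_mapping_eqI) (simp add: lookup_sum lookup_single when_def in_keys_iff)

lemma ev_mult: "ev h (p * r) = ev h p * ev h r"
proof -
  let ?s = "\<lambda>p k. Poly_Mapping.single k (Poly_Mapping.lookup p k)"
  have s: "ev h (Poly_Mapping.single u a * Poly_Mapping.single v b) =
      ev h (Poly_Mapping.single u a) * ev h (Poly_Mapping.single v b)" for u v a b
    by (simp add: mult_single ev_single sc_mult mult.assoc sc_left_comm[of "prod_list _"])
  have "ev h (p * r) = ev h ((\<Sum>k\<in>Poly_Mapping.keys p. ?s p k) * (\<Sum>k\<in>Poly_Mapping.keys r. ?s r k))"
    using poly_mapping_decomp[of p] poly_mapping_decomp[of r] by simp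
  also have "\<dots> = ev h (\<Sum>k\<in>Poly_Mapping.keys p. ?s p k) * ev h (\<Sum>k\<in>Poly_Mapping.keys r. ?s r k)"
    by (simp add: sum_product ev_sum s)
  finally show ?thesis
    using poly_mapping_decomp[of p] poly_mapping_decomp[of r] by simp
qed

lemma ev_const: "ev h (free_const c) = sc c"
  by (simp add: free_const_def ev_single)

lemma ev_1: "ev h 1 = 1"
  using ev_const[of h 1] by (simp add: free_const_simps sc_1)

lemma ev_var: "ev h (free_var x) = h x"
  by (simp add: free_var_def ev_single sc_1)

lemma ev_power: "ev h (p ^ k) = ev h p ^ k"
  by (induction k) (auto simp: ev_1 ev_mult)

lemma ev_minus: "ev h (p - r) = ev h p - ev h r"
  using ev_add[of h "p - r" r] by (simp add: algebra_simps)

lemma ev_mem: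
  assumes "p \<in> carrier (free_algebra X)" and "\<And>x. x \<in> X \<Longrightarrow> h x \<in> S"
    and "\<And>a. sc a \<in> S" "\<And>x y. x \<in> S \<Longrightarrow> y \<in> S \<Longrightarrow> x + y \<in> S" "\<And>x y. x \<in> S \<Longrightarrow> y \<in> S \<Longrightarrow> x * y \<in> S"
  shows "ev h p \<in> S"
proof -
  have 1: "1 \<in> S" "0 \<in> S" using assms(3)[of 1] assms(3)[of 0] by (auto simp: sc_1 sc_0)
  have w: "prod_list (map h l) \<in> S" if "set l \<subseteq> X" for l
    using that by (induction l) (auto intro: assms 1)
  have "(\<Sum>w\<in>I. sc (Poly_Mapping.lookup p w) * prod_list (map h (letters w))) \<in> S"
    if "I \<subseteq> Poly_Mapping.keys p" for I
    using finite_subset[OF that finite_keys] that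
    by (induction I rule: finite_induct) (use assms(1) in \<open>auto intro!: assms(3-5) w 1 simp: mem_free_algebra\<close>)
  thus ?thesis by (simp add: ev_def)
qed

end


section \<open>Specialized traces\<close>

text \<open>Both presentations at once: the \<open>t j\<close> of the original generators, with the
  \<open>P j\<close> as their spectral projections. Evaluation of words in such a model therefore
  factors through \<open>YH\<close>, see \<open>ev_ideal\<close>.\<close>

locale yh_model = coloured_hecke sc g P N d "q - inverse q"
  for sc :: "complex \<Rightarrow> 'a::{ring,monoid_mult}" and g :: "nat \<Rightarrow> 'a" and P N d q +
  fixes t :: "nat \<Rightarrow> 'a"
  assumes t_spec: "1 \<le> j \<Longrightarrow> j \<le> N \<Longrightarrow> spectral d (t j) (P j)"
begin

lemma t_def: "1 \<le> j \<Longrightarrow> j \<le> N \<Longrightarrow> t j = (\<Sum>\<chi><d. sc (zeta d ^ \<chi>) * P j \<chi>)"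
  using t_spec by (simp add: spectral_def)

lemma t_A: "1 \<le> j \<Longrightarrow> j \<le> n \<Longrightarrow> n \<le> N \<Longrightarrow> t j \<in> A n"
  by (auto simp: t_def intro!: A_sum A_mult A_sc A_P)

definition h :: "yh_gen \<Rightarrow> 'a" where "h x = (case x of Gg i \<Rightarrow> g i | Gt j \<Rightarrow> t j)"

lemma h_simps: "h (Gg i) = g i" "h (Gt j) = t j"
  by (simp_all add: h_def)

lemma ev_A: "p \<in> carrier (free_algebra (yh_gens n)) \<Longrightarrow> n \<le> N \<Longrightarrow> ev h p \<in> A n"
  by (rule ev_mem) (auto simp: yh_gens_def h_simps intro!: A_g t_A intro: A_sc A_add A_mult)

lemma ev_fe:
  assumes "1 \<le> i" "i < N"
  shows "ev h (fe d i) = E i (Suc i)"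
  using spectral_e[OF t_spec[of i] t_spec[of "Suc i"] d_pos] assms
  by (simp add: fe_def E_def ev_mult ev_const ev_sum ev_power ev_var h_simps)

lemma ev_t_power:
  "1 \<le> j \<Longrightarrow> j \<le> N \<Longrightarrow> ev h (ft j ^ k) = (\<Sum>\<chi><d. sc (zeta d ^ (\<chi> * k)) * P j \<chi>)"
  using spectral_power[OF t_spec] by (simp add: ev_power ev_var h_simps)

lemma t_intertwine:
  assumes "1 \<le> j" "j \<le> N" "1 \<le> k" "k \<le> N" "\<And>\<chi>. \<chi> < d \<Longrightarrow> P j \<chi> * x = x * P k \<chi>"
  shows "t j * x = x * t k"
  using assms by (simp add: t_def sum_distrib_left sum_distrib_right mult.assoc sc_left_comm[of x])

lemma ev_rels:
  assumes "p \<in> yh_rels d q N"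
  shows "ev h p = 0"
proof -
  note s = ev_minus ev_mult ev_add ev_const ev_1 ev_power ev_var h_simps
  consider i j where "p = fg i * fg j * fg i - fg j * fg i * fg j" "1 \<le> i" "i < N" "1 \<le> j" "j < N" "\<bar>int i - int j\<bar> = 1"
    | i j where "p = fg i * fg j - fg j * fg i" "1 \<le> i" "i < N" "1 \<le> j" "j < N" "\<bar>int i - int j\<bar> > 1"
    | i j where "p = ft i * ft j - ft j * ft i" "1 \<le> i" "i \<le> N" "1 \<le> j" "j \<le> N"
    | i j where "p = ft j * fg i - fg i * ft (transpose i (i + 1) j)" "1 \<le> i" "i < N" "1 \<le> j" "j \<le> N"
    | j where "p = ft j ^ d - 1" "1 \<le> j" "j \<le> N"
    | i where "p = fg i ^ 2 - (1 + free_const (q - inverse q) * (fe d i * fg i))" "1 \<le> i" "i < N"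
    using assms unfolding yh_rels_def by blast
  thus ?thesis
  proof cases
    case 1
    hence "j = i + 1 \<or> i = j + 1" by linarith
    thus ?thesis using braid[of i] braid[of j] 1 by (auto simp: s)
  next
    case 2
    hence "i + 1 < j \<or> j + 1 < i" by linarith
    thus ?thesis using far[of i j] far[of j i] 2 by (auto simp: s)
  next
    case 3
    have "P j \<chi> * t i = t i * P j \<chi>" if "\<chi> < d" for \<chi>
      using t_intertwine[of i i "P j \<chi>"] PP_comm[of i j] 3 that by simp
    thus ?thesis using t_intertwine[of j j "t i"] 3 by (simp add: s)
  next
    case 4
    have "t j * g i = g i * t (transpose i (i + 1) j)"
    proof (rule t_intertwine)
      show "1 \<le> transpose i (i + 1) j" "transpose i (i + 1) j \<le> N" using 4 by (auto simp: transpose_def)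
      show "P j \<chi> * g i = g i * P (transpose i (i + 1) j) \<chi>" if "\<chi> < d" for \<chi>
        using gP[of i \<chi>] gP'[of i \<chi>] gP_far[of i j \<chi>] 4 that by (auto simp: transpose_def)
    qed (use 4 in auto)
    thus ?thesis using 4 by (simp add: s)
  next
    case 5
    have "t j ^ d = (\<Sum>\<chi><d. sc (zeta d ^ (\<chi> * d)) * P j \<chi>)" using spectral_power[OF t_spec] 5 by simp
    also have "\<dots> = 1" using P_sum[of j] 5 zeta_d_mult[OF d_pos] by (simp add: mult.commute[of _ d] sc_1)
    finally show ?thesis using 5 by (simp add: s)
  next
    case 6
    thus ?thesis using gg[of i] ev_fe[of i] by (simp add: s power2_eq_square)
  qed
qed

lemma ev_ideal:
  assumes "p \<in> yh_ideal d q N"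
  shows "ev h p = 0"
proof -
  let ?F = "free_algebra (yh_gens N)"
  let ?K = "{p \<in> carrier ?F. ev h p = 0}"
  interpret R: ring ?F by (rule ring_free_algebra)
  have "ideal ?K ?F"
  proof (rule idealI)
    have "\<ominus>\<^bsub>?F\<^esub> x = - x" if "x \<in> carrier ?F" for x
      using R.minus_equality[of "- x" x] that free_algebra_closed(3)[OF that that] by simp
    hence inv: "inv\<^bsub>add_monoid ?F\<^esub> x = - x" if "x \<in> carrier ?F" for x
      using that by (simp add: a_inv_def)
    have neg: "- x \<in> ?K" if "x \<in> ?K" for x
      using that ev_minus[of h 0 x] by (simp add: ev_0 free_algebra_closed(3)[of x _ x])
    show "subgroup ?K (add_monoid ?F)"
    proof (rule subgroup.intro)
      show "inv\<^bsub>add_monoid ?F\<^esub> x \<in> ?K" if "x \<in> ?K" for x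
        using that inv[of x] neg[of x] by simp
    qed (auto simp: ev_add ev_0 free_algebra_closed)
  qed (auto simp: ring_free_algebra ev_mult free_algebra_closed)
  moreover have "yh_rels d q N \<subseteq> ?K" using yh_rels_subset ev_rels by blast
  ultimately show ?thesis using assms R.genideal_minimal[of ?K "yh_rels d q N"] by (auto simp: yh_ideal_def)
qed

end

lemma yh_model_regular:
  assumes d: "d \<ge> 1" "q \<noteq> 0"
  shows "yh_model endo_sc (opG d q n) (opP d n) n d q (\<lambda>j. \<Sum>\<chi><d. endo_sc (zeta d ^ \<chi>) * opP d n j \<chi>)"
proof -
  interpret L: coloured_hecke endo_sc "opG d q n" "opP d n" n d "q - inverse q"
    by (rule regular_rep[OF d])
  show ?thesis by unfold_locales (auto simp: L.spectral_def L.PP_orth L.P_sum)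
qed

definition regular_ev :: "nat \<Rightarrow> complex \<Rightarrow> nat \<Rightarrow> yh_gen falg \<Rightarrow> endo" where
  "regular_ev d q n = central_scalars.ev endo_sc
     (yh_model.h (opG d q n) (\<lambda>j. \<Sum>\<chi><d. endo_sc (zeta d ^ \<chi>) * opP d n j \<chi>))"

lemma Cor_sum: "(\<And>i. i \<in> I \<Longrightarrow> Cor d q n (f i) (f' i)) \<Longrightarrow> Cor d q n (sum f I) (sum f' I)"
  using Cor_sc[of d q n 0] central_scalars.sc_0[OF central_endo_sc]
  by (induction I rule: infinite_finite_induct) (auto intro: Cor_add)

lemma Cor_ev:
  assumes d: "d \<ge> 1" "q \<noteq> 0" and p: "p \<in> carrier (free_algebra (yh_gens n))"
  shows "Cor d q n (regular_ev d q (Suc n) p) (regular_ev d q n p)"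
proof -
  interpret L: yh_model endo_sc "opG d q n" "opP d n" n d q "\<lambda>j. \<Sum>\<chi><d. endo_sc (zeta d ^ \<chi>) * opP d n j \<chi>"
    by (rule yh_model_regular[OF d])
  interpret L': yh_model endo_sc "opG d q (Suc n)" "opP d (Suc n)" "Suc n" d q "\<lambda>j. \<Sum>\<chi><d. endo_sc (zeta d ^ \<chi>) * opP d (Suc n) j \<chi>"
    by (rule yh_model_regular[OF d])
  have h: "Cor d q n (L'.h x) (L.h x)" if "x \<in> yh_gens n" for x
    using that by (auto simp: yh_gens_def L.h_simps L'.h_simps intro!: Cor_G[OF d] Cor_sum Cor_mult Cor_sc Cor_P[OF d])
  have l: "Cor d q n (prod_list (map L'.h l)) (prod_list (map L.h l))" if "set l \<subseteq> yh_gens n" for l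
    using that Cor_sc[of d q n 1] by (induction l) (auto intro: Cor_mult h simp: L.sc_1)
  show ?thesis
    unfolding regular_ev_def L.ev_def
    by (intro Cor_sum Cor_mult Cor_sc l) (use p in \<open>auto simp: mem_free_algebra\<close>)
qed

section \<open>The functional on the quotient algebras\<close>

lemmas yh_class_mult = ring_hom_mult[OF yh_class_ring_hom, symmetric, unfolded free_algebra_simps]
lemmas yh_class_add = ring_hom_add[OF yh_class_ring_hom, symmetric, unfolded free_algebra_simps]
lemmas yh_class_one = ring_hom_one[OF yh_class_ring_hom, symmetric, unfolded free_algebra_simps]

lemma yh_class_pow:
  assumes "p \<in> carrier (free_algebra (yh_gens n))"
  shows "yh_class d q n p [^]\<^bsub>YH d q n\<^esub> (k::nat) = yh_class d q n (p ^ k)"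
proof -
  interpret R: ring "YH d q n" by (rule ring_YH)
  show ?thesis
    by (induction k) (simp_all add: yh_class_one yh_class_mult assms free_algebra_power power_commutes flip: power_Suc2)
qed

lemma YH_cases:
  assumes "a \<in> carrier (YH d q n)"
  obtains p where "p \<in> carrier (free_algebra (yh_gens n))" "a = yh_class d q n p"
  using assms unfolding carrier_YH by blast

text \<open>For a nonempty \<open>D\<close> below \<open>d\<close> this is the inverse Fourier
  transform of \<open>E_solution d D\<close>; the values of a trace on the powers of
  \<open>t j\<close> force these values on the projections.\<close>

definition weight :: "nat set \<Rightarrow> nat \<Rightarrow> complex" where
  "weight D \<chi> = (if \<chi> \<in> D then 1 / of_nat (card D) else 0)"

lemma weight_sum:
  assumes "D \<subseteq> {..<d}" "D \<noteq> {}"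
  shows "(\<Sum>\<chi><d. f \<chi> * weight D \<chi>) = 1 / of_nat (card D) * (\<Sum>\<chi>\<in>D. f \<chi>)"
proof -
  have "(\<Sum>\<chi><d. f \<chi> * weight D \<chi>) = (\<Sum>\<chi>\<in>D. f \<chi> * weight D \<chi>)"
    using assms by (intro sum.mono_neutral_right) (auto simp: weight_def)
  thus ?thesis by (simp add: weight_def sum_distrib_left)
qed

lemma E_solution_zeta: "E_solution d D k = 1 / of_nat (card D) * (\<Sum>\<chi>\<in>D. zeta d ^ (\<chi> * k))"
  by (auto simp: E_solution_def zeta_pow cis_conv_exp algebra_simps intro!: sum.cong)

text \<open>The value does not depend on the representative chosen, because evaluation sends the
  ideal to 0, see \<open>yh_trace_class\<close>. The value \<open>undefined\<close> outside the
  carrier makes the components extensional.\<close>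

definition yh_trace :: "nat \<Rightarrow> complex \<Rightarrow> nat set \<Rightarrow> nat \<Rightarrow> yh_gen falg set \<Rightarrow> complex poly" where
  "yh_trace d q D n X =
     (if X \<in> carrier (YH d q n)
      then regular_tr d q (weight D) [:0, 1:] n (regular_ev d q n
        (SOME p. p \<in> carrier (free_algebra (yh_gens n)) \<and> X = yh_class d q n p))
      else undefined)"

context
  fixes d :: nat and q :: complex and D :: "nat set"
  assumes d: "d \<ge> 1" "q \<noteq> 0" and D: "D \<subseteq> {..<d}" "D \<noteq> {}"
begin

interpretation L: yh_model endo_sc "opG d q n" "opP d n" n d q "\<lambda>j. \<Sum>\<chi><d. endo_sc (zeta d ^ \<chi>) * opP d n j \<chi>" for n
  by (rule yh_model_regular[OF d])

lemma weight_one: "(\<Sum>\<chi><d. weight D \<chi>) = 1"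
  using weight_sum[OF D, of "\<lambda>_. 1"] D by (auto dest: finite_subset)

interpretation W: weak_trace endo_sc "opG d q n" "opP d n" n d "q - inverse q"
  "regular_tr d q (weight D) [:0, 1:] n" "[:0, 1:]" "weight D" for n
  by (rule weak_trace_regular_tr[OF d weight_one])

private abbreviation "F n \<equiv> carrier (free_algebra (yh_gens n))"
private abbreviation "T \<equiv> yh_trace d q D"
private abbreviation "R n \<equiv> regular_tr d q (weight D) [:0, 1:] n"

private lemma regular_ev_eq: "regular_ev d q n = central_scalars.ev endo_sc (L.h n)"
  by (simp add: regular_ev_def)

lemma yh_trace_class:
  assumes "p \<in> F n"
  shows "T n (yh_class d q n p) = R n (regular_ev d q n p)"
proof -
  define Q where "Q r \<longleftrightarrow> r \<in> F n \<and> yh_class d q n p = yh_class d q n r" for r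
  define r where "r = (SOME r. Q r)"
  have "Q r" unfolding r_def by (rule someI[of Q p]) (simp add: Q_def assms)
  hence r: "r \<in> F n \<and> yh_class d q n p = yh_class d q n r" by (simp only: Q_def)
  have "p - r \<in> yh_ideal d q n"
    by (rule iffD1[OF yh_class_eq_iff[OF assms conjunct1[OF r]] conjunct2[OF r]])
  hence "regular_ev d q n p = regular_ev d q n r"
    using L.ev_ideal[of "p - r" n] by (simp add: regular_ev_eq L.ev_minus)
  moreover have "yh_class d q n p \<in> carrier (YH d q n)" using assms by (auto simp: carrier_YH)
  ultimately show ?thesis by (simp add: yh_trace_def r_def Q_def)
qed

lemma R_Suc: "p \<in> F n \<Longrightarrow> R (Suc n) (regular_ev d q (Suc n) p) = R n (regular_ev d q n p)"
  using regular_tr_Cor[OF Cor_ev[OF d] weight_one] by blast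

lemma free_algebra_Suc: "p \<in> F n \<Longrightarrow> p \<in> F (Suc n)"
  using yh_gens_mono by blast

lemma yh_trace_cyc:
  assumes "a \<in> carrier (YH d q n)" "b \<in> carrier (YH d q n)"
  shows "T n (a \<otimes>\<^bsub>YH d q n\<^esub> b) = T n (b \<otimes>\<^bsub>YH d q n\<^esub> a)"
proof -
  obtain p r where p: "p \<in> F n" "a = yh_class d q n p" and r: "r \<in> F n" "b = yh_class d q n r"
    using assms by (metis YH_cases)
  have "R n (regular_ev d q n p * regular_ev d q n r) = R n (regular_ev d q n r * regular_ev d q n p)"
    using p r unfolding regular_ev_eq by (intro W.tr_cyc[of n] L.ev_A) auto
  thus ?thesis using p r by (simp add: yh_class_mult yh_trace_class free_algebra_closed regular_ev_eq L.ev_mult)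
qed

lemma linear_yh_trace: "linear_on_union d q (\<lambda>n. carrier (YH d q n)) T"
  unfolding linear_on_union_def
proof (intro conjI allI ballI)
  fix n show "T n \<in> extensional (carrier (YH d q n))"
    by (auto simp: extensional_def yh_trace_def)
next
  fix n a b assume "a \<in> carrier (YH d q n)" "b \<in> carrier (YH d q n)"
  then obtain p r where "p \<in> F n" "a = yh_class d q n p" "r \<in> F n" "b = yh_class d q n r"
    by (metis YH_cases)
  thus "T n (a \<oplus>\<^bsub>YH d q n\<^esub> b) = T n a + T n b"
    by (simp add: yh_class_add yh_trace_class free_algebra_closed regular_ev_eq L.ev_add W.tr_add)
next
  fix n c a assume "a \<in> carrier (YH d q n)"
  then obtain p where "p \<in> F n" "a = yh_class d q n p" by (metis YH_cases)
  thus "T n (yh_scalar d q n c \<otimes>\<^bsub>YH d q n\<^esub> a) = Polynomial.smult c (T n a)"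
    by (simp add: yh_scalar_def yh_class_mult yh_trace_class free_algebra_closed regular_ev_eq L.ev_mult L.ev_const W.tr_sc)
next
  fix n a assume "a \<in> carrier (YH d q n)"
  then obtain p where "p \<in> F n" "a = yh_class d q n p" by (metis YH_cases)
  thus "T (Suc n) (yh_incl d q n a) = T n a"
    by (simp add: yh_incl_class yh_trace_class free_algebra_Suc R_Suc)
qed

lemma yh_trace_one: "T n \<one>\<^bsub>YH d q n\<^esub> = 1"
proof (induction n)
  case 0
  show ?case
    by (simp add: yh_class_one yh_trace_class regular_ev_eq L.ev_1 regular_tr_def vac.simps app_simps one_pCons)
next
  case (Suc n)
  thus ?case using R_Suc[of 1 n] by (simp add: yh_class_one yh_trace_class)
qed

lemma yh_trace_g:
  assumes "n \<ge> 1" "a \<in> carrier (YH d q n)"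
  shows "T (Suc n) (yh_incl d q n a \<otimes>\<^bsub>YH d q (Suc n)\<^esub> yh_g d q (Suc n) n) = [:0, 1:] * T n a"
proof -
  obtain p where p: "p \<in> F n" "a = yh_class d q n p" using assms by (metis YH_cases)
  have "R (Suc n) (regular_ev d q (Suc n) p * opG d q (Suc n) n * 1) = [:0, 1:] * R (Suc n) (regular_ev d q (Suc n) p * 1)"
    using assms p unfolding regular_ev_eq by (intro W.tr_g L.ev_A free_algebra_Suc L.A_1) auto
  thus ?thesis using p assms
    by (simp add: yh_g_def yh_incl_class yh_class_mult yh_trace_class free_algebra_closed free_algebra_Suc Gg_mem regular_ev_eq L.ev_mult
        L.ev_var L.h_simps R_Suc[unfolded regular_ev_eq])
qed

lemma yh_trace_t:
  assumes "a \<in> carrier (YH d q n)"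
  shows "T (Suc n) (yh_incl d q n a \<otimes>\<^bsub>YH d q (Suc n)\<^esub> (yh_t d q (Suc n) (Suc n) [^]\<^bsub>YH d q (Suc n)\<^esub> (k::nat))) =
    Polynomial.smult (E_solution d D k) (T n a)"
proof -
  obtain p where p: "p \<in> F n" "a = yh_class d q n p" using assms by (metis YH_cases)
  let ?x = "regular_ev d q (Suc n) p"
  have x: "?x \<in> L.A (Suc n) n" unfolding regular_ev_eq using p by (intro L.ev_A) auto
  have "R (Suc n) (?x * (\<Sum>\<chi><d. endo_sc (zeta d ^ (\<chi> * k)) * opP d (Suc n) (Suc n) \<chi>)) =
     (\<Sum>\<chi><d. Polynomial.smult (zeta d ^ (\<chi> * k)) (R (Suc n) (?x * opP d (Suc n) (Suc n) \<chi>)))"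
    by (simp add: sum_distrib_left W.tr_sum L.sc_left_comm[of "regular_ev d q (Suc n) p"] W.tr_sc)
  also have "\<dots> = (\<Sum>\<chi><d. Polynomial.smult (zeta d ^ (\<chi> * k) * weight D \<chi>) (R n (regular_ev d q n p)))"
    using W.tr_P1[OF _ x] p by (intro sum.cong) (auto simp: R_Suc)
  also have "\<dots> = Polynomial.smult (\<Sum>\<chi><d. zeta d ^ (\<chi> * k) * weight D \<chi>) (R n (regular_ev d q n p))"
    by (simp add: smult_sum)
  also have "(\<Sum>\<chi><d. zeta d ^ (\<chi> * k) * weight D \<chi>) = E_solution d D k"
    by (simp add: weight_sum[OF D] E_solution_zeta)
  finally show ?thesis using p
    by (simp add: yh_t_def yh_class_pow yh_incl_class yh_class_mult yh_trace_class free_algebra_closed free_algebra_power free_algebra_Suc Gt_mem regular_ev_eq L.ev_mult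
        L.ev_t_power)
qed

lemma is_specialized_yh_trace: "is_specialized_trace d q D T"
  unfolding is_specialized_trace_def
  using linear_yh_trace yh_trace_cyc yh_trace_one yh_trace_g yh_trace_t by blast

lemma yh_trace_e:
  assumes "n \<ge> 1" "a \<in> carrier (YH d q n)"
  shows "T (Suc n) (yh_incl d q n a \<otimes>\<^bsub>YH d q (Suc n)\<^esub> yh_e d q (Suc n) n) = Polynomial.smult (1 / of_nat (card D)) (T n a)"
    "T (Suc n) (yh_incl d q n a \<otimes>\<^bsub>YH d q (Suc n)\<^esub> yh_e d q (Suc n) n
        \<otimes>\<^bsub>YH d q (Suc n)\<^esub> yh_g d q (Suc n) n) = [:0, 1:] * T n a"
proof -
  obtain p where p: "p \<in> F n" "a = yh_class d q n p" using assms by (metis YH_cases)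
  let ?x = "regular_ev d q (Suc n) p"
  have x: "?x \<in> L.A (Suc n) n" unfolding regular_ev_eq using p by (intro L.ev_A) auto
  have w: "weight D \<chi> = 0 \<or> weight D \<chi> = 1 / of_nat (card D)" for \<chi> by (auto simp: weight_def)
  have f: "fe d n \<in> F (Suc n)" using assms by (intro fe_mem) auto
  note s = yh_e_def yh_g_def yh_incl_class yh_class_mult yh_trace_class free_algebra_closed free_algebra_Suc Gg_mem f
    regular_ev_eq L.ev_mult L.ev_var L.h_simps L.ev_fe R_Suc[unfolded regular_ev_eq]
  show "T (Suc n) (yh_incl d q n a \<otimes>\<^bsub>YH d q (Suc n)\<^esub> yh_e d q (Suc n) n) = Polynomial.smult (1 / of_nat (card D)) (T n a)"
    using W.tr_E[of n "Suc n" ?x, OF assms(1) _ x w] p assms by (simp add: s)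
  show "T (Suc n) (yh_incl d q n a \<otimes>\<^bsub>YH d q (Suc n)\<^esub> yh_e d q (Suc n) n
        \<otimes>\<^bsub>YH d q (Suc n)\<^esub> yh_g d q (Suc n) n) = [:0, 1:] * T n a"
    using W.tr_Eg[of n "Suc n" ?x, OF assms(1) _ x] p assms by (simp add: s)
qed

text \<open>Level \<open>i + 1\<close> is the rule of \<open>yh_trace_e\<close> for the element 1;
  compatibility with the inclusions carries the value to all higher levels.\<close>

lemma yh_trace_e_const:
  assumes "1 \<le> i"
  shows "i < n \<Longrightarrow> T n (yh_e d q n i) = [:1 / of_nat (card D):]"
proof (induction n)
  case (Suc n)
  interpret H: ring "YH d q (Suc n)" by (rule ring_YH)
  show ?case
  proof (cases "i = n")
    case True
    have "T (Suc n) (yh_incl d q n \<one>\<^bsub>YH d q n\<^esub> \<otimes>\<^bsub>YH d q (Suc n)\<^esub> yh_e d q (Suc n) n) = Polynomial.smult (1 / of_nat (card D)) 1"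
      using yh_trace_e(1)[of n "\<one>\<^bsub>YH d q n\<^esub>"] assms True yh_trace_one[of n] ring.ring_simprules(6)[OF ring_YH] by simp
    moreover have "yh_e d q (Suc n) n \<in> carrier (YH d q (Suc n))"
      using fe_mem[of n "Suc n" d] assms True by (auto simp: yh_e_def carrier_YH)
    ultimately show ?thesis using True ring_hom_one[OF yh_incl_ring_hom[of d q n]] by (simp add: one_pCons)
  next
    case False
    hence "i < n" using Suc by simp
    thus ?thesis using Suc R_Suc[of "fe d i" n] fe_mem[OF assms, of n d] free_algebra_Suc by (simp add: yh_e_def yh_trace_class)
  qed
qed simp

end


section \<open>Uniqueness\<close>

text \<open>The locale \<^locale>\<open>coloured_hecke\<close> needs an ambient type of class \<^class>\<open>ring\<close>, but types cannot
  depend on \<open>d\<close>, \<open>q\<close>, \<open>n\<close>. The product of all the algebras \<open>YH d q n\<close> is such a type.\<close>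

abbreviation YHp :: "nat \<times> complex \<times> nat \<Rightarrow> yh_gen falg set ring" where
  "YHp p \<equiv> YH (fst p) (fst (snd p)) (snd (snd p))"

lemma ring_YHp: "ring (YHp p)" by (rule ring_YH)

typedef yh_prod = "{f :: nat \<times> complex \<times> nat \<Rightarrow> yh_gen falg set. \<forall>p. f p \<in> carrier (YHp p)}"
  morphisms comp Abs_yh_prod
  using ring.ring_simprules(2)[OF ring_YHp] by (intro exI[of _ "\<lambda>p. \<zero>\<^bsub>YHp p\<^esub>"]) blast

setup_lifting type_definition_yh_prod

instantiation yh_prod :: "{ring, monoid_mult}"
begin
lift_definition zero_yh_prod :: yh_prod is "\<lambda>p. \<zero>\<^bsub>YHp p\<^esub>"
  by (rule ring.ring_simprules(2)[OF ring_YHp])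
lift_definition one_yh_prod :: yh_prod is "\<lambda>p. \<one>\<^bsub>YHp p\<^esub>"
  by (rule ring.ring_simprules(6)[OF ring_YHp])
lift_definition plus_yh_prod :: "yh_prod \<Rightarrow> yh_prod \<Rightarrow> yh_prod" is "\<lambda>f h p. f p \<oplus>\<^bsub>YHp p\<^esub> h p"
  by (simp add: ring.ring_simprules(1)[OF ring_YHp])
lift_definition uminus_yh_prod :: "yh_prod \<Rightarrow> yh_prod" is "\<lambda>f p. \<ominus>\<^bsub>YHp p\<^esub> f p"
  by (simp add: ring.ring_simprules(3)[OF ring_YHp])
lift_definition minus_yh_prod :: "yh_prod \<Rightarrow> yh_prod \<Rightarrow> yh_prod" is "\<lambda>f h p. f p \<ominus>\<^bsub>YHp p\<^esub> h p"
  by (simp add: ring.ring_simprules(4)[OF ring_YHp])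
lift_definition times_yh_prod :: "yh_prod \<Rightarrow> yh_prod \<Rightarrow> yh_prod" is "\<lambda>f h p. f p \<otimes>\<^bsub>YHp p\<^esub> h p"
  by (simp add: ring.ring_simprules(5)[OF ring_YHp])
instance
proof
  fix a b c :: yh_prod
  show "a * b * c = a * (b * c)"
    by transfer (rule ext, rule ring.ring_simprules(11)[OF ring_YHp], blast+)
  show "a + b + c = a + (b + c)"
    by transfer (rule ext, rule ring.ring_simprules(7)[OF ring_YHp], blast+)
  show "a + b = b + a"
    by transfer (rule ext, rule ring.ring_simprules(10)[OF ring_YHp], blast+)
  show "0 + a = a"
    by transfer (rule ext, rule ring.ring_simprules(8)[OF ring_YHp], blast+)
  show "- a + a = 0"
    by transfer (rule ext, rule ring.ring_simprules(9)[OF ring_YHp], blast+)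
  show "a - b = a + - b"
    by transfer (simp add: a_minus_def)
  show "(a + b) * c = a * c + b * c"
    by transfer (rule ext, rule ring.ring_simprules(13)[OF ring_YHp], blast+)
  show "a * (b + c) = a * b + a * c"
    by transfer (rule ext, rule ring.ring_simprules(23)[OF ring_YHp], blast+)
  show "1 * a = a"
    by transfer (rule ext, rule ring.ring_simprules(12)[OF ring_YHp], blast+)
  show "a * 1 = a"
    by transfer (rule ext, rule monoid.r_one[OF ring.is_monoid[OF ring_YHp]], blast+)
qed
end

lemma comp_simps: "comp (x + y) p = comp x p \<oplus>\<^bsub>YHp p\<^esub> comp y p" "comp (x * y) p = comp x p \<otimes>\<^bsub>YHp p\<^esub> comp y p"
  "comp 1 p = \<one>\<^bsub>YHp p\<^esub>" "comp 0 p = \<zero>\<^bsub>YHp p\<^esub>"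
  by (transfer; simp)+

lemma comp_mem: "comp x p \<in> carrier (YHp p)"
  by transfer blast

abbreviation Fp :: "nat \<times> complex \<times> nat \<Rightarrow> yh_gen falg set" where
  "Fp p \<equiv> carrier (free_algebra (yh_gens (snd (snd p))))"

abbreviation class_p :: "nat \<times> complex \<times> nat \<Rightarrow> yh_gen falg \<Rightarrow> yh_gen falg set" where
  "class_p p \<equiv> yh_class (fst p) (fst (snd p)) (snd (snd p))"

definition fam :: "(nat \<times> complex \<times> nat \<Rightarrow> yh_gen falg) \<Rightarrow> yh_prod" where
  "fam f = Abs_yh_prod (\<lambda>p. class_p p (f p))"

lemma comp_fam: "(\<And>p. f p \<in> Fp p) \<Longrightarrow> comp (fam f) p = class_p p (f p)"
  unfolding fam_def by (subst Abs_yh_prod_inverse) (auto simp: carrier_YH)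

lemma yh_prod_eqI: "(\<And>p. comp x p = comp y p) \<Longrightarrow> x = y"
  by (metis comp_inject ext)

lemma fam_mult: "(\<And>p. f p \<in> Fp p) \<Longrightarrow> (\<And>p. h p \<in> Fp p) \<Longrightarrow> fam f * fam h = fam (\<lambda>p. f p * h p)"
  by (rule yh_prod_eqI) (simp add: comp_simps comp_fam free_algebra_closed yh_class_mult)

lemma fam_add: "(\<And>p. f p \<in> Fp p) \<Longrightarrow> (\<And>p. h p \<in> Fp p) \<Longrightarrow> fam f + fam h = fam (\<lambda>p. f p + h p)"
  by (rule yh_prod_eqI) (simp add: comp_simps comp_fam free_algebra_closed yh_class_add)

lemma fam_one: "1 = fam (\<lambda>p. 1)"
  by (rule yh_prod_eqI) (simp add: comp_simps comp_fam yh_class_one)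

lemma fam_zero: "0 = fam (\<lambda>p. 0)"
  using ring_hom_zero[OF yh_class_ring_hom ring_free_algebra ring_YH]
  by (intro yh_prod_eqI) (simp add: comp_simps comp_fam)

lemma fam_power: "(\<And>p. f p \<in> Fp p) \<Longrightarrow> fam f ^ k = fam (\<lambda>p. f p ^ k)"
  by (induction k) (simp_all add: fam_one fam_mult free_algebra_power)

lemma fam_sum: "(\<And>i p. i \<in> I \<Longrightarrow> f i p \<in> Fp p) \<Longrightarrow> (\<Sum>i\<in>I. fam (f i)) = fam (\<lambda>p. \<Sum>i\<in>I. f i p)"
  by (induction I rule: infinite_finite_induct) (simp_all add: fam_zero fam_add free_algebra_sum)

lemma fam_eqI:
  assumes "\<And>p. f p \<in> Fp p" "\<And>p. h p \<in> Fp p"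
    "\<And>p. f p - h p \<in> yh_ideal (fst p) (fst (snd p)) (snd (snd p))"
  shows "fam f = fam h"
  using assms by (intro yh_prod_eqI) (simp add: comp_fam yh_class_eq_iff)

definition fam_sc :: "complex \<Rightarrow> yh_prod" where "fam_sc a = fam (\<lambda>p. free_const a)"

lemma free_const_add: "free_const (a + b) = free_const a + free_const b"
  by (simp add: free_const_def single_add)

lemma comp_sc: "comp (fam_sc a) p = yh_scalar (fst p) (fst (snd p)) (snd (snd p)) a"
  by (simp add: fam_sc_def comp_fam yh_scalar_def)

interpretation fam: central_scalars fam_sc
proof
  show "fam_sc (a + b) = fam_sc a + fam_sc b" "fam_sc (a * b) = fam_sc a * fam_sc b" for a b
    by (simp_all add: fam_sc_def fam_add fam_mult free_const_add free_const_simps(2))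
  show "fam_sc 1 = 1" by (simp add: fam_sc_def fam_one free_const_simps(3))
  fix x :: yh_prod and a
  show "x * fam_sc a = fam_sc a * x"
  proof (rule yh_prod_eqI)
    fix p
    obtain r where "r \<in> Fp p" "comp x p = class_p p r"
      using comp_mem[of x p] unfolding carrier_YH by blast
    thus "comp (x * fam_sc a) p = comp (fam_sc a * x) p"
      by (simp add: comp_simps comp_sc yh_scalar_def yh_class_mult free_const_simps(1)[of a r])
  qed
qed

context
  fixes d N :: nat and q :: complex
  assumes d: "d \<ge> 1" and q: "q \<noteq> 0"
begin

text \<open>Outside the component under consideration, the generators act by the one-dimensional
  representation \<open>g\<^sub>i = q\<close>, \<open>t\<^sub>j = 1\<close>, so that the defining relations hold in the whole product.\<close>

definition rep_g :: "nat \<Rightarrow> nat \<times> complex \<times> nat \<Rightarrow> yh_gen falg" where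
  "rep_g i p = (if p = (d, q, N) \<and> 1 \<le> i \<and> i < N then fg i else free_const q)"

definition rep_t :: "nat \<Rightarrow> nat \<times> complex \<times> nat \<Rightarrow> yh_gen falg" where
  "rep_t j p = (if p = (d, q, N) \<and> 1 \<le> j \<and> j \<le> N then ft j else 1)"

lemma rep_mem [simp]: "rep_g i p \<in> Fp p" "rep_t j p \<in> Fp p"
  by (auto simp: rep_g_def rep_t_def Gg_mem Gt_mem)

definition fam_g :: "nat \<Rightarrow> yh_prod" where "fam_g i = fam (rep_g i)"
definition fam_t :: "nat \<Rightarrow> yh_prod" where "fam_t j = fam (rep_t j)"

definition fam_P :: "nat \<Rightarrow> nat \<Rightarrow> yh_prod" where "fam_P j = fam.proj d (fam_t j)"

lemma in_ideal: "p \<in> yh_rels d q N \<Longrightarrow> p \<in> yh_ideal d q N"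
  using ring.genideal_self[OF ring_free_algebra yh_rels_subset] by (auto simp: yh_ideal_def)

lemma rel_braid: "1 \<le> i \<Longrightarrow> i + 1 < N \<Longrightarrow> fg i * fg (i + 1) * fg i - fg (i + 1) * fg i * fg (i + 1) \<in> yh_ideal d q N"
  by (rule in_ideal, unfold yh_rels_def, (rule UnI1)+, intro CollectI exI[of _ i] exI[of _ "i + 1"]) simp

lemma rel_far: "1 \<le> i \<Longrightarrow> i + 1 < j \<Longrightarrow> j < N \<Longrightarrow> fg i * fg j - fg j * fg i \<in> yh_ideal d q N"
  by (rule in_ideal, unfold yh_rels_def, rule UnI1, rule UnI1, rule UnI1, rule UnI1, rule UnI2, intro CollectI exI[of _ i] exI[of _ j]) simp

lemma rel_tt: "1 \<le> i \<Longrightarrow> i \<le> N \<Longrightarrow> 1 \<le> j \<Longrightarrow> j \<le> N \<Longrightarrow> ft i * ft j - ft j * ft i \<in> yh_ideal d q N"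
  by (rule in_ideal, unfold yh_rels_def, rule UnI1, rule UnI1, rule UnI1, rule UnI2) blast

lemma rel_tg: "1 \<le> i \<Longrightarrow> i < N \<Longrightarrow> 1 \<le> j \<Longrightarrow> j \<le> N \<Longrightarrow> ft j * fg i - fg i * ft (transpose i (i + 1) j) \<in> yh_ideal d q N"
  by (rule in_ideal, unfold yh_rels_def, rule UnI1, rule UnI1, rule UnI2) blast

lemma rel_td: "1 \<le> j \<Longrightarrow> j \<le> N \<Longrightarrow> ft j ^ d - 1 \<in> yh_ideal d q N"
  by (rule in_ideal, unfold yh_rels_def, rule UnI1, rule UnI2) blast

lemma rel_quad: "1 \<le> i \<Longrightarrow> i < N \<Longrightarrow> fg i ^ 2 - (1 + free_const (q - inverse q) * (fe d i * fg i)) \<in> yh_ideal d q N"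
  by (rule in_ideal, unfold yh_rels_def, rule UnI2) blast

lemma fam_t_d: "1 \<le> j \<Longrightarrow> j \<le> N \<Longrightarrow> fam_t j ^ d = 1"
  unfolding fam_t_def fam_one
  by (simp add: fam_power, rule fam_eqI) (auto simp: rep_t_def free_algebra_power Gt_mem rel_td yh_ideal_closed(1))

lemma fam_tt: "1 \<le> i \<Longrightarrow> i \<le> N \<Longrightarrow> 1 \<le> j \<Longrightarrow> j \<le> N \<Longrightarrow> fam_t i * fam_t j = fam_t j * fam_t i"
  unfolding fam_t_def
  by (simp add: fam_mult, rule fam_eqI) (auto simp: free_algebra_closed rep_t_def rel_tt yh_ideal_closed(1) Gt_mem)

lemma fam_gt: "1 \<le> i \<Longrightarrow> i < N \<Longrightarrow> 1 \<le> j \<Longrightarrow> j \<le> N \<Longrightarrow> fam_t j * fam_g i = fam_g i * fam_t (transpose i (i + 1) j)"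
proof -
  assume a: "1 \<le> i" "i < N" "1 \<le> j" "j \<le> N"
  have "1 \<le> transpose i (i + 1) j" "transpose i (i + 1) j \<le> N" using a by (auto simp: transpose_def)
  thus ?thesis
    using a rel_tg[OF a] unfolding fam_t_def fam_g_def
    by (simp add: fam_mult, intro fam_eqI) (auto simp: free_algebra_closed rep_t_def rep_g_def yh_ideal_closed(1) Gt_mem Gg_mem)
qed

lemma fam_braid: "1 \<le> i \<Longrightarrow> i + 1 < N \<Longrightarrow> fam_g i * fam_g (i + 1) * fam_g i = fam_g (i + 1) * fam_g i * fam_g (i + 1)"
  using rel_braid[of i] unfolding fam_g_def
  by (simp add: fam_mult free_algebra_closed, intro fam_eqI) (auto simp: free_algebra_closed rep_g_def yh_ideal_closed(1) Gg_mem)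

lemma fam_far: "1 \<le> i \<Longrightarrow> i + 1 < j \<Longrightarrow> j < N \<Longrightarrow> fam_g i * fam_g j = fam_g j * fam_g i"
  using rel_far[of i j] unfolding fam_g_def
  by (simp add: fam_mult free_algebra_closed, intro fam_eqI) (auto simp: free_algebra_closed rep_g_def yh_ideal_closed(1) Gg_mem)

lemma fam_quad:
  assumes "1 \<le> i" "i < N"
  shows "fam_g i * fam_g i = 1 + fam_sc (q - inverse q) *
    (fam_sc (1 / of_nat d) * (\<Sum>s<d. fam_t i ^ s * fam_t (Suc i) ^ (d - s)) * fam_g i)"
proof -
  let ?e = "\<lambda>p. free_const (1 / of_nat d) * (\<Sum>s<d. rep_t i p ^ s * rep_t (Suc i) p ^ (d - s))"
  let ?r = "\<lambda>p. 1 + free_const (q - inverse q) * (?e p * rep_g i p)"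
  note cl = free_algebra_closed free_algebra_sum free_algebra_power free_algebra_consts rep_mem
  have e: "fam_sc (1 / of_nat d) * (\<Sum>s<d. fam_t i ^ s * fam_t (Suc i) ^ (d - s)) = fam ?e"
    unfolding fam_sc_def fam_t_def by (simp add: fam_power fam_mult fam_sum cl)
  have "1 + fam_sc (q - inverse q) *
    (fam_sc (1 / of_nat d) * (\<Sum>s<d. fam_t i ^ s * fam_t (Suc i) ^ (d - s)) * fam_g i) = fam ?r"
    unfolding e unfolding fam_sc_def fam_g_def fam_one by (simp add: fam_mult fam_add cl)
  moreover have "fam_g i * fam_g i = fam (\<lambda>p. rep_g i p * rep_g i p)"
    by (simp add: fam_g_def fam_mult)
  moreover have "fam (\<lambda>p. rep_g i p * rep_g i p) = fam ?r"
  proof (rule fam_eqI)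
    fix p
    show "rep_g i p * rep_g i p \<in> Fp p" "?r p \<in> Fp p" by (intro cl)+
    show "rep_g i p * rep_g i p - ?r p \<in> yh_ideal (fst p) (fst (snd p)) (snd (snd p))"
    proof (cases "p = (d, q, N)")
      case True
      thus ?thesis using rel_quad[OF assms] assms by (simp add: rep_g_def rep_t_def fe_def power2_eq_square)
    next
      case False
      \<comment> \<open>In the other components all \<open>d\<close> summands of e_i are 1, so e_i
        becomes 1 and the quadratic relation is an identity for \<open>q\<close>.\<close>
      have "free_const (1 / of_nat d) * of_nat d = (1 :: yh_gen falg)"
        using d by (simp add: free_const_simps(4)[of d] free_const_simps(2,3))
      hence e: "?e p = 1" using False by (simp add: rep_t_def)
      have qq: "free_const q * free_const q = 1 + free_const (q - inverse q) * free_const q"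
        using q by (simp add: free_const_simps(2) flip: free_const_simps(3) free_const_add) (simp add: field_simps)
      have g: "rep_g i p = free_const q" using False by (simp add: rep_g_def)
      show ?thesis unfolding e g mult_1_left qq by (simp add: yh_ideal_closed(1))
    qed
  qed
  ultimately show ?thesis by simp
qed

lemma spectral_fam: "1 \<le> j \<Longrightarrow> j \<le> N \<Longrightarrow> fam.spectral d (fam_t j) (fam_P j)"
  unfolding fam_P_def using fam.spectral_proj[OF fam_t_d d] .

text \<open>Each projection is a polynomial in its \<open>fam_t j\<close>, so by
  \<open>proj_comm\<close> every intertwining relation for the t_j passes to the projections; the
  quadratic relation is translated by \<open>spectral_e\<close>.\<close>

lemma yh_model_fam: "yh_model fam_sc fam_g fam_P N d q fam_t"
proof unfold_locales
  fix i j \<chi> \<psi> assume a: "1 \<le> i" "i \<le> N" "1 \<le> j" "j \<le> N" 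
  have "fam_t j * fam_P i \<chi> = fam_P i \<chi> * fam_t j" 
    unfolding fam_P_def using fam_tt a by (intro fam.proj_comm) auto
  thus "fam_P i \<chi> * fam_P j \<psi> = fam_P j \<psi> * fam_P i \<chi>"
    unfolding fam_P_def[of j] by (intro fam.proj_comm) simp
next
  fix i assume i: "1 \<le> i" "i < N"
  have t: "fam_g i * fam_t (transpose i (i + 1) j) = fam_t j * fam_g i" if "1 \<le> j" "j \<le> N" for j
    using fam_gt[OF i that] by simp
  show "fam_g i * fam_P i \<chi> = fam_P (i + 1) \<chi> * fam_g i" for \<chi>
    unfolding fam_P_def using t[of "i + 1"] i by (intro fam.proj_comm) simp
  show "fam_g i * fam_P (i + 1) \<chi> = fam_P i \<chi> * fam_g i" for \<chi>
    unfolding fam_P_def using t[of i] i by (intro fam.proj_comm) simp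
  show "fam_g i * fam_P j \<chi> = fam_P j \<chi> * fam_g i" if "1 \<le> j" "j \<le> N" "j \<noteq> i" "j \<noteq> i + 1" for j \<chi>
    unfolding fam_P_def using t[of j] that by (intro fam.proj_comm) (simp add: transpose_def)
  show "fam_g i * fam_g i = 1 + fam_sc (q - inverse q) * ((\<Sum>\<chi><d. fam_P i \<chi> * fam_P (i + 1) \<chi>) * fam_g i)"
    using fam_quad[OF i] fam.spectral_e[OF spectral_fam[of i] spectral_fam[of "Suc i"] d] i by simp
qed (use d fam_braid fam_far spectral_fam in \<open>auto simp: fam.spectral_def\<close>)

end

lemma linear_on_unionD:
  assumes "linear_on_union d q A \<tau>"
  shows "a \<in> A n \<Longrightarrow> b \<in> A n \<Longrightarrow> \<tau> n (a \<oplus>\<^bsub>YH d q n\<^esub> b) = \<tau> n a + \<tau> n b"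
    and "a \<in> A n \<Longrightarrow> \<tau> n (yh_scalar d q n s \<otimes>\<^bsub>YH d q n\<^esub> a) = Polynomial.smult s (\<tau> n a)"
    and "a \<in> A n \<Longrightarrow> \<tau> (Suc n) (yh_incl d q n a) = \<tau> n a"
    and "\<tau> n \<in> extensional (A n)"
  using assms unfolding linear_on_union_def by blast+

lemma comp_pow: "comp (x ^ k) p = comp x p [^]\<^bsub>YHp p\<^esub> k"
proof -
  interpret R: ring "YHp p" by (rule ring_YHp)
  show ?thesis by (induction k) (simp_all add: comp_simps power_Suc2 del: power_Suc)
qed

text \<open>There are no generators at level 0, so only the empty word occurs. The product with the
  unit is the form in which linearity and the value of the trace on 1 apply.\<close>

lemma YH0_scalar:
  assumes "x \<in> carrier (YH d q 0)"
  obtains s where "x = yh_scalar d q 0 s \<otimes>\<^bsub>YH d q 0\<^esub> \<one>\<^bsub>YH d q 0\<^esub>"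
proof -
  obtain p where p: "p \<in> carrier (free_algebra (yh_gens 0))" "x = yh_class d q 0 p"
    using assms unfolding carrier_YH by blast
  have "w = 0" if "w \<in> Poly_Mapping.keys p" for w
    using p(1) that by (cases w) (auto simp: mem_free_algebra yh_gens_def zero_fmon_def)
  hence "p = free_const (Poly_Mapping.lookup p 0)"
    by (intro poly_mapping_eqI) (auto simp: free_const_def lookup_single when_def in_keys_iff)
  hence "x = yh_class d q 0 (free_const (Poly_Mapping.lookup p 0) * 1)" using p(2) by simp
  thus ?thesis using that[of "Poly_Mapping.lookup p 0"]
    by (simp add: yh_scalar_def yh_class_mult yh_class_one)
qed

section \<open>Two traces that agree on level \<open>n\<close> agree on level
  \<open>n + 1\<close>\<close>

context
  fixes d n :: nat and q :: complex
  assumes d: "d \<ge> 1" and q: "q \<noteq> 0"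
begin

private abbreviation "pp \<equiv> (d, q, Suc n)"
private abbreviation "g \<equiv> fam_g d (Suc n) q"
private abbreviation "t \<equiv> fam_t d (Suc n) q"
private abbreviation "P \<equiv> fam_P d (Suc n) q"

interpretation M: yh_model fam_sc g P "Suc n" d q t
  by (rule yh_model_fam[OF d q])

interpretation Y: ring "YH d q n" by (rule ring_YH)
interpretation Y': ring "YH d q (Suc n)" by (rule ring_YH)

lemma comp_g: "1 \<le> i \<Longrightarrow> i < Suc n \<Longrightarrow> comp (g i) pp = yh_g d q (Suc n) i"
  using comp_fam[of "rep_g d (Suc n) q i" pp, OF rep_mem(1)[OF d q]] by (simp add: fam_g_def[OF d q] rep_g_def[OF d q] yh_g_def)

lemma comp_t: "1 \<le> i \<Longrightarrow> i \<le> Suc n \<Longrightarrow> comp (t i) pp = yh_t d q (Suc n) i"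
  using comp_fam[of "rep_t d (Suc n) q i" pp, OF rep_mem(2)[OF d q]] by (simp add: fam_t_def[OF d q] rep_t_def[OF d q] yh_t_def)

lemma comp_sc': "comp (fam_sc a) pp = yh_scalar d q (Suc n) a"
  by (simp add: comp_sc)

lemma comp_mem': "comp x pp \<in> carrier (YH d q (Suc n))"
  using comp_mem[of x pp] by simp

lemma comp_word:
  "set l \<subseteq> yh_gens (Suc n) \<Longrightarrow> comp (prod_list (map M.h l)) pp = yh_class d q (Suc n) (Poly_Mapping.single (FMon l) 1)"
proof (induction l)
  case Nil
  thus ?case by (simp add: comp_simps yh_class_one flip: zero_fmon_def)
next
  case (Cons x l)
  have "Poly_Mapping.single (FMon (x # l)) 1 = free_var x * Poly_Mapping.single (FMon l) (1 :: complex)"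
    by (simp add: free_var_def mult_single plus_fmon_def)
  moreover have "comp (M.h x) pp = yh_class d q (Suc n) (free_var x)"
    using Cons.prems by (auto simp: yh_gens_def M.h_simps comp_g comp_t yh_g_def yh_t_def)
  moreover have "Poly_Mapping.single (FMon l) 1 \<in> carrier (free_algebra (yh_gens (Suc n)))"
    using Cons.prems by (simp add: mem_free_algebra)
  ultimately show ?case using Cons by (simp add: comp_simps yh_class_mult)
qed

text \<open>Evaluation in the product, followed by the component at \<open>pp\<close>, is the
  quotient map of level \<open>n + 1\<close>. So the spanning results for \<open>M\<close> descend
  to this level, and all its elements are reached.\<close>

lemma comp_ev:
  assumes p: "p \<in> carrier (free_algebra (yh_gens (Suc n)))"
  shows "comp (fam.ev M.h p) pp = yh_class d q (Suc n) p"
proof -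
  have l: "set (letters w) \<subseteq> yh_gens (Suc n)" if "w \<in> Poly_Mapping.keys p" for w
    using that p by (auto simp: mem_free_algebra)
  have m: "Poly_Mapping.single w a \<in> carrier (free_algebra (yh_gens (Suc n)))" if "w \<in> Poly_Mapping.keys p" for w a
    using l[OF that] by (auto simp: mem_free_algebra)
  have s: "comp (fam_sc a * prod_list (map M.h (letters w))) pp = yh_class d q (Suc n) (Poly_Mapping.single w a)"
    if "w \<in> Poly_Mapping.keys p" for w a
  proof -
    have "Poly_Mapping.single w a = free_const a * Poly_Mapping.single w 1"
      by (simp add: free_const_def mult_single)
    thus ?thesis using comp_word[OF l[OF that]] m[OF that, of 1]
      by (simp add: comp_simps comp_sc' yh_scalar_def yh_class_mult)
  qed
  have "comp (\<Sum>w\<in>I. fam_sc (Poly_Mapping.lookup p w) * prod_list (map M.h (letters w))) pp =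
      yh_class d q (Suc n) (\<Sum>w\<in>I. Poly_Mapping.single w (Poly_Mapping.lookup p w))"
    if "I \<subseteq> Poly_Mapping.keys p" for I
    using finite_subset[OF that finite_keys] that
  proof (induction I rule: finite_induct)
    case empty
    thus ?case using fam_zero comp_fam[of "\<lambda>p. 0" pp] by simp
  next
    case (insert w I)
    have "(\<Sum>w\<in>I. Poly_Mapping.single w (Poly_Mapping.lookup p w)) \<in> carrier (free_algebra (yh_gens (Suc n)))"
      using insert m by (intro free_algebra_sum) auto
    thus ?case using insert s m by (simp add: comp_simps yh_class_add)
  qed
  from this[of "Poly_Mapping.keys p"] show ?thesis
    using fam.poly_mapping_decomp[of p] by (simp add: fam.ev_def)
qed

lemma comp_E: "1 \<le> i \<Longrightarrow> i < Suc n \<Longrightarrow> comp (M.E i (Suc i)) pp = yh_e d q (Suc n) i"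
  using comp_ev[OF fe_mem[of i "Suc n" d]] M.ev_fe[of i] by (simp add: yh_e_def)

lemma A_surj:
  assumes "x \<in> carrier (YH d q (Suc n))"
  obtains X where "X \<in> M.A (Suc n)" "comp X pp = x"
proof -
  obtain p where p: "p \<in> carrier (free_algebra (yh_gens (Suc n)))" "x = yh_class d q (Suc n) p"
    using assms unfolding carrier_YH by blast
  show ?thesis using that[of "fam.ev M.h p"] M.ev_A[OF p(1)] comp_ev[OF p(1)] p(2) by simp
qed

lemma incl_hom: 
  "a \<in> carrier (YH d q n) \<Longrightarrow> b \<in> carrier (YH d q n) \<Longrightarrow>
    yh_incl d q n (a \<oplus>\<^bsub>YH d q n\<^esub> b) = yh_incl d q n a \<oplus>\<^bsub>YH d q (Suc n)\<^esub> yh_incl d q n b"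
  "a \<in> carrier (YH d q n) \<Longrightarrow> b \<in> carrier (YH d q n) \<Longrightarrow>
    yh_incl d q n (a \<otimes>\<^bsub>YH d q n\<^esub> b) = yh_incl d q n a \<otimes>\<^bsub>YH d q (Suc n)\<^esub> yh_incl d q n b"
  by (auto simp: ring_hom_add[OF yh_incl_ring_hom] ring_hom_mult[OF yh_incl_ring_hom])

text \<open>Stands for level \<open>n\<close> inside the product; membership constrains only the
  component at \<open>pp\<close>, the one on which traces are compared.\<close>

definition level_image :: "yh_prod set" where
  "level_image = {X. \<exists>a\<in>carrier (YH d q n). comp X pp = yh_incl d q n a}"

lemma level_image_closed: "x \<in> level_image \<Longrightarrow> y \<in> level_image \<Longrightarrow> x + y \<in> level_image" "x \<in> level_image \<Longrightarrow> y \<in> level_image \<Longrightarrow> x * y \<in> level_image" "fam_sc s \<in> level_image"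
  "1 \<le> i \<Longrightarrow> i < n \<Longrightarrow> g i \<in> level_image" "1 \<le> j \<Longrightarrow> j \<le> n \<Longrightarrow> t j \<in> level_image"
proof -
  show "x \<in> level_image \<Longrightarrow> y \<in> level_image \<Longrightarrow> x + y \<in> level_image" "x \<in> level_image \<Longrightarrow> y \<in> level_image \<Longrightarrow> x * y \<in> level_image"
    by (auto simp: level_image_def comp_simps incl_hom[symmetric])
  show "fam_sc s \<in> level_image"
    by (auto simp: level_image_def comp_sc' yh_scalar_def yh_incl_class carrier_YH intro!: bexI[of _ "free_const s"])
  show "1 \<le> i \<Longrightarrow> i < n \<Longrightarrow> g i \<in> level_image"
    by (auto simp: level_image_def comp_g yh_g_def yh_incl_class carrier_YH Gg_mem intro!: bexI[of _ "fg i"])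
  show "1 \<le> j \<Longrightarrow> j \<le> n \<Longrightarrow> t j \<in> level_image"
    by (auto simp: level_image_def comp_t yh_t_def yh_incl_class carrier_YH Gt_mem intro!: bexI[of _ "ft j"])
qed

lemma level_image_1: "1 \<in> level_image" and level_image_0: "0 \<in> level_image"
  using level_image_closed(3)[of 1] level_image_closed(3)[of 0] by (simp_all add: fam.sc_1 fam.sc_0)

lemma level_image_power: "x \<in> level_image \<Longrightarrow> x ^ k \<in> level_image"
  by (induction k) (auto simp: level_image_1 intro: level_image_closed)

lemma level_image_sum: "(\<And>i. i \<in> I \<Longrightarrow> f i \<in> level_image) \<Longrightarrow> sum f I \<in> level_image"
  by (induction I rule: infinite_finite_induct) (auto simp: level_image_0 intro: level_image_closed)

lemma A_level_image: "x \<in> M.A n \<Longrightarrow> x \<in> level_image"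
proof (induction rule: M.A.induct)
  case (A_P j \<chi>)
  thus ?case unfolding fam_P_def[OF d q] fam.proj_def
    by (intro level_image_closed(2) level_image_closed(3) level_image_sum level_image_power level_image_closed(5)) auto
qed (auto intro: level_image_closed)

text \<open>The difference \<open>\<delta>\<close> of the two traces is linear and symmetric, so it
  suffices that it vanishes on the generators of \<open>Sp n\<close>: the projection
  \<open>P (Suc n) \<chi>\<close> is a combination of powers of \<open>t (Suc n)\<close>, and
  \<open>a * g n * b\<close> may be turned into \<open>b * a * g n\<close>.\<close>

lemma specialized_step:
  assumes \<tau>: "is_specialized_trace d q D \<tau>" and \<tau>': "is_specialized_trace d q D \<tau>'"
    and IH: "\<And>x. x \<in> carrier (YH d q n) \<Longrightarrow> \<tau> n x = \<tau>' n x"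
    and x: "x \<in> carrier (YH d q (Suc n))"
  shows "\<tau> (Suc n) x = \<tau>' (Suc n) x"
proof -
  define \<delta> where "\<delta> X = \<tau> (Suc n) (comp X pp) - \<tau>' (Suc n) (comp X pp)" for X
  have l: "linear_on_union d q (\<lambda>n. carrier (YH d q n)) \<tau>" "linear_on_union d q (\<lambda>n. carrier (YH d q n)) \<tau>'"
    using \<tau> \<tau>' unfolding is_specialized_trace_def by blast+
  note lin = linear_on_unionD[OF l(1)] linear_on_unionD[OF l(2)]
  have add: "\<delta> (X + X') = \<delta> X + \<delta> X'" for X X'
    by (simp add: \<delta>_def comp_simps lin(1,5) comp_mem')
  have sc: "\<delta> (fam_sc s * X) = Polynomial.smult s (\<delta> X)" for X s
    by (simp add: \<delta>_def comp_simps comp_sc' lin(2,6) comp_mem' smult_diff_right)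
  have zero: "\<delta> 0 = 0" using add[of 0 0] by simp
  have sum: "\<delta> (sum f I) = (\<Sum>i\<in>I. \<delta> (f i))" for f and I :: "nat set"
    by (induction I rule: infinite_finite_induct) (auto simp: add zero)
  have cyc: "\<delta> (X * X') = \<delta> (X' * X)" for X X'
    using \<tau> \<tau>' comp_mem'[of X] comp_mem'[of X'] unfolding is_specialized_trace_def
    by (simp add: \<delta>_def comp_simps)
  have level: "\<delta> a = 0" if "a \<in> level_image" for a
    using that IH lin(3,7) by (auto simp: level_image_def \<delta>_def)
  have t: "\<delta> (a * t (Suc n) ^ k) = 0" if a: "a \<in> level_image" and k: "k < d" for a k
  proof (cases "k = 0")
    \<comment> \<open>The rule for powers of t_{n+1} starts at \<open>k = 1\<close>; for
      \<open>k = 0\<close> compatibility with the inclusion takes its place.\<close>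
    case True thus ?thesis using level[OF a] by simp
  next
    case False
    obtain b where b: "b \<in> carrier (YH d q n)" "comp a pp = yh_incl d q n b" using a by (auto simp: level_image_def)
    have e: "\<sigma> (Suc n) (comp (a * t (Suc n) ^ k) pp) = Polynomial.smult (E_solution d D k) (\<sigma> n b)"
      if "is_specialized_trace d q D \<sigma>" for \<sigma>
      using that b False k unfolding is_specialized_trace_def by (simp add: comp_simps comp_pow comp_t)
    show ?thesis using e[OF \<tau>] e[OF \<tau>'] IH[OF b(1)] by (simp add: \<delta>_def)
  qed
  have gz: "\<delta> (a * g n) = 0" if a: "a \<in> level_image" and n: "1 \<le> n" for a
  proof -
    obtain b where b: "b \<in> carrier (YH d q n)" "comp a pp = yh_incl d q n b" using a by (auto simp: level_image_def)
    have e: "\<sigma> (Suc n) (comp (a * g n) pp) = [:0, 1:] * \<sigma> n b"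
      if "is_specialized_trace d q D \<sigma>" for \<sigma>
      using that b n unfolding is_specialized_trace_def by (simp add: comp_simps comp_g)
    show ?thesis using e[OF \<tau>] e[OF \<tau>'] IH[OF b(1)] by (simp add: \<delta>_def)
  qed
  obtain X where X: "X \<in> M.A (Suc n)" "comp X pp = x" using A_surj[OF x] by blast
  have "X \<in> M.Sp n" using M.A_Sp X by simp
  hence "\<delta> X = 0"
  proof (induction rule: M.Sp.induct)
    case (Sp_P a \<chi>)
    have "a * P (Suc n) \<chi> =
        fam_sc (1 / of_nat d) * (\<Sum>s<d. fam_sc (zeta d ^ (\<chi> * (d - s))) * (a * t (Suc n) ^ s))"
      by (simp add: fam_P_def[OF d q] fam.proj_def fam.sc_left_comm[of a] sum_distrib_left)
    thus ?case using t[OF A_level_image[OF Sp_P(1)]] by (simp add: sc sum)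
  next
    case (Sp_g a b)
    have "\<delta> (a * g n * b) = \<delta> (b * a * g n)" using cyc[of "a * g n" b] by (simp add: mult.assoc)
    thus ?case using Sp_g gz[of "b * a"] A_level_image by (simp add: level_image_closed)
  qed (simp add: add)
  thus ?thesis by (simp add: \<delta>_def X)
qed

definition level_image_br :: "yh_prod set" where
  "level_image_br = {X. \<exists>a\<in>YH_br d q n. comp X pp = yh_incl d q n a}"

lemma YH_br_subset: "a \<in> YH_br d q k \<Longrightarrow> a \<in> carrier (YH d q k)"
  using subringE(1)[OF subring_YH_br] by blast

lemma YH_br_scalar: "yh_scalar d q k s \<in> YH_br d q k"
  by (auto simp: YH_br_def intro: generate_ring.incl)

lemma YH_br_g: "1 \<le> i \<Longrightarrow> i < k \<Longrightarrow> yh_g d q k i \<in> YH_br d q k"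
  by (auto simp: YH_br_def intro!: generate_ring.incl)

lemma Br_level_image: "x \<in> M.Br n \<Longrightarrow> x \<in> level_image_br"
proof (induction rule: M.Br.induct)
  case (Br_sc s)
  thus ?case using YH_br_scalar[of n s]
    by (auto simp: level_image_br_def comp_sc' yh_scalar_def yh_incl_class intro!: bexI[of _ "yh_class d q n (free_const s)"])
next
  case (Br_g i)
  thus ?case using YH_br_g[of i n] by (auto simp: level_image_br_def comp_g yh_g_def yh_incl_class intro!: bexI)
next
  case (Br_add x y)
  thus ?case using subringE(7)[OF subring_YH_br] YH_br_subset
    by (auto simp: level_image_br_def comp_simps incl_hom[symmetric])
next
  case (Br_mult x y)
  thus ?case using subringE(6)[OF subring_YH_br] YH_br_subset
    by (auto simp: level_image_br_def comp_simps incl_hom[symmetric])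
qed

lemma comp_Br: "x \<in> M.Br (Suc n) \<Longrightarrow> comp x pp \<in> YH_br d q (Suc n)"
  by (induction rule: M.Br.induct)
    (auto simp: comp_simps comp_sc' comp_g YH_br_scalar YH_br_g subringE(6,7)[OF subring_YH_br])

lemma Br_surj:
  assumes "x \<in> YH_br d q (Suc n)"
  shows "\<exists>X\<in>M.Br (Suc n). comp X pp = x"
  using assms unfolding YH_br_def
proof (induction rule: generate_ring.induct)
  case one
  show ?case by (intro bexI[of _ 1]) (simp_all add: comp_simps)
next
  case (incl x)
  then consider s where "x = yh_scalar d q (Suc n) s" | i where "1 \<le> i" "i < Suc n" "x = yh_g d q (Suc n) i" by auto
  thus ?case
  proof cases
    case 1 thus ?thesis using M.Br_sc comp_sc' by blast
  next
    case 2 thus ?thesis using M.Br_g[of i] comp_g[of i] by auto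
  qed
next
  case (a_inv x)
  then obtain X where X: "X \<in> M.Br (Suc n)" "comp X pp = x" by blast
  have "- X \<in> M.Br (Suc n)" using M.Br_diff[OF M.Br_0 X(1)] by simp
  moreover have "comp (- X) pp = \<ominus>\<^bsub>YH d q (Suc n)\<^esub> x"
    using X(2) by transfer auto
  ultimately show ?case by blast
next
  case (eng_add x y)
  then obtain X Y where "X \<in> M.Br (Suc n)" "comp X pp = x" "Y \<in> M.Br (Suc n)" "comp Y pp = y" by blast
  thus ?case by (intro bexI[of _ "X + Y"]) (auto simp: comp_simps intro: M.Br_add)
next
  case (eng_mult x y)
  then obtain X Y where "X \<in> M.Br (Suc n)" "comp X pp = x" "Y \<in> M.Br (Suc n)" "comp Y pp = y" by blast
  thus ?case by (intro bexI[of _ "X * Y"]) (auto simp: comp_simps intro: M.Br_mult)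
qed

lemma BS_Br: "x \<in> M.BS n \<Longrightarrow> 1 \<le> n \<Longrightarrow> x \<in> M.Br (Suc n)"
proof (induction rule: M.BS.induct)
  case (BS_w w a b)
  have "w \<in> M.Br (Suc n)"
    using BS_w M.F_Br[of n "Suc n"] by (auto intro!: M.Br_g M.Br_mult)
  thus ?case using BS_w M.Br_mono[of _ n "Suc n"] by (intro M.Br_mult) auto
qed (auto intro: M.Br_add)

text \<open>As in \<open>specialized_step\<close>, now on the words of \<open>BS n\<close>: symmetry
  turns \<open>a * w * b\<close> into \<open>b * a * w\<close> with \<open>b * a\<close> of level
  \<open>n\<close>, and each of the four words \<open>w\<close> is governed by one of the
  rules.\<close>

lemma braid_step:
  assumes \<tau>: "is_braid_trace d q m \<tau>" and \<tau>': "is_braid_trace d q m \<tau>'" and n: "1 \<le> n"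
    and IH: "\<And>x. x \<in> YH_br d q n \<Longrightarrow> \<tau> n x = \<tau>' n x"
    and x: "x \<in> YH_br d q (Suc n)"
  shows "\<tau> (Suc n) x = \<tau>' (Suc n) x"
proof -
  define \<delta> where "\<delta> X = \<tau> (Suc n) (comp X pp) - \<tau>' (Suc n) (comp X pp)" for X
  have l: "linear_on_union d q (YH_br d q) \<tau>" "linear_on_union d q (YH_br d q) \<tau>'"
    using \<tau> \<tau>' unfolding is_braid_trace_def by blast+
  note lin = linear_on_unionD[OF l(1)] linear_on_unionD[OF l(2)]
  have add: "\<delta> (X + X') = \<delta> X + \<delta> X'" if "X \<in> M.Br (Suc n)" "X' \<in> M.Br (Suc n)" for X X'
    using that by (simp add: \<delta>_def comp_simps lin(1,5) comp_Br)
  have sc: "\<delta> (fam_sc s * X) = Polynomial.smult s (\<delta> X)" if "X \<in> M.Br (Suc n)" for X s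
    using that by (simp add: \<delta>_def comp_simps comp_sc' lin(2,6) comp_Br smult_diff_right)
  have zero: "\<delta> 0 = 0" using add[of 0 0] by simp
  have cyc: "\<delta> (X * X') = \<delta> (X' * X)" if "X \<in> M.Br (Suc n)" "X' \<in> M.Br (Suc n)" for X X'
    using \<tau> \<tau>' comp_Br[OF that(1)] comp_Br[OF that(2)] unfolding is_braid_trace_def
    by (simp add: \<delta>_def comp_simps)
  have base: "\<delta> a = 0" if "a \<in> M.Br n" for a
    using Br_level_image[OF that] IH lin(3,7) by (auto simp: level_image_br_def \<delta>_def)
  have gz: "\<delta> (a * g n) = 0" if a: "a \<in> M.Br n" for a
  proof -
    obtain b where b: "b \<in> YH_br d q n" "comp a pp = yh_incl d q n b" using Br_level_image[OF a] by (auto simp: level_image_br_def)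
    have e: "\<sigma> (Suc n) (comp (a * g n) pp) = [:0, 1:] * \<sigma> n b"
      if "is_braid_trace d q m \<sigma>" for \<sigma>
      using that b n unfolding is_braid_trace_def by (simp add: comp_simps comp_g)
    show ?thesis using e[OF \<tau>] e[OF \<tau>'] IH[OF b(1)] by (simp add: \<delta>_def)
  qed
  define c where "c = q - inverse q"
  have ez: "\<delta> (a * M.E n (Suc n)) = 0" "\<delta> (a * M.E n (Suc n) * g n) = 0"
    "a * M.E n (Suc n) \<in> M.Br (Suc n)" "a * M.E n (Suc n) * g n \<in> M.Br (Suc n)"
    if a: "a \<in> M.Br n" and c: "c \<noteq> 0" for a
  proof -
    obtain b where b: "b \<in> YH_br d q n" "comp a pp = yh_incl d q n b" using Br_level_image[OF a] by (auto simp: level_image_br_def)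
    \<comment> \<open>The rules for e_n and e_n g_n apply only to elements in the domain of the
      trace. For \<open>c \<noteq> 0\<close> membership follows from that of
      \<open>F n\<close>.\<close>
    have "M.E n (Suc n) = fam_sc (1 / c) * M.F n"
      using c unfolding M.F_def c_def by (simp add: fam.sc_mult_left fam.sc_1)
    also have "\<dots> \<in> M.Br (Suc n)" using n by (intro M.Br_mult M.Br_sc M.F_Br) auto
    finally have E: "M.E n (Suc n) \<in> M.Br (Suc n)" .
    show m: "a * M.E n (Suc n) \<in> M.Br (Suc n)" "a * M.E n (Suc n) * g n \<in> M.Br (Suc n)"
      using n E M.Br_mono[OF a, of "Suc n"] by (auto intro!: M.Br_mult M.Br_g)
    have e: "\<sigma> (Suc n) (comp (a * M.E n (Suc n)) pp) = Polynomial.smult (1 / of_nat m) (\<sigma> n b)"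
      "\<sigma> (Suc n) (comp (a * M.E n (Suc n) * g n) pp) = [:0, 1:] * \<sigma> n b"
      if "is_braid_trace d q m \<sigma>" for \<sigma>
      using that b n comp_Br[OF m(1)] comp_Br[OF m(2)] unfolding is_braid_trace_def Let_def
      by (simp_all add: comp_simps comp_g comp_E)
    show "\<delta> (a * M.E n (Suc n)) = 0" "\<delta> (a * M.E n (Suc n) * g n) = 0"
      using e[OF \<tau>] e[OF \<tau>'] IH[OF b(1)] by (simp_all add: \<delta>_def)
  qed
  \<comment> \<open>Either \<open>c = 0\<close> and the word itself vanishes, or the rules for e_n
    apply; this covers q^2 = 1.\<close>
  have Fz: "\<delta> (a * M.F n) = 0" "\<delta> (a * (M.F n * g n)) = 0" if a: "a \<in> M.Br n" for a
  proof -
    have 1: "a * M.F n = fam_sc c * (a * M.E n (Suc n))"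
      "a * (M.F n * g n) = fam_sc c * (a * M.E n (Suc n) * g n)"
      by (simp_all add: M.F_def c_def fam.sc_left_comm[of a] mult.assoc)
    show "\<delta> (a * M.F n) = 0" "\<delta> (a * (M.F n * g n)) = 0"
      unfolding 1 using ez[OF a] sc zero by (cases "c = 0"; simp add: fam.sc_0)+
  qed
  obtain X where X: "X \<in> M.Br (Suc n)" "comp X pp = x" using Br_surj[OF x] by blast
  have "X \<in> M.BS n" using M.Br_Suc_BS[of n] X n by simp
  hence "\<delta> X = 0"
  proof (induction rule: M.BS.induct)
    case (BS_w w a b)
    have ab: "a \<in> M.Br (Suc n)" "b \<in> M.Br (Suc n)" using BS_w M.Br_mono[of _ n "Suc n"] by auto
    have w: "w \<in> M.Br (Suc n)"
      using BS_w n M.F_Br[of n "Suc n"] by (auto intro!: M.Br_g M.Br_mult)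
    have "\<delta> (a * w * b) = \<delta> (b * a * w)"
      using cyc[of "a * w" b] ab w by (simp add: mult.assoc M.Br_mult)
    also have "\<dots> = 0"
      using BS_w(1) base[of "b * a"] gz[of "b * a"] Fz[of "b * a"] M.Br_mult[OF BS_w(3,2)] by auto
    finally show ?case .
  qed (use BS_Br[OF _ n] in \<open>simp add: add\<close>)
  thus ?thesis by (simp add: \<delta>_def X)
qed

text \<open>Starts the induction for braid traces: \<open>braid_step\<close> requires
  \<open>g n\<close> with \<open>n \<ge> 1\<close>, and level 1 has no braid generator.\<close>

lemma Br_1_scalar: "x \<in> M.Br (Suc 0) \<Longrightarrow> \<exists>s. x = fam_sc s"
proof (induction rule: M.Br.induct)
  case (Br_add x y) thus ?case using fam.sc_add by metis
next
  case (Br_mult x y) thus ?case using fam.sc_mult by metis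
qed auto

lemma YH_br_1: "n = 0 \<Longrightarrow> x \<in> YH_br d q (Suc n) \<Longrightarrow> \<exists>s. x = yh_scalar d q (Suc n) s"
  using Br_surj[of x] Br_1_scalar comp_sc' by force

end

lemma extensional_family_eqI:
  assumes "\<And>n. \<tau> n \<in> extensional (A n)" "\<And>n. \<tau>' n \<in> extensional (A n)"
    "\<And>n x. x \<in> A n \<Longrightarrow> \<tau> n x = \<tau>' n x"
  shows "\<tau> = \<tau>'"
  using assms by (intro ext) (metis extensional_arb)

lemma specialized_trace_unique:
  assumes d: "d \<ge> 1" "q \<noteq> 0" and \<tau>: "is_specialized_trace d q D \<tau>" "is_specialized_trace d q D \<tau>'"
  shows "\<tau> = \<tau>'"
proof -
  have l: "linear_on_union d q (\<lambda>n. carrier (YH d q n)) \<tau>" "linear_on_union d q (\<lambda>n. carrier (YH d q n)) \<tau>'"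
    using \<tau> unfolding is_specialized_trace_def by blast+
  have "\<tau> n x = \<tau>' n x" if "x \<in> carrier (YH d q n)" for n x
    using that
  proof (induction n arbitrary: x)
    case 0
    obtain s where s: "x = yh_scalar d q 0 s \<otimes>\<^bsub>YH d q 0\<^esub> \<one>\<^bsub>YH d q 0\<^esub>" using YH0_scalar[OF 0] .
    have "\<sigma> 0 \<one>\<^bsub>YH d q 0\<^esub> = 1" if "is_specialized_trace d q D \<sigma>" for \<sigma>
      using that unfolding is_specialized_trace_def by blast
    from this[OF \<tau>(1)] this[OF \<tau>(2)] show ?case
      unfolding s using linear_on_unionD(2)[OF l(1)] linear_on_unionD(2)[OF l(2)]
        ring.ring_simprules(6)[OF ring_YH] by simp
  next
    case (Suc n)
    show ?case by (rule specialized_step[OF d \<tau> Suc.IH Suc.prems])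
  qed
  thus ?thesis
    by (intro extensional_family_eqI[of \<tau> "\<lambda>n. carrier (YH d q n)"] linear_on_unionD(4)[OF l(1)] linear_on_unionD(4)[OF l(2)])
qed

lemma braid_trace_unique:
  assumes d: "d \<ge> 1" "q \<noteq> 0" and \<tau>: "is_braid_trace d q m \<tau>" "is_braid_trace d q m \<tau>'"
  shows "\<tau> = \<tau>'"
proof -
  have l: "linear_on_union d q (YH_br d q) \<tau>" "linear_on_union d q (YH_br d q) \<tau>'"
    using \<tau> unfolding is_braid_trace_def by blast+
  have one: "\<sigma> n \<one>\<^bsub>YH d q n\<^esub> = 1" if "is_braid_trace d q m \<sigma>" for \<sigma> n
    using that unfolding is_braid_trace_def by blast
  have scalar: "\<tau> n x = \<tau>' n x" if "x = yh_scalar d q n s \<otimes>\<^bsub>YH d q n\<^esub> \<one>\<^bsub>YH d q n\<^esub>" for n x s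
    unfolding that using linear_on_unionD(2)[OF l(1)] linear_on_unionD(2)[OF l(2)]
      one[OF \<tau>(1)] one[OF \<tau>(2)] subringE(3)[OF subring_YH_br] by simp
  have "\<tau> n x = \<tau>' n x" if "x \<in> YH_br d q n" for n x
    using that
  proof (induction n arbitrary: x)
    case 0
    have "x \<in> carrier (YH d q 0)" using 0 subringE(1)[OF subring_YH_br] by blast
    then obtain s where "x = yh_scalar d q 0 s \<otimes>\<^bsub>YH d q 0\<^esub> \<one>\<^bsub>YH d q 0\<^esub>" by (rule YH0_scalar)
    thus ?case by (rule scalar)
  next
    case (Suc n)
    show ?case
    proof (cases "n = 0")
      case True
      interpret R: ring "YH d q (Suc n)" by (rule ring_YH)
      obtain s where "x = yh_scalar d q (Suc n) s" using YH_br_1[OF d True Suc.prems] by blast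
      hence "x = yh_scalar d q (Suc n) s \<otimes>\<^bsub>YH d q (Suc n)\<^esub> \<one>\<^bsub>YH d q (Suc n)\<^esub>" by (simp add: yh_scalar_mem)
      thus ?thesis by (rule scalar)
    next
      case False
      hence n: "1 \<le> n" by simp
      show ?thesis by (rule braid_step[OF d \<tau> n Suc.IH Suc.prems])
    qed
  qed
  thus ?thesis
    by (intro extensional_family_eqI[of \<tau> "YH_br d q"] linear_on_unionD(4)[OF l(1)] linear_on_unionD(4)[OF l(2)])
qed

lemma specialized_trace_eq:
  assumes "d \<ge> 1" "q \<noteq> 0" "D \<subseteq> {..<d}" "D \<noteq> {}"
  shows "specialized_trace d q D = yh_trace d q D"
  unfolding specialized_trace_def
  using is_specialized_yh_trace[OF assms] specialized_trace_unique[OF assms(1,2)] by (intro the_equality) auto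

lemma braid_trace_restrict:
  assumes d: "d \<ge> 1" "q \<noteq> 0" and D: "D \<subseteq> {..<d}" "D \<noteq> {}"
  shows "is_braid_trace d q (card D) (\<lambda>n. restrict (yh_trace d q D n) (YH_br d q n))"
proof -
  let ?T = "yh_trace d q D"
  note l = linear_on_unionD[OF linear_yh_trace[OF d D]]
  have sub: "a \<in> carrier (YH d q n)" if "a \<in> YH_br d q n" for a n
    using that subringE(1)[OF subring_YH_br] by blast
  note br = subringE(3,6,7)[OF subring_YH_br]
  have sc: "yh_scalar d q n s \<in> YH_br d q n" for n s
    by (auto simp: YH_br_def intro: generate_ring.incl)
  have g: "yh_g d q (Suc n) n \<in> YH_br d q (Suc n)" if "1 \<le> n" for n
    using that by (auto simp: YH_br_def intro!: generate_ring.incl)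
  show ?thesis
    unfolding is_braid_trace_def linear_on_union_def Let_def
    using l(1-3) yh_trace_cyc[OF d D] yh_trace_one[OF d D] yh_trace_g[OF d D] yh_trace_e[OF d D]
    by (auto simp: sub br sc g yh_incl_YH_br)
qed

theorem theorem2:
  fixes d m :: nat and q :: complex
  assumes "d \<ge> 1" and "q \<noteq> 0" and "1 \<le> m" and "m \<le> d"
  shows "(\<exists>!\<tau>. is_braid_trace d q m \<tau>) \<and>
    (\<forall>\<tau> D. is_braid_trace d q m \<tau> \<and> D \<subseteq> {..<d} \<and> card D = m \<longrightarrow>
       (\<forall>n. \<forall>a\<in>YH_br d q n. \<tau> n a = specialized_trace d q D n a) \<and>
       (\<forall>n i. 1 \<le> i \<and> i < n \<longrightarrow>
          specialized_trace d q D n (yh_e d q n i) = [:1 / of_nat (card D):] \<and>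
          [:1 / of_nat m:] = specialized_trace d q D n (yh_e d q n i)))"
proof (intro conjI allI impI)
  \<comment> \<open>Existence requires one set with \<open>m\<close> elements, and the initial
    segment serves. Any other \<open>D\<close> of this size restricts to a braid trace for the same
    \<open>m\<close>, so uniqueness gives independence of \<open>D\<close>.\<close>
  have D: "{..<m} \<subseteq> {..<d}" "{..<m} \<noteq> {}" using assms by (auto simp: lessThan_empty_iff)
  show "\<exists>!\<tau>. is_braid_trace d q m \<tau>"
    using braid_trace_restrict[OF assms(1,2) D] braid_trace_unique[OF assms(1,2)] by auto
next
  fix \<tau> D
  assume a: "is_braid_trace d q m \<tau> \<and> D \<subseteq> {..<d} \<and> card D = m"
  hence D: "D \<subseteq> {..<d}" "D \<noteq> {}" using assms(3) by auto
  note T = specialized_trace_eq[OF assms(1,2) D]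
  show "\<forall>a\<in>YH_br d q n. \<tau> n a = specialized_trace d q D n a" for n
    using braid_trace_unique[OF assms(1,2), of m \<tau>] braid_trace_restrict[OF assms(1,2) D] a T by auto
  show "specialized_trace d q D n (yh_e d q n i) = [:1 / of_nat (card D):]"
    "[:1 / of_nat m:] = specialized_trace d q D n (yh_e d q n i)" if "1 \<le> i \<and> i < n" for n i
    using yh_trace_e_const[OF assms(1,2) D, of i n] that a T by simp_all
qed

end
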